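(* Let $n\ge 1$, let $\Omega\subset\mathbb{C}^n$ be a domain and let $\varphi:\Omega\to\mathbb{R}$ be a continuous function. Then $\varphi$ is pluriharmonic on $\Omega$ if and only if the following holds: for every $a\in\Omega$, $r>0$, $s>0$ and $A\in\mathbf{U}(n)$ with $a+P_{r,s,A}\subset\Omega$, there exists a unique holomorphic function $f$ on $a+P_{r,s,A}$ satisfying $f(a)=1$ and \[ \int_{a+P_{r,s,A}}|f|^2e^{-\varphi}\leq |P_{r,s,A}|\,e^{-\varphi(a)} . \]
   Context: A domain is a nonempty connected open set. $\mathbf{U}(n)$ is the group of $n\times n$ unitary matrices. For $r,s>0$ let $\Delta_r=\{z\in\mathbb{C}\mid |z|<r\}$ and, for $m\ge 0$, $\mathbb{B}^m_s=\{z\in\mathbb{C}^m\mid |z|<s\}$ (Euclidean norm). The holomorphic cylinder is $P_{r,s,A}=A(\Delta_r\times\mathbb{B}^{n-1}_s)\subset\mathbb{C}^n$, the image of $\Delta_r\times\mathbb{B}^{n-1}_s$ under $A$ (for $n=1$, $\Delta_r\times\mathbb{B}^{0}_s$ is just $\Delta_r$). Integrals are with respect to Lebesgue measure on $\mathbb{C}^n=\mathbb{R}^{2n}$, and $|P_{r,s,A}|$ denotes the Lebesgue volume of $P_{r,s,A}$. "Unique" means that exactly one holomorphic function $f$ on $a+P_{r,s,A}$ satisfies both $f(a)=1$ and the stated inequality. *)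

theory Defs
  imports "HOL-Analysis.Analysis"
begin

text \<open>
  \<open>complex ^ 'n\<close> plays the role of complex Euclidean \<open>n\<close>-space with \<open>n = CARD('n)\<close>. Its norm is the
  Euclidean one, and \<^const>\<open>lborel\<close> on it is Lebesgue measure of the underlying real
  \<open>2n\<close>-dimensional space.
\<close>

definition cdomain :: "(complex ^ 'n) set \<Rightarrow> bool" where
  "cdomain \<Omega> \<longleftrightarrow> \<Omega> \<noteq> {} \<and> open \<Omega> \<and> connected \<Omega>"

definition conj_transpose :: "complex ^ 'm ^ 'n \<Rightarrow> complex ^ 'n ^ 'm" where
  "conj_transpose A = map_matrix cnj (transpose A)"

definition unitary_group :: "(complex ^ 'n ^ 'n) set" where
  "unitary_group = {A. conj_transpose A ** A = mat 1 \<and> A ** conj_transpose A = mat 1}"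

text \<open>
  The index type \<open>'n\<close> carries no order, so the coordinate of the disc factor is a parameter \<open>p\<close>; the
  remaining coordinates form the ball factor. For \<open>CARD('n) = 1\<close> the second condition reads \<open>0 < s\<close>.
\<close>

definition disc_times_ball :: "'n \<Rightarrow> real \<Rightarrow> real \<Rightarrow> (complex ^ 'n) set" where
  "disc_times_ball p r s =
     {z. cmod (z $ p) < r \<and> L2_set (\<lambda>j. cmod (z $ j)) (UNIV - {p}) < s}"

definition holomorphic_cylinder ::
    "'n \<Rightarrow> real \<Rightarrow> real \<Rightarrow> complex ^ 'n ^ 'n \<Rightarrow> (complex ^ 'n) set" where
  "holomorphic_cylinder p r s A = (\<lambda>z. A *v z) ` disc_times_ball p r s"

text \<open>
  Holomorphy in several variables: the real Frechet derivative exists and is complex linear. It is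
  meant for open sets.
\<close>

definition holomorphic_several_on ::
    "(complex ^ 'n \<Rightarrow> complex) \<Rightarrow> (complex ^ 'n) set \<Rightarrow> bool" where
  "holomorphic_several_on f S \<longleftrightarrow>
     (\<forall>z\<in>S. \<exists>D. (f has_derivative D) (at z) \<and> (\<forall>c v. D (c *s v) = c * D v))"

definition C2_on ::
    "('a::real_normed_vector \<Rightarrow> 'b::real_normed_vector) \<Rightarrow> 'a set \<Rightarrow> bool" where
  "C2_on f S \<longleftrightarrow>
     (\<exists>(f' :: 'a \<Rightarrow> 'a \<Rightarrow>\<^sub>L 'b) (f'' :: 'a \<Rightarrow> 'a \<Rightarrow>\<^sub>L ('a \<Rightarrow>\<^sub>L 'b)).
        (\<forall>z\<in>S. (f has_derivative blinfun_apply (f' z)) (at z)) \<and>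
        (\<forall>z\<in>S. (f' has_derivative blinfun_apply (f'' z)) (at z)) \<and>
        continuous_on S f'')"

text \<open>
  The Wirtinger derivatives with respect to \<open>z\<^sub>j\<close> and its conjugate. The directions
  \<open>axis j 1\<close> and \<open>axis j \<i>\<close> are those of the real coordinates \<open>x\<^sub>j\<close> and \<open>y\<^sub>j\<close>.
\<close>

definition wirtinger :: "'n \<Rightarrow> (complex ^ 'n \<Rightarrow> complex) \<Rightarrow> complex ^ 'n \<Rightarrow> complex" where
  "wirtinger j f z =
     (frechet_derivative f (at z) (axis j 1) - \<i> * frechet_derivative f (at z) (axis j \<i>)) / 2"

definition wirtinger_bar :: "'n \<Rightarrow> (complex ^ 'n \<Rightarrow> complex) \<Rightarrow> complex ^ 'n \<Rightarrow> complex" where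
  "wirtinger_bar j f z =
     (frechet_derivative f (at z) (axis j 1) + \<i> * frechet_derivative f (at z) (axis j \<i>)) / 2"

definition pluriharmonic_on :: "(complex ^ 'n \<Rightarrow> real) \<Rightarrow> (complex ^ 'n) set \<Rightarrow> bool" where
  "pluriharmonic_on \<phi> \<Omega> \<longleftrightarrow>
     C2_on \<phi> \<Omega> \<and>
     (\<forall>z\<in>\<Omega>. \<forall>j k. wirtinger j (wirtinger_bar k (\<lambda>w. complex_of_real (\<phi> w))) z = 0)"

end

theory Submission
  imports Defs "HOL-Complex_Analysis.Complex_Analysis"
begin

text \<open>
  If \<open>\<phi>\<close> is pluriharmonic, then \<open>\<phi> - \<phi>(a) = Re h\<close> on the cylinder with \<open>h\<close> holomorphic and \<open>h(a) = 0\<close>,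
  and \<open>exp (h/2)\<close> attains equality. Dividing a competitor by it gives a holomorphic \<open>g\<close> with \<open>g(a) = 1\<close> and
  mean square at most \<open>1\<close>; since the cylinder is circular, the mean of \<open>g\<close> is \<open>1\<close>, so the mean of \<open>|g - 1|\<^sup>2\<close>
  is at most \<open>0\<close>.

  Conversely, apply the hypothesis to cylinders that shrink to a disc in a complex line. Existence forbids that
  \<open>\<phi>\<close> is touched strictly from above on the line by a function \<open>Re H - \<epsilon>|\<zeta>|\<^sup>2\<close>, and uniqueness forbids strict
  touching from below, as \<open>exp (H/2)\<close> and its small perturbations would all be admissible. Both comparison
  principles hold against real parts of polynomials, which are dense in the continuous functions on a circle;
  hence \<open>\<phi>\<close> has the mean value property on all circles in complex lines. Therefore \<open>\<phi>\<close> is locally a constant multiple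
  of its convolution with a radial bump function, so it is \<open>C\<^sup>2\<close>, and Taylor expansion of the circle means
  shows that the Levi form vanishes.
\<close>

section \<open>Means over circles\<close>

text \<open>The hypothesis compares integrals over sets of full dimension, while strict touching
  concerns a single complex line; the independence of the two radii bridges this. A gain of
  \<open>\<epsilon> * |\<zeta>|^2\<close> on the line is worth a fixed factor on average, governed
  by a constant \<open>\<kappa> < 1\<close> that depends on \<open>r\<close> and
  \<open>\<epsilon>\<close> but not on \<open>s\<close>, since at least half of the volume has
  \<open>|\<zeta>| >= r / 2\<close>. So \<open>s\<close> is chosen last, so small that the
  oscillation of \<open>\<phi>\<close> transversally to the line is paid for by that factor.
  Strictness comes for free: a violated comparison with \<open>Re h\<close> at an interior point
  survives the addition of a small multiple of \<open>|\<zeta>|^2\<close>, and expanding that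
  multiple about the maximum point produces, besides the strict term, only a constant and the real
  part of a linear polynomial. Boundary data on a circle have to be matched only approximately, so
  no Dirichlet problem is solved: two-sided comparison carries the error from the circle to the
  centre. Functions are total, so uniqueness on a set is expressed through
  \<open>extensional\<close>; the proof works with agreement on the set instead.\<close>

lemma nn_integral_lborel_translate:
  fixes c :: "'a::euclidean_space"
  assumes [measurable]: "f \<in> borel_measurable borel"
  shows "(\<integral>\<^sup>+x. f (c + x) \<partial>lborel) = (\<integral>\<^sup>+x. f x \<partial>lborel)"
proof -
  have "(\<integral>\<^sup>+x. f x \<partial>lborel) = (\<integral>\<^sup>+x. f x \<partial>distr lborel borel ((+) c))"
    by (simp add: lborel_distr_plus)
  also have "\<dots> = (\<integral>\<^sup>+x. f (c + x) \<partial>lborel)"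
    by (subst nn_integral_distr) auto
  finally show ?thesis by simp
qed

text \<open>
  Uniqueness of translation invariant measures: comparing the two orders of integration of
  \<open>1_B(y) 1_E(T x + y)\<close>, with \<open>B\<close> the unit ball, gives the claim, since \<open>T\<close> preserves \<open>B\<close>.
\<close>

lemma lborel_distr_isometry:
  fixes T :: "'a::euclidean_space \<Rightarrow> 'a"
  assumes lin: "linear T" and nrm: "\<And>x. norm (T x) = norm x"
  shows "distr lborel borel T = lborel"
proof (rule measure_eqI)
  show "sets (distr lborel borel T) = sets (lborel :: 'a measure)" by simp
next
  fix E assume "E \<in> sets (distr lborel borel T)"
  then have E[measurable]: "E \<in> sets borel" by simp
  have "continuous_on UNIV T" using lin linear_continuous_on linear_conv_bounded_linear by blast
  then have T[measurable]: "T \<in> borel_measurable borel" by (rule borel_measurable_continuous_onI)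
  have inj: "inj T"
    by (metis lin nrm linear_injective_0 norm_eq_zero)
  then have "surj T" using lin linear_injective_imp_surjective by blast
  then obtain T' where T': "\<And>y. T (T' y) = y" by (metis surjD)
  define B where "B = (ball 0 1 :: 'a set)"
  have B[measurable]: "B \<in> sets borel" by (simp add: B_def)
  have TB: "T x \<in> B \<longleftrightarrow> x \<in> B" for x by (simp add: B_def nrm)
  let ?i = "indicator :: 'a set \<Rightarrow> 'a \<Rightarrow> ennreal"
  have P: "pair_sigma_finite (lborel :: 'a measure) (lborel :: 'a measure)" ..
  define \<beta> where "\<beta> = emeasure lborel B"
  have "emeasure lborel B \<noteq> \<infinity>" "emeasure lborel B \<noteq> 0"
    using emeasure_lborel_ball_finite[of "0::'a" 1] content_ball_gt_0_iff[of "0::'a" 1]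
    by (auto simp: B_def measure_def)
  then have \<beta>: "\<beta> \<noteq> \<infinity>" "\<beta> \<noteq> 0" by (simp_all add: \<beta>_def)
  have em: "emeasure (distr lborel borel T) E = (\<integral>\<^sup>+x. ?i E (T x) \<partial>lborel)"
    using nn_integral_distr[of T lborel borel "?i E"] by simp
  \<comment> \<open>\<open>T x + y = T (x + T' y)\<close>, so translation invariance in
    \<open>x\<close> absorbs \<open>y\<close>.\<close>
  have tr: "(\<integral>\<^sup>+x. ?i E (T x) \<partial>lborel) = (\<integral>\<^sup>+x. ?i E (T x + y) \<partial>lborel)" for y
    using nn_integral_lborel_translate[of "\<lambda>x. ?i E (T x)" "T' y"]
    by (simp add: linear_add[OF lin] T' add.commute)
  have "\<beta> * (\<integral>\<^sup>+x. ?i E (T x) \<partial>lborel) = (\<integral>\<^sup>+y. ?i B y * (\<integral>\<^sup>+x. ?i E (T x) \<partial>lborel) \<partial>lborel)"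
    by (simp add: nn_integral_multc \<beta>_def)
  also have "\<dots> = (\<integral>\<^sup>+y. (\<integral>\<^sup>+x. ?i B y * ?i E (T x + y) \<partial>lborel) \<partial>lborel)"
    by (intro nn_integral_cong) (simp add: nn_integral_cmult tr[symmetric])
  also have "\<dots> = (\<integral>\<^sup>+x. (\<integral>\<^sup>+y. ?i B y * ?i E (T x + y) \<partial>lborel) \<partial>lborel)"
    by (rule pair_sigma_finite.Fubini'[OF P]) measurable
  also have "\<dots> = (\<integral>\<^sup>+x. (\<integral>\<^sup>+y. ?i B (- T x + y) * ?i E y \<partial>lborel) \<partial>lborel)"
    using nn_integral_lborel_translate[of "\<lambda>y. ?i B y * ?i E (T x + y)" "- T x" for x]
    by (simp add: add.assoc[symmetric])
  also have "\<dots> = (\<integral>\<^sup>+y. (\<integral>\<^sup>+x. ?i B (- T x + y) * ?i E y \<partial>lborel) \<partial>lborel)"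
    by (rule pair_sigma_finite.Fubini'[OF P]) measurable
  also have "\<dots> = (\<integral>\<^sup>+y. \<beta> * ?i E y \<partial>lborel)"
  proof (intro nn_integral_cong)
    fix y
    have "?i B (- T x + y) = ?i B (- T' y + x)" for x
    proof -
      have "- T x + y = - (T (- T' y + x))"
        by (simp add: linear_add[OF lin] linear_diff[OF lin] T')
      then have "norm (- T x + y) = norm (- T' y + x)"
        using norm_minus_cancel nrm by metis
      then show ?thesis by (simp add: B_def indicator_def)
    qed
    then have "(\<integral>\<^sup>+x. ?i B (- T x + y) * ?i E y \<partial>lborel) = (\<integral>\<^sup>+x. ?i B (- T' y + x) \<partial>lborel) * ?i E y"
      by (simp add: nn_integral_multc)
    also have "(\<integral>\<^sup>+x. ?i B (- T' y + x) \<partial>lborel) = \<beta>"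
      by (subst nn_integral_lborel_translate) (simp_all add: \<beta>_def)
    finally show "(\<integral>\<^sup>+x. ?i B (- T x + y) * ?i E y \<partial>lborel) = \<beta> * ?i E y" .
  qed
  also have "\<dots> = \<beta> * emeasure lborel E" by (simp add: nn_integral_cmult)
  finally show "emeasure (distr lborel borel T) E = emeasure lborel E"
    unfolding em using \<beta> by (simp add: ennreal_mult_cancel_left)
qed

lemma linear_csmult: "linear ((*s) (c::complex) :: complex ^ 'n \<Rightarrow> complex ^ 'n)"
  by (rule linearI) (auto simp: vec_eq_iff algebra_simps)

lemma bounded_linear_csmult: "bounded_linear ((*s) (c::complex) :: complex ^ 'n \<Rightarrow> complex ^ 'n)"
  using linear_csmult linear_conv_bounded_linear by blast

lemma norm_csmult: "norm (c *s (z :: complex ^ 'n)) = cmod c * norm z"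
  by (simp add: norm_vec_def norm_mult L2_set_right_distrib)

lemma continuous_on_csmult [continuous_intros]:
  fixes f :: "'a::topological_space \<Rightarrow> complex" and g :: "'a \<Rightarrow> complex ^ 'n"
  assumes "continuous_on S f" "continuous_on S g"
  shows "continuous_on S (\<lambda>x. f x *s g x)"
  unfolding vector_scalar_mult_def
  by (intro continuous_on_vec_lambda continuous_intros assms)

text \<open>Each rotation \<open>z \<mapsto> cis t *s z\<close> is an isometry preserving
  \<open>S\<close>, so it does not change the integral of \<open>G\<close>; averaging over
  \<open>t\<close> and exchanging the integrals replaces \<open>G\<close> by its means over circles.
  \<open>M\<close> is left general because it is a constant for holomorphic \<open>G\<close>, but a
  radial weight times a constant in the convolution argument.\<close>

lemma set_integral_circle_mean:
  fixes G M :: "complex ^ 'n \<Rightarrow> 'b::{banach, second_countable_topology}"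
  assumes S: "open S" and circ: "\<And>c z. cmod c = 1 \<Longrightarrow> z \<in> S \<Longrightarrow> c *s z \<in> S"
    and cont: "continuous_on S G" and int: "set_integrable lborel S G"
    and M: "\<And>z. z \<in> S \<Longrightarrow> (LINT t:{0..1}|lborel. G (cis (2 * pi * t) *s z)) = M z"
  shows "(LINT z:S|lborel. G z) = (LINT z:S|lborel. M z)"
proof -
  define K where "K = (\<lambda>z. indicat_real S z *\<^sub>R G z)"
  have K: "K \<in> borel_measurable borel" "integrable lborel K"
    using int borel_measurable_continuous_on_indicator[OF _ cont] S
    by (auto simp: K_def set_integrable_def)
  note [measurable] = K(1)
  have P: "pair_sigma_finite (lborel :: real measure) (lborel :: (complex ^ 'n) measure)" ..
  define F where "F = (\<lambda>(t::real) (z::complex ^ 'n). indicat_real {0..1} t *\<^sub>R K (cis (2 * pi * t) *s z))"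
  have "continuous_on UNIV (\<lambda>x. cis (2 * pi * fst x) *s snd x :: complex ^ 'n)"
    by (intro continuous_intros continuous_on_cis)
  then have "(\<lambda>x. cis (2 * pi * fst x) *s snd x :: complex ^ 'n) \<in> borel_measurable borel"
    by (rule borel_measurable_continuous_onI)
  then have [measurable]: "(\<lambda>x. cis (2 * pi * fst x) *s snd x :: complex ^ 'n) \<in> borel_measurable (borel \<Otimes>\<^sub>M borel)"
    by (simp add: borel_prod)
  have Fm[measurable]: "case_prod F \<in> borel_measurable (lborel \<Otimes>\<^sub>M lborel)"
    unfolding F_def case_prod_beta by measurable
  have rot: "distr lborel borel ((*s) (cis t)) = (lborel :: (complex ^ 'n) measure)" for t
    by (rule lborel_distr_isometry) (auto simp: linear_csmult norm_csmult)
  have [measurable]: "(*s) c \<in> borel_measurable (borel :: (complex ^ 'n) measure)" for c :: complex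
    by (intro borel_measurable_continuous_onI linear_continuous_on bounded_linear_csmult)
  have rK: "(LINT z|lborel. H (cis t *s z)) = (LINT z|lborel. H z)"
    if [measurable]: "H \<in> borel_measurable borel" for H :: "complex ^ 'n \<Rightarrow> 'c::{banach, second_countable_topology}" and t
    by (subst rot[of t, symmetric], subst integral_distr) auto
  have rI: "integrable lborel (\<lambda>z. K (cis t *s z))" for t
    using K(2) by (subst (asm) rot[of t, symmetric], subst (asm) integrable_distr_eq) auto
  \<comment> \<open>By rotation invariance the integral of the norm over \<open>z\<close> is the
    same number for every \<open>t\<close> in \<open>{0..1}\<close> and vanishes for other
    \<open>t\<close>, so the iterated integral is finite.\<close>
  have intF: "integrable (lborel \<Otimes>\<^sub>M lborel) (case_prod F)"
  proof (rule pair_sigma_finite.Fubini_integrable[OF P Fm])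
    have "(LINT z|lborel. norm (case_prod F (t, z))) = indicat_real {0..1} t * (LINT z|lborel. norm (K z))" for t
      using rK[of "\<lambda>z. norm (K z)" "2 * pi * t"] by (simp add: F_def)
    then show "integrable lborel (\<lambda>t. LINT z|lborel. norm (case_prod F (t, z)))"
      by simp
    show "AE t in lborel. integrable lborel (\<lambda>z. case_prod F (t, z))"
      by (simp add: F_def rI)
  qed
  have "(LINT z:S|lborel. G z) = (LINT t:{0..1::real}|lborel. (LINT z|lborel. K z))"
    by (simp add: K_def set_lebesgue_integral_def)
  also have "\<dots> = (LINT t|lborel. (LINT z|lborel. F t z))"
    unfolding set_lebesgue_integral_def
    by (intro Bochner_Integration.integral_cong) (simp_all add: F_def rK)
  also have "\<dots> = (LINT z|lborel. (LINT t|lborel. F t z))"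
    using pair_sigma_finite.Fubini_integral[OF P intF] by simp
  also have "\<dots> = (LINT z:S|lborel. M z)"
    unfolding set_lebesgue_integral_def[of _ S]
  proof (intro Bochner_Integration.integral_cong refl)
    fix z :: "complex ^ 'n"
    have "cis t *s z \<in> S \<longleftrightarrow> z \<in> S" for t
    proof
      assume "cis t *s z \<in> S"
      then have "cis (-t) *s (cis t *s z) \<in> S" by (rule circ[rotated]) auto
      moreover have "cis (-t) *s (cis t *s z) = z"
        by (simp add: cis_mult)
      ultimately show "z \<in> S" by simp
    qed (auto intro: circ)
    then have "(LINT t|lborel. F t z) = indicat_real S z *\<^sub>R (LINT t:{0..1}|lborel. G (cis (2 * pi * t) *s z))"
      unfolding set_lebesgue_integral_def
      by (subst Bochner_Integration.integral_scaleR_right[symmetric], intro Bochner_Integration.integral_cong)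
         (simp_all add: F_def K_def indicator_def)
    then show "(LINT t|lborel. F t z) = indicat_real S z *\<^sub>R M z"
      using M by (cases "z \<in> S") auto
  qed
  finally show ?thesis .
qed

text \<open>The substitution \<open>u = cis (2\<pi>t)\<close> turns the Cauchy integral formula at the centre into this.\<close>

lemma circle_mean_holomorphic:
  assumes "open U" "cball 0 1 \<subseteq> U" "G holomorphic_on U"
  shows "(LINT t:{0..1}|lborel. G (cis (2 * pi * t))) = G 0"
proof -
  have "((\<lambda>u. G u / (u - 0)) has_contour_integral (2 * of_real pi * \<i> * G 0)) (circlepath 0 1)"
    using holomorphic_on_subset[OF assms(3) assms(2)] ball_subset_cball[of "0::complex" 1]
    by (intro Cauchy_integral_circlepath)
       (auto intro: holomorphic_on_imp_continuous_on holomorphic_on_subset)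
  then have "((\<lambda>t. G (circlepath 0 1 t) / (circlepath 0 1 t) * (2 * pi * \<i> * exp (2 * pi * \<i> * t)))
      has_integral (2 * of_real pi * \<i> * G 0)) {0..1}"
    unfolding has_contour_integral_def
    by (rule has_integral_eq[rotated]) (simp add: vector_derivative_circlepath01)
  then have "((\<lambda>t. G (cis (2 * pi * t)) * (2 * pi * \<i>)) has_integral (2 * of_real pi * \<i> * G 0)) {0..1}"
    by (rule has_integral_eq[rotated]) (simp add: circlepath cis_conv_exp mult_ac)
  from has_integral_mult_left[OF this, of "1 / (2 * pi * \<i>)"]
  have hi: "((\<lambda>t. G (cis (2 * pi * t))) has_integral G 0) {0..1}"
    by (simp add: field_simps)
  have "continuous_on {0..1} (\<lambda>t. G (cis (2 * pi * t)))"
    by (rule continuous_on_compose2[of U])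
       (use assms in \<open>auto intro!: holomorphic_on_imp_continuous_on continuous_intros continuous_on_cis\<close>)
  then have "set_integrable lborel {0..1} (\<lambda>t. G (cis (2 * pi * t)))"
    by (rule borel_integrable_atLeastAtMost')
  then show ?thesis
    using hi by (simp add: set_borel_integral_eq_integral integral_unique)
qed

section \<open>Unitary matrices and cylinders\<close>

text \<open>The Hermitian product, conjugate linear in \<open>w\<close>. For a unit vector
  \<open>w\<close>, \<open>cdot w z *s w\<close> is the orthogonal projection of \<open>z\<close> to
  the complex line of \<open>w\<close>.\<close>

definition cdot :: "complex ^ 'n \<Rightarrow> complex ^ 'n \<Rightarrow> complex" where
  "cdot w z = (\<Sum>j\<in>UNIV. cnj (w $ j) * z $ j)"

text \<open>The holomorphic cylinder without its matrix: it depends on the unitary map only through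
  the unit vector \<open>w\<close> that spans the line of the disc factor. This form also has no
  distinguished coordinate.\<close>

definition cyl :: "complex ^ 'n \<Rightarrow> real \<Rightarrow> real \<Rightarrow> (complex ^ 'n) set" where
  "cyl w r s = {z. cmod (cdot w z) < r \<and> norm (z - cdot w z *s w) < s}"

lemma cdot_add: "cdot w (x + y) = cdot w x + cdot w y"
  by (simp add: cdot_def algebra_simps sum.distrib)

lemma cdot_diff: "cdot w (x - y) = cdot w x - cdot w y"
  by (simp add: cdot_def algebra_simps sum_subtractf)

lemma cdot_cscale: "cdot w (c *s x) = c * cdot w x"
  by (simp add: cdot_def sum_distrib_left algebra_simps)

lemma cdot_0 [simp]: "cdot w 0 = 0"
  by (simp add: cdot_def)

lemma cdot_axis: "cdot (axis p 1) z = z $ p"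
  by (simp add: cdot_def axis_def if_distrib[of cnj] if_distrib[of "\<lambda>x. x * _"] cong: if_cong)

lemma cdot_axis_right: "cdot w (axis p 1) = cnj (w $ p)"
  by (simp add: cdot_def axis_def if_distrib[of "\<lambda>x. _ * x"] cong: if_cong)

lemma scaleR_eq_cscale: "r *\<^sub>R (z :: complex ^ 'n) = complex_of_real r *s z"
  by (simp add: vec_eq_iff) (simp add: scaleR_conv_of_real)

lemma bounded_linear_cdot: "bounded_linear (cdot w)"
  by (intro linear_conv_bounded_linear[THEN iffD1] linearI)
     (auto simp: cdot_add scaleR_eq_cscale cdot_cscale scaleR_conv_of_real)

lemma continuous_on_cdot [continuous_intros]:
  "continuous_on S f \<Longrightarrow> continuous_on S (\<lambda>x. cdot w (f x))"
  by (rule continuous_on_compose2[OF linear_continuous_on[OF bounded_linear_cdot, of UNIV]]) auto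

lemma cdot_self: "cdot z z = of_real ((norm z)\<^sup>2)"
  by (simp add: cdot_def norm_vec_def L2_set_def sum_nonneg mult.commute
      complex_norm_square[unfolded of_real_power])

lemma cdot_adjoint: "cdot (A *v x) y = cdot x (conj_transpose A *v y)"
proof -
  have "cdot (A *v x) y = (\<Sum>i\<in>UNIV. \<Sum>j\<in>UNIV. cnj (A $ i $ j) * cnj (x $ j) * y $ i)"
    by (simp add: cdot_def matrix_vector_mult_def sum_distrib_right)
  also have "\<dots> = (\<Sum>j\<in>UNIV. \<Sum>i\<in>UNIV. cnj (A $ i $ j) * cnj (x $ j) * y $ i)"
    by (rule sum.swap)
  also have "\<dots> = cdot x (conj_transpose A *v y)"
    by (simp add: cdot_def matrix_vector_mult_def conj_transpose_def transpose_def map_matrix_def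
        sum_distrib_left mult_ac)
  finally show ?thesis .
qed

lemma cdot_unitary:
  assumes "A \<in> unitary_group"
  shows "cdot (A *v x) (A *v y) = cdot x y"
proof -
  have "conj_transpose A *v (A *v y) = y"
    using assms by (simp add: unitary_group_def matrix_vector_mul_assoc)
  then show ?thesis by (simp add: cdot_adjoint)
qed

lemma norm_unitary:
  assumes "A \<in> unitary_group"
  shows "norm (A *v x) = norm x"
proof -
  have "complex_of_real ((norm (A *v x))\<^sup>2) = of_real ((norm x)\<^sup>2)"
    using cdot_unitary[OF assms, of x x] by (simp only: cdot_self)
  then show ?thesis by (simp add: power2_eq_iff_nonneg del: of_real_power)
qed

lemma L2_set_off_coordinate:
  fixes x :: "complex ^ 'n"
  shows "L2_set (\<lambda>j. cmod (x $ j)) (UNIV - {p}) = norm (x - x $ p *s axis p 1)"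
proof -
  have "(\<Sum>j\<in>UNIV. (cmod ((x - x $ p *s axis p 1) $ j))\<^sup>2) = (\<Sum>j\<in>UNIV - {p}. (cmod (x $ j))\<^sup>2)"
    by (rule sum.mono_neutral_cong_right) (auto simp: axis_def)
  then show ?thesis by (simp only: norm_vec_def L2_set_def)
qed

text \<open>A unitary matrix preserves \<open>cdot\<close> and the norm, so the coordinate
  \<open>p\<close> of \<open>x\<close> is the \<open>cdot\<close> of \<open>A *v x\<close> with the
  image of \<open>axis p 1\<close>, and the norm of the remaining coordinates is the distance of
  \<open>A *v x\<close> from the line of that image.\<close>

lemma holomorphic_cylinder_eq_cyl:
  assumes A: "A \<in> unitary_group"
  shows "holomorphic_cylinder p r s A = cyl (A *v axis p 1) r s"
proof -
  let ?w = "A *v axis p 1"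
  have iff: "x \<in> disc_times_ball p r s \<longleftrightarrow> A *v x \<in> cyl ?w r s" for x
  proof -
    have "cdot ?w (A *v x) = x $ p" by (simp add: cdot_unitary[OF A] cdot_axis)
    moreover have "A *v x - x $ p *s ?w = A *v (x - x $ p *s axis p 1)"
      by (simp add: matrix_vector_mult_diff_distrib vector_scalar_commute)
    ultimately show ?thesis
      by (simp add: disc_times_ball_def cyl_def L2_set_off_coordinate norm_unitary[OF A])
  qed
  have "y \<in> (\<lambda>z. A *v z) ` disc_times_ball p r s" if "y \<in> cyl ?w r s" for y
  proof
    have "A *v (conj_transpose A *v y) = y"
      using A by (simp add: unitary_group_def matrix_vector_mul_assoc)
    then show "y = A *v (conj_transpose A *v y)" "conj_transpose A *v y \<in> disc_times_ball p r s"
      using that iff by auto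
  qed
  then show ?thesis
    unfolding holomorphic_cylinder_def using iff by blast
qed

text \<open>
  A Householder reflection: with the unimodular \<open>c\<close> chosen so that \<open>cdot w (c *s axis p 1)\<close> is real,
  reflecting in \<open>v = w - c *s axis p 1\<close> exchanges \<open>w\<close> and \<open>c *s axis p 1\<close>. If \<open>v = 0\<close>, the division
  by zero makes the reflection the identity, as it should be.
\<close>

lemma unitary_with_column:
  fixes w :: "complex ^ 'n"
  assumes w: "norm w = 1"
  obtains A where "A \<in> unitary_group" "A *v axis p 1 = w"
proof -
  define c where "c = (if w $ p = 0 then 1 else w $ p / cmod (w $ p))"
  define v where "v = w - c *s axis p 1"
  define N where "N = cdot v v"
  define R :: "complex ^ 'n ^ 'n" where
    "R = (\<chi> i j. (if i = j then 1 else 0) - 2 * v $ i * cnj (v $ j) / N)"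
  \<comment> \<open>The reflection \<open>R\<close> sends \<open>c *s axis p 1\<close> to
    \<open>w\<close>, so \<open>c R\<close> sends \<open>axis p 1\<close> to \<open>w\<close>; as
    \<open>c\<close> is unimodular, the product is still unitary.\<close>
  define A where "A = (\<chi> i j. c * R $ i $ j)"
  have cc: "cnj c * c = 1"
    using complex_norm_square[of "w $ p"]
    by (simp add: c_def power2_eq_square nonzero_divide_eq_eq mult.commute)
  have cw: "cnj (w $ p) * c = cmod (w $ p)"
    by (simp add: c_def power2_eq_square nonzero_divide_eq_eq mult.commute
        complex_norm_square[unfolded of_real_power, symmetric])
  have N0: "N = 0 \<longleftrightarrow> v = 0" and Nc: "cnj N = N" by (simp_all add: N_def cdot_self)
  have R: "R *v z = z - (2 * cdot v z / N) *s v" for z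
  proof -
    have "(R *v z) $ i = (z - (2 * cdot v z / N) *s v) $ i" for i
    proof -
      have "(R *v z) $ i = z $ i - (\<Sum>j\<in>UNIV. 2 * v $ i * cnj (v $ j) / N * z $ j)"
        by (simp add: R_def matrix_vector_mult_def left_diff_distrib sum_subtractf
            if_distrib[of "\<lambda>x. x * _"] cong: if_cong)
      also have "(\<Sum>j\<in>UNIV. 2 * v $ i * cnj (v $ j) / N * z $ j) = 2 * cdot v z / N * v $ i"
        by (simp add: cdot_def sum_distrib_left sum_distrib_right sum_divide_distrib mult_ac)
      finally show ?thesis by simp
    qed
    then show ?thesis by (intro vec_eq_iff[THEN iffD2] allI)
  qed
  have RR: "R *v (R *v z) = z" for z
  proof (cases "v = 0")
    case False
    then have "cdot v (z - (2 * cdot v z / N) *s v) = - cdot v z"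
      using N0 by (simp add: cdot_diff cdot_cscale N_def[symmetric])
    then show ?thesis
      unfolding R by (simp add: vec_eq_iff)
  qed (simp add: R)
  have Rc: "R *v (b *s z) = b *s (R *v z)" for b z
    by (simp add: vector_scalar_commute)
  have Av: "A *v z = c *s (R *v z)" for z
    by (simp add: A_def matrix_vector_mult_def vec_eq_iff sum_distrib_left mult.assoc)
  have ct: "conj_transpose A $ i $ j = cnj c * R $ i $ j" for i j
    by (simp add: conj_transpose_def A_def transpose_def map_matrix_def R_def Nc)
  have Bv: "conj_transpose A *v z = cnj c *s (R *v z)" for z
    by (simp add: ct matrix_vector_mult_def vec_eq_iff sum_distrib_left mult.assoc)
  have "conj_transpose A ** A = mat 1" "A ** conj_transpose A = mat 1"
    using cc by (simp_all add: matrix_eq matrix_vector_mul_assoc[symmetric] Av Bv Rc RR mult.commute[of c])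
  then have "A \<in> unitary_group" by (simp add: unitary_group_def)
  moreover have "A *v axis p 1 = w"
  proof -
    let ?t = "complex_of_real (cmod (w $ p))"
    have "cdot v z = cdot w z - cdot (c *s axis p 1) z" for z
      by (simp add: v_def cdot_def left_diff_distrib sum_subtractf)
    moreover have "cdot (c *s axis p 1) z = cnj c * cdot (axis p 1) z" for z
      by (simp add: cdot_def sum_distrib_left mult.assoc)
    ultimately have cvr: "cdot v z = cdot w z - cnj c * z $ p" for z
      by (simp add: cdot_axis)
    have "cnj c * (c *s axis p 1) $ p = 1" using cc by simp
    then have 1: "cdot v (c *s axis p 1) = ?t - 1"
      unfolding cvr using cw by (simp add: cdot_cscale cdot_axis_right mult.commute[of c])
    have "cnj c * w $ p = cnj (cnj (w $ p) * c)" by simp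
    then have "cdot v w = 1 - ?t" unfolding cvr cw by (simp add: cdot_self w)
    \<comment> \<open>Thus \<open>N\<close> is \<open>-2 * cdot v (c *s axis p 1)\<close>, and the
      coefficient of \<open>v\<close> in the reflection is \<open>1\<close>: the vector
      \<open>v\<close> is added exactly once.\<close>
    then have 2: "N = 2 - 2 * ?t"
      using 1 unfolding N_def by (subst (2) v_def) (simp add: cdot_diff)
    have "c *s (R *v axis p 1) = R *v (c *s axis p 1)" by (simp add: Rc)
    also have "\<dots> = c *s axis p 1 + v"
    proof (cases "v = 0")
      case False
      then have "2 * cdot v (c *s axis p 1) / N = -1"
        using N0 1 2 by (simp add: divide_eq_eq)
      then show ?thesis unfolding R by (simp add: vec_eq_iff)
    qed (simp add: R)
    also have "\<dots> = w" by (simp add: v_def)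
    finally show ?thesis by (simp add: Av)
  qed
  ultimately show ?thesis by (rule that)
qed

section \<open>Topology and volume of cylinders\<close>

lemma open_cyl: "open (cyl w r s)"
  unfolding cyl_def by (intro open_Collect_conj open_Collect_less continuous_intros)

lemma borel_cyl [measurable]: "cyl w r s \<in> sets borel"
  by (intro borel_open open_cyl)

lemma zero_in_cyl: "0 < r \<Longrightarrow> 0 < s \<Longrightarrow> 0 \<in> cyl w r s"
  by (simp add: cyl_def)

text \<open>Both defining quantities scale by \<open>cmod c\<close>. Unimodular \<open>c\<close>
  give circularity, real \<open>c\<close> in the unit interval give star-shapedness about
  \<open>0\<close>, and the closed unit disc of scalars gives the analytic discs on which means are
  computed.\<close>

lemma cscale_in_cyl:
  assumes "z \<in> cyl w r s" "cmod c \<le> 1"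
  shows "c *s z \<in> cyl w r s"
proof -
  have "c *s z - (c * cdot w z) *s w = c *s (z - cdot w z *s w)"
    by (simp add: vec_eq_iff algebra_simps)
  then have "norm (c *s z - (c * cdot w z) *s w) = cmod c * norm (z - cdot w z *s w)"
    by (simp only: norm_csmult)
  moreover have "cmod c * a < b" if "a < b" "0 \<le> a" for a b :: real
    using mult_right_mono[OF assms(2) that(2)] that(1) by simp
  ultimately have "norm (c *s z - (c * cdot w z) *s w) < s" "cmod c * cmod (cdot w z) < r"
    using assms(1) by (simp_all add: cyl_def)
  then show ?thesis
    unfolding cyl_def mem_Collect_eq cdot_cscale norm_mult by blast
qed

lemma norm_cyl_less:
  assumes "z \<in> cyl w r s" "norm w = 1"
  shows "norm z < r + s"
proof -
  have "norm z \<le> norm (cdot w z *s w) + norm (z - cdot w z *s w)"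
    using norm_triangle_ineq[of "cdot w z *s w" "z - cdot w z *s w"] by simp
  then show ?thesis using assms by (simp add: cyl_def norm_csmult)
qed

lemma emeasure_cyl_finite: "norm w = 1 \<Longrightarrow> emeasure lborel (cyl w r s) < \<infinity>"
  by (rule emeasure_bounded_finite, rule bounded_subset[OF bounded_ball[of 0 "r + s"]])
     (simp add: norm_cyl_less subset_iff)

lemma measure_cyl_pos:
  fixes w :: "complex ^ 'n"
  assumes "norm w = 1" "0 < r" "0 < s"
  shows "0 < measure lborel (cyl w r s)"
proof -
  obtain e where e: "0 < e" "ball 0 e \<subseteq> cyl w r s"
    using open_contains_ball[of "cyl w r s"] open_cyl[of w r s] zero_in_cyl[OF assms(2,3)] by blast
  have "0 < measure lborel (ball 0 e :: (complex ^ 'n) set)" using e(1) by simp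
  also have "measure lborel (ball 0 e :: (complex ^ 'n) set) \<le> measure lborel (cyl w r s)"
    by (rule measure_mono_fmeasurable)
       (use e(2) emeasure_cyl_finite[OF assms(1)] in \<open>auto simp: fmeasurable_def\<close>)
  finally show ?thesis .
qed

lemma emeasure_cyl: "norm w = 1 \<Longrightarrow> emeasure lborel (cyl w r s) = ennreal (measure lborel (cyl w r s))"
  by (rule emeasure_eq_ennreal_measure) (metis emeasure_cyl_finite infinity_ennreal_def less_irrefl)

lemma emeasure_lborel_translate:
  fixes a :: "'a::euclidean_space"
  assumes "S \<in> sets borel"
  shows "emeasure lborel ((+) a ` S) = emeasure lborel S"
proof -
  have "(+) a ` S = (+) (- a) -` S"
    by (rule set_eqI) (metis add_minus_cancel image_iff minus_add_cancel vimage_eq)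
  then have "emeasure lborel ((+) a ` S) = emeasure (distr lborel borel ((+) (- a))) S"
    using assms by (simp add: emeasure_distr)
  then show ?thesis by (simp add: lborel_distr_plus)
qed

text \<open>
  The discs of radius \<open>r/2\<close> about \<open>\<plusminus>r/2\<close> are disjoint and lie in the disc of radius \<open>r\<close>, so two
  disjoint translates of the half-radius cylinder fit in the cylinder.
\<close>

lemma measure_cyl_half:
  assumes w: "norm w = 1"
  shows "2 * measure lborel (cyl w (r / 2) s) \<le> measure lborel (cyl w r s)"
proof -
  define T where "T = (\<lambda>b::real. (+) (of_real (b * r / 2) *s w) ` cyl w (r / 2) s)"
  have ww: "cdot w w = 1" by (simp add: cdot_self w)
  have T_iff: "z \<in> T b \<longleftrightarrow> cmod (cdot w z - of_real (b * r / 2)) < r / 2 \<and> norm (z - cdot w z *s w) < s" for z b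
  proof -
    have "z \<in> T b \<longleftrightarrow> z - of_real (b * r / 2) *s w \<in> cyl w (r / 2) s"
      unfolding T_def by (force simp: image_iff algebra_simps)
    moreover have "z - of_real (b * r / 2) *s w - (cdot w z - of_real (b * r / 2)) *s w = z - cdot w z *s w"
      by (simp add: vec_eq_iff algebra_simps)
    ultimately show ?thesis by (simp add: cyl_def cdot_diff cdot_cscale ww)
  qed
  have sub: "T b \<subseteq> cyl w r s" if "\<bar>b\<bar> = 1" for b
  proof
    fix z assume z: "z \<in> T b"
    then have "r > 0" unfolding T_iff using norm_ge_zero[of "cdot w z - of_real (b * r / 2)"] by linarith
    have "cmod (cdot w z) \<le> cmod (cdot w z - of_real (b * r / 2)) + cmod (of_real (b * r / 2))"
      by (metis diff_add_cancel norm_triangle_ineq)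
    also have "cmod (of_real (b * r / 2)) = r / 2"
      using that \<open>r > 0\<close> by (simp only: norm_of_real) (simp add: abs_mult)
    finally show "z \<in> cyl w r s" using z by (simp add: T_iff cyl_def)
  qed
  have disj: "T 1 \<inter> T (-1) = {}"
  proof (rule ccontr)
    assume "T 1 \<inter> T (-1) \<noteq> {}"
    then obtain z where z: "cmod (cdot w z - of_real (r / 2)) < r / 2" "cmod (cdot w z + of_real (r / 2)) < r / 2"
      by (auto simp: T_iff)
    then have "cmod ((cdot w z + of_real (r / 2)) - (cdot w z - of_real (r / 2))) < r"
      by (intro le_less_trans[OF norm_triangle_ineq4]) linarith
    then have "cmod (of_real r) < r" by simp
    then show False by simp
  qed
  have Tm: "T b \<in> sets borel" for b
  proof -
    have "T b = {z. cmod (cdot w z - of_real (b * r / 2)) < r / 2 \<and> norm (z - cdot w z *s w) < s}"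
      using T_iff by auto
    moreover have "open {z. cmod (cdot w z - of_real (b * r / 2)) < r / 2 \<and> norm (z - cdot w z *s w) < s}"
      by (intro open_Collect_conj open_Collect_less continuous_intros)
    ultimately show ?thesis by simp
  qed
  have Te: "measure lborel (T b) = measure lborel (cyl w (r / 2) s)" for b
    unfolding T_def measure_def by (subst emeasure_lborel_translate) auto
  have fm: "cyl w r s \<in> fmeasurable lborel"
    using emeasure_cyl_finite[OF w] by (auto simp: fmeasurable_def)
  have fT: "T b \<in> fmeasurable lborel" if "\<bar>b\<bar> = 1" for b
    by (rule fmeasurableI2[OF fm sub[OF that]]) (simp add: Tm)
  have "2 * measure lborel (cyl w (r / 2) s) = measure lborel (T 1 \<union> T (-1))"
    using disj fT by (subst measure_Un3) (simp_all add: Te)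
  also have "\<dots> \<le> measure lborel (cyl w r s)"
    by (rule measure_mono_fmeasurable) (use sub[of 1] sub[of "-1"] fm Tm in auto)
  finally show ?thesis .
qed

section \<open>Holomorphic functions on cylinders\<close>

text \<open>Agreement on \<open>S\<close> suffices because \<open>S\<close> is open: a derivative at
  a point sees a full neighbourhood of it.\<close>

lemma holomorphic_several_on_cong:
  assumes "open S" "\<And>z. z \<in> S \<Longrightarrow> f z = g z"
  shows "holomorphic_several_on f S \<longleftrightarrow> holomorphic_several_on g S"
proof -
  have "holomorphic_several_on g S"
    if "holomorphic_several_on f S" "\<And>z. z \<in> S \<Longrightarrow> f z = g z" for f g :: "complex ^ 'a \<Rightarrow> complex"
    using that has_derivative_transform_within_open[OF _ assms(1), of f _ _ UNIV g]
    unfolding holomorphic_several_on_def by metis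
  from this[of f g] this[of g f] show ?thesis using assms(2) by auto
qed

lemma holomorphic_several_on_translate:
  "holomorphic_several_on f ((+) a ` S) \<longleftrightarrow> holomorphic_several_on (\<lambda>z. f (a + z)) S"
proof
  assume f: "holomorphic_several_on f ((+) a ` S)"
  show "holomorphic_several_on (\<lambda>z. f (a + z)) S"
    unfolding holomorphic_several_on_def
  proof
    fix z assume "z \<in> S"
    then obtain D where D: "(f has_derivative D) (at (a + z))" "\<And>c v. D (c *s v) = c * D v"
      using f unfolding holomorphic_several_on_def by blast
    have "((+) a has_derivative (\<lambda>x. x)) (at z)"
      by (auto intro!: derivative_eq_intros)
    from has_derivative_compose[OF this D(1)]
    show "\<exists>D. ((\<lambda>z. f (a + z)) has_derivative D) (at z) \<and> (\<forall>c v. D (c *s v) = c * D v)"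
      using D(2) by auto
  qed
next
  assume f: "holomorphic_several_on (\<lambda>z. f (a + z)) S"
  show "holomorphic_several_on f ((+) a ` S)"
    unfolding holomorphic_several_on_def
  proof
    fix z assume "z \<in> (+) a ` S"
    then have "z - a \<in> S" by auto
    then obtain D where D: "((\<lambda>z. f (a + z)) has_derivative D) (at (z - a))" "\<And>c v. D (c *s v) = c * D v"
      using f unfolding holomorphic_several_on_def by blast
    have "((\<lambda>x. x - a) has_derivative (\<lambda>x. x)) (at z)"
      by (auto intro!: derivative_eq_intros)
    from has_derivative_compose[OF this D(1)]
    show "\<exists>D. (f has_derivative D) (at z) \<and> (\<forall>c v. D (c *s v) = c * D v)"
      using D(2) by auto
  qed
qed

lemma holomorphic_several_on_imp_continuous_on:
  assumes "holomorphic_several_on f S"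
  shows "continuous_on S f"
  using assms has_derivative_continuous unfolding holomorphic_several_on_def
  by (metis continuous_at_imp_continuous_on)

lemma holomorphic_several_on_mult:
  assumes "holomorphic_several_on f S" "holomorphic_several_on g S"
  shows "holomorphic_several_on (\<lambda>z. f z * g z) S"
  unfolding holomorphic_several_on_def
proof
  fix z assume "z \<in> S"
  then obtain D E where "(f has_derivative D) (at z)" "\<And>c v. D (c *s v) = c * D v"
    "(g has_derivative E) (at z)" "\<And>c v. E (c *s v) = c * E v"
    using assms unfolding holomorphic_several_on_def by metis
  then show "\<exists>D. ((\<lambda>z. f z * g z) has_derivative D) (at z) \<and> (\<forall>c v. D (c *s v) = c * D v)"
    by (intro exI[of _ "\<lambda>h. f z * E h + D h * g z"] conjI has_derivative_mult)
       (auto simp: algebra_simps)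
qed

lemma holomorphic_several_on_compose:
  assumes "holomorphic_several_on f S" "H holomorphic_on UNIV"
  shows "holomorphic_several_on (\<lambda>z. H (f z)) S"
  unfolding holomorphic_several_on_def
proof
  fix z assume "z \<in> S"
  then obtain D where D: "(f has_derivative D) (at z)" "\<And>c v. D (c *s v) = c * D v"
    using assms unfolding holomorphic_several_on_def by metis
  have "(H has_field_derivative deriv H (f z)) (at (f z))"
    using assms(2) holomorphic_derivI by blast
  then have "(H has_derivative (*) (deriv H (f z))) (at (f z))"
    by (simp add: has_field_derivative_def)
  from has_derivative_compose[OF D(1) this]
  show "\<exists>D. ((\<lambda>z. H (f z)) has_derivative D) (at z) \<and> (\<forall>c v. D (c *s v) = c * D v)"
    using D(2) by (intro exI[of _ "\<lambda>x. deriv H (f z) * D x"]) auto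
qed

lemma holomorphic_several_on_cdot: "holomorphic_several_on (cdot w) S"
  unfolding holomorphic_several_on_def
  using bounded_linear_imp_has_derivative[OF bounded_linear_cdot] cdot_cscale by blast

text \<open>Complex linearity of the derivative turns \<open>D (x *s z)\<close> into
  \<open>D z * x\<close>, which is a complex derivative in one variable.\<close>

lemma holomorphic_on_slice:
  assumes "holomorphic_several_on f S" "\<And>c. c \<in> U \<Longrightarrow> c *s z \<in> S"
  shows "(\<lambda>c. f (c *s z)) holomorphic_on U"
  unfolding holomorphic_on_def field_differentiable_def
proof
  fix c assume "c \<in> U"
  then obtain D where D: "(f has_derivative D) (at (c *s z))" "\<And>c v. D (c *s v) = c * D v"
    using assms unfolding holomorphic_several_on_def by metis
  have "linear (\<lambda>c::complex. c *s z)"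
    by (rule linearI) (simp_all add: vec_eq_iff algebra_simps)
  then have "((\<lambda>c. c *s z) has_derivative (\<lambda>c. c *s z)) (at c within U)"
    by (simp add: linear_conv_bounded_linear bounded_linear_imp_has_derivative)
  from has_derivative_compose[OF this D(1)]
  have "((\<lambda>c. f (c *s z)) has_derivative (\<lambda>x. D z * x)) (at c within U)"
    by (simp add: D(2) mult.commute)
  then show "\<exists>f'. ((\<lambda>c. f (c *s z)) has_field_derivative f') (at c within U)"
    unfolding has_field_derivative_def by blast
qed

text \<open>The circle through a point \<open>z\<close> of the cylinder bounds the disc of all
  \<open>c *s z\<close> with \<open>cmod c \<le> 1\<close>, which lies in the open cylinder. So
  \<open>G\<close> is holomorphic past that circle, and its mean there is \<open>G 0\<close>; no
  regularity at the boundary of the cylinder enters.\<close>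

lemma set_integral_cyl_holomorphic:
  assumes w: "norm w = 1" and G: "holomorphic_several_on G (cyl w r s)" and int: "set_integrable lborel (cyl w r s) G"
  shows "(LINT z:cyl w r s|lborel. G z) = measure lborel (cyl w r s) *\<^sub>R G 0"
proof -
  have "(LINT z:cyl w r s|lborel. G z) = (LINT z:cyl w r s|lborel. G 0)"
  proof (rule set_integral_circle_mean[OF open_cyl _ holomorphic_several_on_imp_continuous_on[OF G] int])
    fix z assume z: "z \<in> cyl w r s"
    have "continuous_on UNIV (\<lambda>c::complex. c *s z)" by (intro continuous_intros)
    then have "open ((\<lambda>c::complex. c *s z) -` cyl w r s)"
      by (rule open_vimage[OF open_cyl])
    moreover have "cball 0 1 \<subseteq> (\<lambda>c::complex. c *s z) -` cyl w r s"
      using cscale_in_cyl[OF z] by auto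
    moreover have "(\<lambda>c. G (c *s z)) holomorphic_on ((\<lambda>c::complex. c *s z) -` cyl w r s)"
      by (rule holomorphic_on_slice[OF G]) auto
    ultimately have "(LINT t:{0..1}|lborel. G (cis (2 * pi * t) *s z)) = G (0 *s z)"
      by (rule circle_mean_holomorphic)
    then show "(LINT t:{0..1}|lborel. G (cis (2 * pi * t) *s z)) = G 0" by simp
  qed (simp add: cscale_in_cyl)
  moreover have "integrable lborel (indicat_real (cyl w r s))"
    using emeasure_cyl_finite[OF w] by (auto intro!: integrable_real_indicator)
  ultimately show ?thesis by (simp add: set_lebesgue_integral_def)
qed

text \<open>The origin of \<open>\<kappa>\<close>: the part with
  \<open>cmod (cdot w z) < r / 2\<close> has at most half of the volume and the integrand is at most
  \<open>1\<close> there, while elsewhere it is at most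
  \<open>exp (- \<epsilon> * (r / 2)^2)\<close>. The bound is the average of the two values and is
  independent of \<open>s\<close>.\<close>

lemma set_integral_gauss_cyl_le:
  assumes w: "norm w = 1" and r: "0 < r" and \<epsilon>: "0 < \<epsilon>"
  defines "\<kappa> \<equiv> (1 + exp (- \<epsilon> * (r / 2)\<^sup>2)) / 2"
  shows "set_integrable lborel (cyl w r s) (\<lambda>z. exp (- \<epsilon> * (cmod (cdot w z))\<^sup>2))"
    and "(LINT z:cyl w r s|lborel. exp (- \<epsilon> * (cmod (cdot w z))\<^sup>2)) \<le> \<kappa> * measure lborel (cyl w r s)"
proof -
  let ?P = "cyl w r s" and ?P' = "cyl w (r / 2) s" and ?q = "exp (- \<epsilon> * (r / 2)\<^sup>2)"
  let ?e = "\<lambda>z. exp (- \<epsilon> * (cmod (cdot w z))\<^sup>2)"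
  have sub: "?P' \<subseteq> ?P" using r by (auto simp: cyl_def)
  have fin: "emeasure lborel (cyl w r' s) < \<infinity>" for r' by (rule emeasure_cyl_finite[OF w])
  have "continuous_on UNIV ?e" by (intro continuous_intros)
  then have em[measurable]: "?e \<in> borel_measurable borel" by (rule borel_measurable_continuous_onI)
  show int: "set_integrable lborel ?P ?e"
    unfolding set_integrable_def
    by (rule integrableI_bounded_set_indicator[where B=1]) (use fin \<epsilon> em in auto)
  have iP': "integrable lborel (indicat_real ?P')" and iP: "integrable lborel (indicat_real ?P)"
    using fin by (auto intro!: integrable_real_indicator)
  have "(LINT z:?P|lborel. ?e z) \<le> (LINT z|lborel. (1 - ?q) * indicat_real ?P' z + ?q * indicat_real ?P z)"
    unfolding set_lebesgue_integral_def
  proof (rule integral_mono)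
    show "integrable lborel (\<lambda>z. indicat_real ?P z *\<^sub>R ?e z)"
      using int by (simp add: set_integrable_def)
    show "integrable lborel (\<lambda>z. (1 - ?q) * indicat_real ?P' z + ?q * indicat_real ?P z)"
      using iP iP' by auto
    fix z
    have "?e z \<le> ?q" if "z \<in> ?P" "z \<notin> ?P'"
    proof -
      have "r / 2 \<le> cmod (cdot w z)" using that by (auto simp: cyl_def)
      then have "(r / 2)\<^sup>2 \<le> (cmod (cdot w z))\<^sup>2" using r by (intro power_mono) auto
      then show ?thesis using \<epsilon> by simp
    qed
    moreover have "?e z \<le> 1" using \<epsilon> by simp
    ultimately show "indicat_real ?P z *\<^sub>R ?e z \<le> (1 - ?q) * indicat_real ?P' z + ?q * indicat_real ?P z"
      using sub by (auto simp: indicator_def)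
  qed
  also have "\<dots> = (1 - ?q) * measure lborel ?P' + ?q * measure lborel ?P"
    using iP iP' by simp
  also have "\<dots> \<le> (1 - ?q) * (measure lborel ?P / 2) + ?q * measure lborel ?P"
    using measure_cyl_half[OF w, of r s] \<epsilon> by (intro add_right_mono mult_left_mono) auto
  also have "\<dots> = \<kappa> * measure lborel ?P" by (simp add: \<kappa>_def field_simps)
  finally show "(LINT z:?P|lborel. ?e z) \<le> \<kappa> * measure lborel ?P" .
qed

section \<open>From finite nonnegative integrals to Bochner integrability\<close>

lemma borel_measurable_ennreal_indicator:
  assumes "open S" "continuous_on S k"
  shows "(\<lambda>z. ennreal (k z) * indicator S z) \<in> borel_measurable borel"
proof -
  have "(\<lambda>z. indicat_real S z *\<^sub>R k z) \<in> borel_measurable borel"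
    using assms by (intro borel_measurable_continuous_on_indicator) auto
  then have "(\<lambda>z. ennreal (indicat_real S z *\<^sub>R k z)) \<in> borel_measurable borel"
    by measurable
  moreover have "(\<lambda>z. ennreal (indicat_real S z *\<^sub>R k z)) = (\<lambda>z. ennreal (k z) * indicator S z)"
    by (auto simp: indicator_def)
  ultimately show ?thesis by simp
qed

lemma set_integrable_if_nn_integral_finite:
  assumes S: "open S" and k: "continuous_on S k" "\<And>z. z \<in> S \<Longrightarrow> 0 \<le> k z"
    and fin: "(\<integral>\<^sup>+z\<in>S. ennreal (k z) \<partial>lborel) < \<infinity>"
  shows "set_integrable lborel S k"
    and "(\<integral>\<^sup>+z\<in>S. ennreal (k z) \<partial>lborel) = ennreal (LINT z:S|lborel. k z)"
proof -
  have "(\<lambda>z. indicat_real S z *\<^sub>R k z) \<in> borel_measurable borel"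
    using S k(1) by (intro borel_measurable_continuous_on_indicator) auto
  then have m: "(\<lambda>z. indicat_real S z *\<^sub>R k z) \<in> borel_measurable lborel" by simp
  have eq: "(\<integral>\<^sup>+z. ennreal (indicat_real S z *\<^sub>R k z) \<partial>lborel) = (\<integral>\<^sup>+z\<in>S. ennreal (k z) \<partial>lborel)"
    by (intro nn_integral_cong) (auto simp: indicator_def)
  have pos: "AE z in lborel. 0 \<le> indicat_real S z *\<^sub>R k z"
    using k(2) by (auto simp: indicator_def)
  show int: "set_integrable lborel S k"
    unfolding set_integrable_def
    by (rule integrableI_nonneg[OF m pos]) (use fin eq in simp)
  show "(\<integral>\<^sup>+z\<in>S. ennreal (k z) \<partial>lborel) = ennreal (LINT z:S|lborel. k z)"
    unfolding set_lebesgue_integral_def eq[symmetric]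
    by (rule nn_integral_eq_integral[OF int[unfolded set_integrable_def] pos])
qed

text \<open>\<open>cmod (G z) \<le> 1 + (cmod (G z))^2\<close>, and the constant is integrable
  because the cylinder has finite volume.\<close>

lemma set_integrable_if_square_integrable:
  fixes G :: "complex ^ 'n \<Rightarrow> complex"
  assumes w: "norm w = 1" and G: "continuous_on (cyl w r s) G"
    and int: "set_integrable lborel (cyl w r s) (\<lambda>z. (cmod (G z))\<^sup>2)"
  shows "set_integrable lborel (cyl w r s) G"
proof -
  have "(\<lambda>z. indicat_real (cyl w r s) z *\<^sub>R G z) \<in> borel_measurable lborel"
    using G by (simp, intro borel_measurable_continuous_on_indicator) auto
  moreover have "set_integrable lborel (cyl w r s) (\<lambda>z. 1 + (cmod (G z))\<^sup>2)"
    using emeasure_cyl_finite[OF w, of r s]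
    by (intro set_integral_add int) (auto simp: set_integrable_def)
  ultimately show ?thesis
    unfolding set_integrable_def
  proof (elim Bochner_Integration.integrable_bound[rotated], intro AE_I2)
    fix z
    have "cmod (G z) \<le> 1 + (cmod (G z))\<^sup>2"
      using zero_le_power2[of "cmod (G z) - 1"] zero_le_square[of "cmod (G z)"]
      unfolding power2_eq_square by (simp only: algebra_simps)
    then show "norm (indicat_real (cyl w r s) z *\<^sub>R G z) \<le> norm (indicat_real (cyl w r s) z *\<^sub>R (1 + (cmod (G z))\<^sup>2))"
      by (simp add: indicator_def)
  qed
qed

text \<open>
  With \<open>t = exp (\<epsilon> * \<zeta>\<^sup>2)\<close> and \<open>\<zeta> = cmod (cdot w z)\<close>, AM-GM gives \<open>|G|\<^sup>2 t \<ge> 2 Re G - 1/t\<close>, and the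
  integral of \<open>G\<close> is known.
\<close>

lemma nn_integral_weighted_holomorphic_ge:
  fixes G :: "complex ^ 'n \<Rightarrow> complex"
  assumes w: "norm w = 1" and r: "0 < r" and \<epsilon>: "0 < \<epsilon>"
    and G: "holomorphic_several_on G (cyl w r s)" "G 0 = 1"
  defines "\<kappa> \<equiv> (1 + exp (- \<epsilon> * (r / 2)\<^sup>2)) / 2"
  shows "ennreal ((2 - \<kappa>) * measure lborel (cyl w r s))
    \<le> (\<integral>\<^sup>+z\<in>cyl w r s. ennreal ((cmod (G z))\<^sup>2 * exp (\<epsilon> * (cmod (cdot w z))\<^sup>2)) \<partial>lborel)"
proof (cases "(\<integral>\<^sup>+z\<in>cyl w r s. ennreal ((cmod (G z))\<^sup>2 * exp (\<epsilon> * (cmod (cdot w z))\<^sup>2)) \<partial>lborel) < \<infinity>")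
  \<comment> \<open>An infinite integral leaves nothing to prove; a finite one supplies the
    integrability that the mean value formula for \<open>G\<close> asks for.\<close>
  case True
  let ?P = "cyl w r s" and ?k = "\<lambda>z. (cmod (G z))\<^sup>2 * exp (\<epsilon> * (cmod (cdot w z))\<^sup>2)"
  let ?e = "\<lambda>z. exp (- \<epsilon> * (cmod (cdot w z))\<^sup>2)"
  have contG: "continuous_on ?P G" by (rule holomorphic_several_on_imp_continuous_on[OF G(1)])
  have contk: "continuous_on ?P ?k" by (intro continuous_intros contG)
  note k = set_integrable_if_nn_integral_finite[OF open_cyl contk _ True]
  have intk: "set_integrable lborel ?P ?k" by (rule k(1)) simp
  \<comment> \<open>The weight is at least \<open>1\<close>, so the weighted bound also controls the
    square of \<open>G\<close> itself.\<close>
  have "(\<lambda>z. indicat_real ?P z *\<^sub>R (cmod (G z))\<^sup>2) \<in> borel_measurable borel"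
    by (intro borel_measurable_continuous_on_indicator continuous_intros contG) auto
  then have "set_integrable lborel ?P (\<lambda>z. (cmod (G z))\<^sup>2)"
    unfolding set_integrable_def
    by (intro Bochner_Integration.integrable_bound[OF intk[unfolded set_integrable_def]])
       (use \<epsilon> in \<open>auto simp: indicator_def mult_le_cancel_left1\<close>)
  then have intG: "set_integrable lborel ?P G"
    by (rule set_integrable_if_square_integrable[OF w contG])
  have intRe: "set_integrable lborel ?P (\<lambda>z. Re (G z))"
    using integrable_Re[OF intG[unfolded set_integrable_def]] by (simp add: set_integrable_def)
  have "(LINT z:?P|lborel. Re (G z)) = Re (LINT z:?P|lborel. G z)"
    using integral_Re[OF intG[unfolded set_integrable_def]] by (simp add: set_lebesgue_integral_def)
  also have "\<dots> = measure lborel ?P"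
    by (simp add: set_integral_cyl_holomorphic[OF w G(1) intG] G(2))
  finally have Re: "(LINT z:?P|lborel. Re (G z)) = measure lborel ?P" .
  note e = set_integral_gauss_cyl_le[OF w r \<epsilon>, of s]
  have "(2 - \<kappa>) * measure lborel ?P \<le> (LINT z:?P|lborel. 2 * Re (G z)) - (LINT z:?P|lborel. ?e z)"
    using e(2) Re by (simp add: \<kappa>_def left_diff_distrib)
  also have "\<dots> = (LINT z:?P|lborel. 2 * Re (G z) - ?e z)"
    by (rule set_integral_diff(2)[symmetric]) (use intRe e in auto)
  also have "\<dots> \<le> (LINT z:?P|lborel. ?k z)"
  proof (rule set_integral_mono)
    show "set_integrable lborel ?P (\<lambda>z. 2 * Re (G z) - ?e z)"
      by (rule set_integral_diff(1)) (use intRe e in auto)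
    fix z
    define t where "t = exp (\<epsilon> * (cmod (cdot w z))\<^sup>2)"
    have t: "t > 0" "?e z = 1 / t" by (auto simp: t_def exp_minus divide_inverse)
    have "0 \<le> (cmod (G z) * t - 1)\<^sup>2 / t" using t by simp
    also have "\<dots> = (cmod (G z))\<^sup>2 * t - 2 * cmod (G z) + 1 / t"
      using t by (simp add: power2_eq_square field_simps)
    finally show "2 * Re (G z) - ?e z \<le> ?k z"
      using complex_Re_le_cmod[of "G z"] t by (simp add: t_def[symmetric])
  qed (rule intk)
  finally show ?thesis
    using k(2) by (simp add: ennreal_leI)
qed (simp add: not_less top_unique)

section \<open>Competitors on a cylinder about the origin\<close>

text \<open>The centre is moved to \<open>0\<close>, so \<open>\<psi>\<close> stands for
  \<open>\<phi>\<close> translated by \<open>a\<close>. The integral takes values in the extended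
  half line, so the inequality includes finiteness.\<close>

definition admissible :: "(complex ^ 'n \<Rightarrow> real) \<Rightarrow> (complex ^ 'n) set \<Rightarrow> (complex ^ 'n \<Rightarrow> complex) \<Rightarrow> bool" where
  "admissible \<psi> P F \<longleftrightarrow> holomorphic_several_on F P \<and> F 0 = 1 \<and>
     (\<integral>\<^sup>+z\<in>P. ennreal ((cmod (F z))\<^sup>2 * exp (- \<psi> z)) \<partial>lborel) \<le> emeasure lborel P * ennreal (exp (- \<psi> 0))"

definition unique_admissible :: "(complex ^ 'n \<Rightarrow> real) \<Rightarrow> (complex ^ 'n) set \<Rightarrow> bool" where
  "unique_admissible \<psi> P \<longleftrightarrow> (\<exists>F. admissible \<psi> P F) \<and>
     (\<forall>F G. admissible \<psi> P F \<longrightarrow> admissible \<psi> P G \<longrightarrow> (\<forall>z\<in>P. F z = G z))"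

text \<open>Among total functions, \<open>extensional\<close> selects one representative for each
  function on the set. The condition depends only on values there, so this amounts to existence
  together with agreement on the set; translation invariance of the measure moves the centre to
  \<open>0\<close>.\<close>

lemma ex1_iff_unique_admissible:
  fixes P :: "(complex ^ 'n) set"
  assumes P: "open P" "0 \<in> P" and \<phi>: "continuous_on ((+) a ` P) \<phi>"
  shows "(\<exists>!f. f \<in> extensional ((+) a ` P) \<and> holomorphic_several_on f ((+) a ` P) \<and> f a = 1 \<and>
      (\<integral>\<^sup>+ z \<in> (+) a ` P. ennreal ((cmod (f z))\<^sup>2 * exp (- \<phi> z)) \<partial>lborel)
        \<le> emeasure lborel P * ennreal (exp (- \<phi> a)))
    \<longleftrightarrow> unique_admissible (\<lambda>z. \<phi> (a + z)) P"
proof -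
  let ?S = "(+) a ` P"
  define ok where "ok f \<longleftrightarrow> holomorphic_several_on f ?S \<and> f a = 1 \<and>
      (\<integral>\<^sup>+ z \<in> ?S. ennreal ((cmod (f z))\<^sup>2 * exp (- \<phi> z)) \<partial>lborel)
        \<le> emeasure lborel P * ennreal (exp (- \<phi> a))" for f
  have S: "open ?S" by (simp add: P open_translation)
  have aS: "a \<in> ?S" using P(2) by (intro image_eqI[of _ _ 0]) simp_all
  have ok_adm: "ok f \<longleftrightarrow> admissible (\<lambda>z. \<phi> (a + z)) P (\<lambda>z. f (a + z))" for f
  proof (cases "holomorphic_several_on f ?S")
    case True
    then have "continuous_on ?S f" by (rule holomorphic_several_on_imp_continuous_on)
    then have "continuous_on ?S (\<lambda>z. (cmod (f z))\<^sup>2 * exp (- \<phi> z))" using \<phi> by (intro continuous_intros)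
    from nn_integral_lborel_translate[OF borel_measurable_ennreal_indicator[OF S this], of a]
    have "(\<integral>\<^sup>+ z \<in> ?S. ennreal ((cmod (f z))\<^sup>2 * exp (- \<phi> z)) \<partial>lborel)
      = (\<integral>\<^sup>+ z \<in> P. ennreal ((cmod (f (a + z)))\<^sup>2 * exp (- \<phi> (a + z))) \<partial>lborel)"
      by (simp add: indicator_def image_iff)
    then show ?thesis using True
      by (simp add: ok_def admissible_def holomorphic_several_on_translate)
  qed (simp add: ok_def admissible_def holomorphic_several_on_translate)
  have ok_cong: "ok f \<longleftrightarrow> ok g" if "\<And>z. z \<in> ?S \<Longrightarrow> f z = g z" for f g
  proof -
    have "(\<integral>\<^sup>+ z \<in> ?S. ennreal ((cmod (f z))\<^sup>2 * exp (- \<phi> z)) \<partial>lborel) =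
      (\<integral>\<^sup>+ z \<in> ?S. ennreal ((cmod (g z))\<^sup>2 * exp (- \<phi> z)) \<partial>lborel)"
      by (intro nn_integral_cong) (use that in \<open>auto simp: indicator_def\<close>)
    then show ?thesis
      unfolding ok_def using holomorphic_several_on_cong[OF S that] that[OF aS] by simp
  qed
  have adm_ok: "ok (\<lambda>z. F (z - a)) \<longleftrightarrow> admissible (\<lambda>z. \<phi> (a + z)) P F" for F
    by (simp add: ok_adm)
  have "(\<exists>!f. f \<in> extensional ?S \<and> ok f) \<longleftrightarrow>
    (\<exists>f. ok f) \<and> (\<forall>f g. ok f \<longrightarrow> ok g \<longrightarrow> (\<forall>z\<in>?S. f z = g z))" (is "?L \<longleftrightarrow> ?R")
  proof
    assume ?L
    then obtain f where f: "ok f" "\<And>g. g \<in> extensional ?S \<Longrightarrow> ok g \<Longrightarrow> g = f" by blast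
    have "restrict g ?S = f" if "ok g" for g
    proof (rule f(2))
      show "ok (restrict g ?S)" using that by (subst ok_cong[of _ g]) simp_all
    qed simp
    then have "g z = f z" if "ok g" "z \<in> ?S" for g z
      using that by (metis restrict_apply')
    then show ?R using f(1) by metis
  next
    assume R: ?R
    then obtain f where f: "ok f" by blast
    then have okr: "ok (restrict f ?S)" by (subst ok_cong[of _ f]) simp_all
    show ?L
    proof (rule ex1I[of _ "restrict f ?S"])
      fix g assume g: "g \<in> extensional ?S \<and> ok g"
      show "g = restrict f ?S"
      proof (rule extensionalityI)
        show "g \<in> extensional ?S" "restrict f ?S \<in> extensional ?S" using g by simp_all
        show "g z = restrict f ?S z" if "z \<in> ?S" for z using R g okr that by blast
      qed
    qed (use okr in simp)
  qed
  also have "\<dots> \<longleftrightarrow> unique_admissible (\<lambda>z. \<phi> (a + z)) P"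
    unfolding unique_admissible_def
  proof (intro conj_cong iffI allI impI ballI)
    assume "\<exists>f. ok f"
    then show "\<exists>F. admissible (\<lambda>z. \<phi> (a + z)) P F" using ok_adm by blast
  next
    assume "\<exists>F. admissible (\<lambda>z. \<phi> (a + z)) P F"
    then show "\<exists>f. ok f" using adm_ok by blast
  next
    fix F G z
    assume u: "\<forall>f g. ok f \<longrightarrow> ok g \<longrightarrow> (\<forall>z\<in>?S. f z = g z)"
      and "admissible (\<lambda>z. \<phi> (a + z)) P F" "admissible (\<lambda>z. \<phi> (a + z)) P G" "z \<in> P"
    then have "ok (\<lambda>z. F (z - a))" "ok (\<lambda>z. G (z - a))" "a + z \<in> ?S" using adm_ok by simp_all
    then have "F (a + z - a) = G (a + z - a)" using u by blast
    then show "F z = G z" by simp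
  next
    fix f g z
    assume u: "\<forall>F G. admissible (\<lambda>z. \<phi> (a + z)) P F \<longrightarrow> admissible (\<lambda>z. \<phi> (a + z)) P G \<longrightarrow> (\<forall>z\<in>P. F z = G z)"
      and f: "ok f" and g: "ok g" and "z \<in> ?S"
    then obtain x where x: "x \<in> P" "z = a + x" by blast
    have "\<forall>x\<in>P. f (a + x) = g (a + x)"
      using u f g unfolding ok_adm by blast
    then show "f z = g z" using x by simp
  qed
  finally show ?thesis unfolding ok_def .
qed

section \<open>Comparison on complex lines\<close>

definition unique_admissible_on :: "(complex ^ 'n \<Rightarrow> real) \<Rightarrow> (complex ^ 'n) set \<Rightarrow> bool" where
  "unique_admissible_on \<phi> \<Omega> \<longleftrightarrow> (\<forall>a\<in>\<Omega>. \<forall>w r s. norm w = 1 \<longrightarrow> 0 < r \<longrightarrow> 0 < s \<longrightarrow>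
     (+) a ` cyl w r s \<subseteq> \<Omega> \<longrightarrow> unique_admissible (\<lambda>z. \<phi> (a + z)) (cyl w r s))"

text \<open>The order of choices is the point: \<open>r\<close> is restricted only by the distance
  to the boundary, and \<open>s\<close> may depend on both \<open>r\<close> and
  \<open>\<delta>\<close>. Uniform continuity on a closed ball about \<open>a\<close> compares
  \<open>\<phi>\<close> at a point with its value at the projection to the line.\<close>

lemma thin_cyl:
  fixes \<phi> :: "complex ^ 'n \<Rightarrow> real"
  assumes "open \<Omega>" "continuous_on \<Omega> \<phi>" "a \<in> \<Omega>" and w: "norm w = 1"
  obtains r\<^sub>1 where "0 < r\<^sub>1" "\<And>r \<delta>. 0 < r \<Longrightarrow> r \<le> r\<^sub>1 \<Longrightarrow> 0 < \<delta> \<Longrightarrow> \<exists>s>0. (+) a ` cyl w r s \<subseteq> \<Omega> \<and>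
    (\<forall>z\<in>cyl w r s. a + cdot w z *s w \<in> \<Omega> \<and> \<bar>\<phi> (a + z) - \<phi> (a + cdot w z *s w)\<bar> < \<delta>)"
proof -
  obtain e where e: "0 < e" "cball a e \<subseteq> \<Omega>"
    using assms open_contains_cball by blast
  have uc: "uniformly_continuous_on (cball a e) \<phi>"
    using assms(2) e(2) by (intro compact_uniformly_continuous) (auto intro: continuous_on_subset)
  have "\<exists>s>0. (+) a ` cyl w r s \<subseteq> \<Omega> \<and>
    (\<forall>z\<in>cyl w r s. a + cdot w z *s w \<in> \<Omega> \<and> \<bar>\<phi> (a + z) - \<phi> (a + cdot w z *s w)\<bar> < \<delta>)"
    if r: "0 < r" "r \<le> e / 2" and \<delta>: "0 < \<delta>" for r \<delta>
  proof -
    obtain d where d: "0 < d" "\<And>x x'. x \<in> cball a e \<Longrightarrow> x' \<in> cball a e \<Longrightarrow> dist x' x < d \<Longrightarrow> dist (\<phi> x') (\<phi> x) < \<delta>"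
      using uc \<delta> unfolding uniformly_continuous_on_def by metis
    \<comment> \<open>With \<open>r \<le> e / 2\<close>, the term \<open>e / 2\<close> keeps the
      cylinder within \<open>e\<close> of \<open>a\<close>; the term \<open>d\<close> bounds the
      distance from a point to its projection.\<close>
    define s where "s = min (e / 2) d"
    have s: "0 < s" using d e by (simp add: s_def)
    have z: "a + z \<in> cball a e" "a + cdot w z *s w \<in> cball a e" "dist (a + z) (a + cdot w z *s w) < d"
      if "z \<in> cyl w r s" for z
      using that norm_cyl_less[OF that w] r
      by (auto simp: dist_norm s_def norm_csmult w cyl_def)
    show ?thesis
    proof (intro exI[of _ s] conjI ballI s)
      show "(+) a ` cyl w r s \<subseteq> \<Omega>" using z(1) e(2) by blast
      fix y assume y: "y \<in> cyl w r s"
      show "a + cdot w y *s w \<in> \<Omega>" using z(2)[OF y] e(2) by blast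
      show "\<bar>\<phi> (a + y) - \<phi> (a + cdot w y *s w)\<bar> < \<delta>"
        using d(2)[OF z(2)[OF y] z(1)[OF y] z(3)[OF y]] by (simp add: dist_real_def)
    qed
  qed
  then show ?thesis using that[of "e / 2"] e(1) by simp
qed

context
  fixes \<phi> :: "complex ^ 'n \<Rightarrow> real" and \<Omega> :: "(complex ^ 'n) set"
  assumes \<Omega>: "open \<Omega>" and \<phi>: "continuous_on \<Omega> \<phi>" and unq: "unique_admissible_on \<phi> \<Omega>"
begin

text \<open>
  On a thin cylinder, dividing the extremal function by \<open>exp (H / 2)\<close> would contradict
  the lower bound for weighted integrals.
\<close>

lemma no_strict_touching_above:
  assumes a: "a \<in> \<Omega>" and w: "norm w = 1" and H: "H holomorphic_on UNIV" "H 0 = 0"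
    and \<epsilon>: "0 < \<epsilon>" and r\<^sub>0: "0 < r\<^sub>0"
    and touch: "\<And>\<zeta>. cmod \<zeta> < r\<^sub>0 \<Longrightarrow> a + \<zeta> *s w \<in> \<Omega> \<Longrightarrow> \<phi> (a + \<zeta> *s w) \<le> \<phi> a + Re (H \<zeta>) - \<epsilon> * (cmod \<zeta>)\<^sup>2"
  shows False
proof -
  obtain r\<^sub>1 where r\<^sub>1: "0 < r\<^sub>1" "\<And>r \<delta>. 0 < r \<Longrightarrow> r \<le> r\<^sub>1 \<Longrightarrow> 0 < \<delta> \<Longrightarrow> \<exists>s>0. (+) a ` cyl w r s \<subseteq> \<Omega> \<and>
    (\<forall>z\<in>cyl w r s. a + cdot w z *s w \<in> \<Omega> \<and> \<bar>\<phi> (a + z) - \<phi> (a + cdot w z *s w)\<bar> < \<delta>)"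
    using thin_cyl[OF \<Omega> \<phi> a w] by blast
  define r where "r = min r\<^sub>0 r\<^sub>1"
  have r: "0 < r" "r \<le> r\<^sub>0" "r \<le> r\<^sub>1" using r\<^sub>0 r\<^sub>1 by (auto simp: r_def)
  define \<kappa> where "\<kappa> = (1 + exp (- \<epsilon> * (r / 2)\<^sup>2)) / 2"
  have \<kappa>: "\<kappa> < 1" using \<epsilon> r by (simp add: \<kappa>_def)
  \<comment> \<open>Half of the logarithm, so that the loss \<open>exp \<delta>\<close> from leaving
    the line stays strictly below the factor \<open>2 - \<kappa>\<close> of the lower bound.\<close>
  define \<delta> where "\<delta> = ln (2 - \<kappa>) / 2"
  have \<delta>0: "0 < \<delta>" using \<kappa> by (simp add: \<delta>_def)
  have "\<delta> < ln (2 - \<kappa>)" using \<delta>0 by (simp add: \<delta>_def)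
  then have \<delta>1: "exp \<delta> < 2 - \<kappa>" using \<kappa> by (metis exp_less_mono exp_ln diff_gt_0_iff_gt less_trans one_less_numeral_iff semiring_norm(76))
  obtain s where s: "s > 0" "(+) a ` cyl w r s \<subseteq> \<Omega>" "\<And>z. z \<in> cyl w r s \<Longrightarrow> a + cdot w z *s w \<in> \<Omega>"
      "\<And>z. z \<in> cyl w r s \<Longrightarrow> \<bar>\<phi> (a + z) - \<phi> (a + cdot w z *s w)\<bar> < \<delta>"
    using r\<^sub>1(2)[OF r(1,3) \<delta>0] by blast
  let ?P = "cyl w r s" and ?m = "measure lborel (cyl w r s)"
  obtain F where F: "admissible (\<lambda>z. \<phi> (a + z)) ?P F"
    using unq a w r s unfolding unique_admissible_on_def unique_admissible_def by blast
  define G where "G z = F z * exp (- H (cdot w z) / 2)" for z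
  have "(\<lambda>\<zeta>. exp (- H \<zeta> / 2)) holomorphic_on UNIV"
    using H by (intro holomorphic_intros) auto
  then have "holomorphic_several_on (\<lambda>z. exp (- H (cdot w z) / 2)) ?P"
    by (rule holomorphic_several_on_compose[OF holomorphic_several_on_cdot])
  then have G: "holomorphic_several_on G ?P" "G 0 = 1"
    using F H unfolding G_def admissible_def by (auto intro: holomorphic_several_on_mult)
  have "continuous_on ((+) a ` ?P) \<phi>" using \<phi> s(2) continuous_on_subset by blast
  then have "continuous_on ?P (\<lambda>z. \<phi> (a + z))"
    by (rule continuous_on_compose2) (auto intro!: continuous_intros)
  moreover have "continuous_on ?P F"
    using F by (simp add: admissible_def holomorphic_several_on_imp_continuous_on)
  ultimately have meas: "(\<lambda>z. ennreal ((cmod (F z))\<^sup>2 * exp (- \<phi> (a + z))) * indicator ?P z) \<in> borel_measurable borel"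
    by (intro borel_measurable_ennreal_indicator open_cyl continuous_intros)
  have "ennreal ((2 - \<kappa>) * ?m) \<le> (\<integral>\<^sup>+z\<in>?P. ennreal ((cmod (G z))\<^sup>2 * exp (\<epsilon> * (cmod (cdot w z))\<^sup>2)) \<partial>lborel)"
    unfolding \<kappa>_def by (rule nn_integral_weighted_holomorphic_ge[OF w r(1) \<epsilon> G])
  also have "\<dots> \<le> (\<integral>\<^sup>+z. ennreal (exp (\<phi> a + \<delta>)) * (ennreal ((cmod (F z))\<^sup>2 * exp (- \<phi> (a + z))) * indicator ?P z) \<partial>lborel)"
  proof (rule nn_integral_mono)
    fix z
    show "ennreal ((cmod (G z))\<^sup>2 * exp (\<epsilon> * (cmod (cdot w z))\<^sup>2)) * indicator ?P z
      \<le> ennreal (exp (\<phi> a + \<delta>)) * (ennreal ((cmod (F z))\<^sup>2 * exp (- \<phi> (a + z))) * indicator ?P z)"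
    proof (cases "z \<in> ?P")
      case True
      have "cmod (cdot w z) < r\<^sub>0" using True r by (simp add: cyl_def)
      from touch[OF this s(3)[OF True]] s(4)[OF True]
      have le: "- Re (H (cdot w z)) + \<epsilon> * (cmod (cdot w z))\<^sup>2 \<le> \<phi> a + \<delta> - \<phi> (a + z)" by linarith
      have "(cmod (G z))\<^sup>2 = (cmod (F z))\<^sup>2 * exp (- Re (H (cdot w z)))"
        by (simp add: G_def norm_mult power_mult_distrib power2_eq_square exp_add[symmetric])
      then have "(cmod (G z))\<^sup>2 * exp (\<epsilon> * (cmod (cdot w z))\<^sup>2)
        = (cmod (F z))\<^sup>2 * exp (- Re (H (cdot w z)) + \<epsilon> * (cmod (cdot w z))\<^sup>2)"
        by (simp only: exp_add mult.assoc)
      also have "\<dots> \<le> (cmod (F z))\<^sup>2 * exp (\<phi> a + \<delta> - \<phi> (a + z))"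
        using le by (intro mult_left_mono) auto
      also have "\<dots> = exp (\<phi> a + \<delta>) * ((cmod (F z))\<^sup>2 * exp (- \<phi> (a + z)))"
        by (simp add: exp_add exp_diff exp_minus field_simps)
      finally show ?thesis using True by (simp add: ennreal_mult[symmetric] ennreal_leI)
    qed simp
  qed
  also have "\<dots> = ennreal (exp (\<phi> a + \<delta>)) * (\<integral>\<^sup>+z\<in>?P. ennreal ((cmod (F z))\<^sup>2 * exp (- \<phi> (a + z))) \<partial>lborel)"
    using meas by (intro nn_integral_cmult) simp
  also have "\<dots> \<le> ennreal (exp (\<phi> a + \<delta>)) * (ennreal ?m * ennreal (exp (- \<phi> a)))"
    using F unfolding admissible_def emeasure_cyl[OF w] by (intro mult_left_mono) auto
  also have "\<dots> = ennreal (exp \<delta> * ?m)"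
    by (simp add: ennreal_mult[symmetric] exp_add exp_minus field_simps)
  finally have "(2 - \<kappa>) * ?m \<le> exp \<delta> * ?m"
    by (subst (asm) ennreal_le_iff) simp_all
  then show False using measure_cyl_pos[OF w r(1) s(1)] \<delta>1 by simp
qed

text \<open>
  On a thin cylinder both \<open>exp (H / 2)\<close> and a small perturbation of it would be admissible,
  contradicting uniqueness.
\<close>

lemma no_strict_touching_below:
  assumes a: "a \<in> \<Omega>" and w: "norm w = 1" and H: "H holomorphic_on UNIV" "H 0 = 0"
    and \<epsilon>: "0 < \<epsilon>" and r\<^sub>0: "0 < r\<^sub>0"
    and touch: "\<And>\<zeta>. cmod \<zeta> < r\<^sub>0 \<Longrightarrow> a + \<zeta> *s w \<in> \<Omega> \<Longrightarrow> \<phi> a + Re (H \<zeta>) + \<epsilon> * (cmod \<zeta>)\<^sup>2 \<le> \<phi> (a + \<zeta> *s w)"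
  shows False
proof -
  obtain r\<^sub>1 where r\<^sub>1: "0 < r\<^sub>1" "\<And>r \<delta>. 0 < r \<Longrightarrow> r \<le> r\<^sub>1 \<Longrightarrow> 0 < \<delta> \<Longrightarrow> \<exists>s>0. (+) a ` cyl w r s \<subseteq> \<Omega> \<and>
    (\<forall>z\<in>cyl w r s. a + cdot w z *s w \<in> \<Omega> \<and> \<bar>\<phi> (a + z) - \<phi> (a + cdot w z *s w)\<bar> < \<delta>)"
    using thin_cyl[OF \<Omega> \<phi> a w] by blast
  define r where "r = min r\<^sub>0 r\<^sub>1"
  have r: "0 < r" "r \<le> r\<^sub>0" "r \<le> r\<^sub>1" using r\<^sub>0 r\<^sub>1 by (auto simp: r_def)
  define \<kappa> where "\<kappa> = (1 + exp (- \<epsilon> * (r / 2)\<^sup>2)) / 2"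
  have \<kappa>: "0 < \<kappa>" "\<kappa> < 1" using \<epsilon> r by (auto simp: \<kappa>_def add_pos_pos)
  \<comment> \<open>Two errors of size \<open>\<delta>\<close> have to be absorbed by
    \<open>\<kappa>\<close>: one from leaving the line, one from perturbing \<open>H\<close>. The
    choice makes \<open>exp (2 * \<delta>) * \<kappa>\<close> exactly \<open>1\<close>.\<close>
  define \<delta> where "\<delta> = - ln \<kappa> / 2"
  have \<delta>0: "0 < \<delta>" using \<kappa> by (simp add: \<delta>_def)
  have \<delta>1: "exp (2 * \<delta>) * \<kappa> = 1" using \<kappa> by (simp add: \<delta>_def exp_minus)
  obtain s where s: "s > 0" "(+) a ` cyl w r s \<subseteq> \<Omega>" "\<And>z. z \<in> cyl w r s \<Longrightarrow> a + cdot w z *s w \<in> \<Omega>"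
      "\<And>z. z \<in> cyl w r s \<Longrightarrow> \<bar>\<phi> (a + z) - \<phi> (a + cdot w z *s w)\<bar> < \<delta>"
    using r\<^sub>1(2)[OF r(1,3) \<delta>0] by blast
  let ?P = "cyl w r s" and ?m = "measure lborel (cyl w r s)"
  let ?e = "\<lambda>z. exp (- \<epsilon> * (cmod (cdot w z))\<^sup>2)"
  \<comment> \<open>The slack \<open>\<delta>\<close> in the condition on \<open>K\<close> lets one
    estimate serve both competitors.\<close>
  have adm: "admissible (\<lambda>z. \<phi> (a + z)) ?P (\<lambda>z. exp (K (cdot w z) / 2))"
    if K: "K holomorphic_on UNIV" "K 0 = 0" "\<And>\<zeta>. cmod \<zeta> < r \<Longrightarrow> Re (K \<zeta>) \<le> Re (H \<zeta>) + \<delta>" for K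
    unfolding admissible_def
  proof (intro conjI)
    have "(\<lambda>\<zeta>. exp (K \<zeta> / 2)) holomorphic_on UNIV"
      using K by (intro holomorphic_intros) auto
    then show "holomorphic_several_on (\<lambda>z. exp (K (cdot w z) / 2)) ?P"
      by (rule holomorphic_several_on_compose[OF holomorphic_several_on_cdot])
    have "(\<integral>\<^sup>+z\<in>?P. ennreal ((cmod (exp (K (cdot w z) / 2)))\<^sup>2 * exp (- \<phi> (a + z))) \<partial>lborel)
      \<le> (\<integral>\<^sup>+z. ennreal (exp (- \<phi> a + 2 * \<delta>)) * ennreal (indicat_real ?P z *\<^sub>R ?e z) \<partial>lborel)"
    proof (rule nn_integral_mono)
      fix z
      show "ennreal ((cmod (exp (K (cdot w z) / 2)))\<^sup>2 * exp (- \<phi> (a + z))) * indicator ?P z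
        \<le> ennreal (exp (- \<phi> a + 2 * \<delta>)) * ennreal (indicat_real ?P z *\<^sub>R ?e z)"
      proof (cases "z \<in> ?P")
        case True
        have c: "cmod (cdot w z) < r" "cmod (cdot w z) < r\<^sub>0" using True r by (simp_all add: cyl_def)
        from touch[OF c(2) s(3)[OF True]] s(4)[OF True] K(3)[OF c(1)]
        have le: "Re (K (cdot w z)) - \<phi> (a + z) \<le> (- \<phi> a + 2 * \<delta>) + (- \<epsilon> * (cmod (cdot w z))\<^sup>2)" by linarith
        have "(cmod (exp (K (cdot w z) / 2)))\<^sup>2 * exp (- \<phi> (a + z)) = exp (Re (K (cdot w z)) - \<phi> (a + z))"
          by (simp add: power2_eq_square exp_add[symmetric])
        also have "\<dots> \<le> exp (- \<phi> a + 2 * \<delta>) * ?e z"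
          using le unfolding exp_add[symmetric] by simp
        finally show ?thesis using True by (simp add: ennreal_mult[symmetric] ennreal_leI)
      qed simp
    qed
    also have "\<dots> = ennreal (exp (- \<phi> a + 2 * \<delta>)) * (\<integral>\<^sup>+z. ennreal (indicat_real ?P z *\<^sub>R ?e z) \<partial>lborel)"
      by (intro nn_integral_cmult)
         (use set_integral_gauss_cyl_le(1)[OF w r(1) \<epsilon>, of s] in \<open>auto simp: set_integrable_def dest: borel_measurable_integrable\<close>)
    also have "(\<integral>\<^sup>+z. ennreal (indicat_real ?P z *\<^sub>R ?e z) \<partial>lborel) = ennreal (LINT z:?P|lborel. ?e z)"
      using set_integral_gauss_cyl_le(1)[OF w r(1) \<epsilon>, of s]
      unfolding set_integrable_def set_lebesgue_integral_def by (intro nn_integral_eq_integral) auto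
    also have "ennreal (exp (- \<phi> a + 2 * \<delta>)) * \<dots> \<le> ennreal (exp (- \<phi> a + 2 * \<delta>)) * ennreal (\<kappa> * ?m)"
      using set_integral_gauss_cyl_le(2)[OF w r(1) \<epsilon>, of s] unfolding \<kappa>_def
      by (intro mult_left_mono ennreal_leI) auto
    also have "\<dots> = ennreal ((exp (2 * \<delta>) * \<kappa>) * (?m * exp (- \<phi> a)))"
      using \<kappa> by (simp add: ennreal_mult[symmetric] exp_diff exp_minus field_simps)
    also have "\<dots> = emeasure lborel ?P * ennreal (exp (- \<phi> (a + 0)))"
      unfolding \<delta>1 emeasure_cyl[OF w] by (simp add: ennreal_mult)
    finally show "(\<integral>\<^sup>+z\<in>?P. ennreal ((cmod (exp (K (cdot w z) / 2)))\<^sup>2 * exp (- \<phi> (a + z))) \<partial>lborel)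
      \<le> emeasure lborel ?P * ennreal (exp (- \<phi> (a + 0)))" .
  qed (simp add: K)
  \<comment> \<open>The added term vanishes at \<open>0\<close>, which keeps the normalisation, and
    its real part is at most \<open>\<delta>\<close> on the disc of radius \<open>r\<close>.\<close>
  let ?K = "\<lambda>\<zeta>. H \<zeta> + of_real (\<delta> / r) * \<zeta>"
  have adm1: "admissible (\<lambda>z. \<phi> (a + z)) ?P (\<lambda>z. exp (H (cdot w z) / 2))"
    using H \<delta>0 by (intro adm) auto
  have adm2: "admissible (\<lambda>z. \<phi> (a + z)) ?P (\<lambda>z. exp (?K (cdot w z) / 2))"
  proof (rule adm)
    show "?K holomorphic_on UNIV" using H by (intro holomorphic_intros)
    fix \<zeta> assume "cmod \<zeta> < r"
    then have "Re \<zeta> \<le> r" using complex_Re_le_cmod[of \<zeta>] by linarith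
    then have "\<delta> / r * Re \<zeta> \<le> \<delta> / r * r" using \<delta>0 r by (intro mult_left_mono) auto
    then show "Re (?K \<zeta>) \<le> Re (H \<zeta>) + \<delta>" using r by simp
  qed (simp add: H)
  \<comment> \<open>A point of the line where the added term equals \<open>\<delta> / 2\<close>, so
    that the two competitors already differ in modulus.\<close>
  let ?z = "complex_of_real (r / 2) *s w"
  have cz: "cdot w ?z = of_real (r / 2)" by (simp only: cdot_cscale cdot_self w) simp
  then have "?z \<in> ?P" unfolding cyl_def mem_Collect_eq cz using r s(1) by simp
  moreover have "unique_admissible (\<lambda>z. \<phi> (a + z)) ?P"
    using unq a w r s unfolding unique_admissible_on_def by blast
  ultimately have "exp (H (cdot w ?z) / 2) = exp (?K (cdot w ?z) / 2)"
    using adm1 adm2 unfolding unique_admissible_def by blast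
  then have "cmod (exp (H (cdot w ?z) / 2)) = cmod (exp (?K (cdot w ?z) / 2))" by simp
  then show False unfolding cz using \<delta>0 r by simp
qed

text \<open>A maximum principle, with \<open>\<sigma>\<close> selecting comparison from above or
  below. If the bound fails inside, then
  \<open>\<sigma> * (\<phi> - Re h) + \<epsilon> * |\<zeta>|^2\<close> still has an interior maximum
  for small \<open>\<epsilon>\<close>, and at that point \<open>\<phi>\<close> is strictly touched
  by a function of the forbidden kind.\<close>

lemma harmonic_comparison:
  assumes w: "norm w = 1" and disc: "\<And>\<zeta>. cmod \<zeta> \<le> R \<Longrightarrow> b + \<zeta> *s w \<in> \<Omega>"
    and h: "h holomorphic_on UNIV" and \<sigma>: "\<sigma> = 1 \<or> \<sigma> = - 1"
    and bd: "\<And>\<zeta>. cmod \<zeta> = R \<Longrightarrow> \<sigma> * (\<phi> (b + \<zeta> *s w) - Re (h \<zeta>)) \<le> \<eta>"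
    and \<zeta>\<^sub>0: "cmod \<zeta>\<^sub>0 \<le> R"
  shows "\<sigma> * (\<phi> (b + \<zeta>\<^sub>0 *s w) - Re (h \<zeta>\<^sub>0)) \<le> \<eta>"
proof (rule ccontr)
  let ?m = "\<lambda>\<zeta>. \<sigma> * (\<phi> (b + \<zeta> *s w) - Re (h \<zeta>))"
  assume "\<not> ?m \<zeta>\<^sub>0 \<le> \<eta>"
  then have \<gamma>: "?m \<zeta>\<^sub>0 > \<eta>" by simp
  then have "cmod \<zeta>\<^sub>0 \<noteq> R" using bd[of \<zeta>\<^sub>0] by auto
  then have R: "R > 0" using \<zeta>\<^sub>0 norm_ge_zero[of \<zeta>\<^sub>0] by linarith
  \<comment> \<open>On the circle the perturbation then amounts to half of the excess at the
    violating point, too little for the maximum to move to the boundary.\<close>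
  define \<epsilon> where "\<epsilon> = (?m \<zeta>\<^sub>0 - \<eta>) / (2 * R\<^sup>2)"
  have \<epsilon>: "0 < \<epsilon>" using \<gamma> R by (simp add: \<epsilon>_def)
  have \<epsilon>R: "\<epsilon> * R\<^sup>2 = (?m \<zeta>\<^sub>0 - \<eta>) / 2" using R by (simp add: \<epsilon>_def)
  have "continuous_on (cball 0 R) (\<lambda>\<zeta>. \<phi> (b + \<zeta> *s w))"
    by (rule continuous_on_compose2[OF \<phi>]) (auto intro!: continuous_intros disc)
  moreover have "continuous_on (cball 0 R) h"
    using h holomorphic_on_imp_continuous_on holomorphic_on_subset by blast
  ultimately have "continuous_on (cball 0 R) (\<lambda>\<zeta>. ?m \<zeta> + \<epsilon> * (cmod \<zeta>)\<^sup>2)"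
    by (intro continuous_intros)
  then obtain \<zeta>\<^sub>1 where \<zeta>\<^sub>1: "\<zeta>\<^sub>1 \<in> cball 0 R" "\<And>\<zeta>. \<zeta> \<in> cball 0 R \<Longrightarrow> ?m \<zeta> + \<epsilon> * (cmod \<zeta>)\<^sup>2 \<le> ?m \<zeta>\<^sub>1 + \<epsilon> * (cmod \<zeta>\<^sub>1)\<^sup>2"
    using continuous_attains_sup[of "cball 0 R" "\<lambda>\<zeta>. ?m \<zeta> + \<epsilon> * (cmod \<zeta>)\<^sup>2"] R by auto
  have "cmod \<zeta>\<^sub>1 \<noteq> R"
  proof
    assume "cmod \<zeta>\<^sub>1 = R"
    then have "?m \<zeta>\<^sub>0 + \<epsilon> * (cmod \<zeta>\<^sub>0)\<^sup>2 \<le> \<eta> + \<epsilon> * R\<^sup>2"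
      using bd[of \<zeta>\<^sub>1] \<zeta>\<^sub>1(2)[of \<zeta>\<^sub>0] \<zeta>\<^sub>0 by simp
    moreover have "0 \<le> \<epsilon> * (cmod \<zeta>\<^sub>0)\<^sup>2" using \<epsilon> by simp
    ultimately show False using \<gamma> unfolding \<epsilon>R by argo
  qed
  then have r\<^sub>0: "0 < R - cmod \<zeta>\<^sub>1" using \<zeta>\<^sub>1(1) by simp
  \<comment> \<open>Expanding \<open>\<epsilon> * |\<zeta>|^2\<close> about the maximum point gives
    a constant, the linear term that is subtracted here, and the strict quadratic term.\<close>
  define K where "K = (\<lambda>\<xi>. of_real \<sigma> * (h (\<zeta>\<^sub>1 + \<xi>) - h \<zeta>\<^sub>1) - of_real (2 * \<epsilon>) * cnj \<zeta>\<^sub>1 * \<xi>)"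
  have hol: "(\<lambda>\<xi>. h (\<zeta>\<^sub>1 + \<xi>)) holomorphic_on UNIV"
    by (rule holomorphic_on_compose_gen[of "\<lambda>\<xi>. \<zeta>\<^sub>1 + \<xi>" UNIV h UNIV, unfolded o_def])
       (intro holomorphic_on_add holomorphic_on_const holomorphic_on_ident h, simp_all add: h)
  then have K: "K holomorphic_on UNIV" "K 0 = 0"
    by (auto simp: K_def intro!: holomorphic_intros)
  let ?a = "b + \<zeta>\<^sub>1 *s w"
  have a: "?a \<in> \<Omega>" using disc \<zeta>\<^sub>1(1) by simp
  have shift: "?a + \<xi> *s w = b + (\<zeta>\<^sub>1 + \<xi>) *s w" for \<xi>
    by (simp add: vec_eq_iff algebra_simps)
  have touch: "\<sigma> * \<phi> (?a + \<xi> *s w) \<le> \<sigma> * \<phi> ?a + Re (K \<xi>) - \<epsilon> * (cmod \<xi>)\<^sup>2" if "cmod \<xi> < R - cmod \<zeta>\<^sub>1" for \<xi>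
  proof -
    have "cmod (\<zeta>\<^sub>1 + \<xi>) \<le> R" using that norm_triangle_ineq[of \<zeta>\<^sub>1 \<xi>] by linarith
    then have 1: "?m (\<zeta>\<^sub>1 + \<xi>) + \<epsilon> * (cmod (\<zeta>\<^sub>1 + \<xi>))\<^sup>2 \<le> ?m \<zeta>\<^sub>1 + \<epsilon> * (cmod \<zeta>\<^sub>1)\<^sup>2"
      by (intro \<zeta>\<^sub>1(2)) simp
    have "(cmod (\<zeta>\<^sub>1 + \<xi>))\<^sup>2 = (cmod \<zeta>\<^sub>1)\<^sup>2 + (2 * Re (cnj \<zeta>\<^sub>1 * \<xi>) + (cmod \<xi>)\<^sup>2)"
      unfolding cmod_power2 by (simp add: power2_eq_square algebra_simps)
    then have 2: "\<epsilon> * (cmod (\<zeta>\<^sub>1 + \<xi>))\<^sup>2 = \<epsilon> * (cmod \<zeta>\<^sub>1)\<^sup>2 + (2 * \<epsilon> * Re (cnj \<zeta>\<^sub>1 * \<xi>) + \<epsilon> * (cmod \<xi>)\<^sup>2)"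
      by (simp only: distrib_left)
    have 3: "Re (K \<xi>) = \<sigma> * Re (h (\<zeta>\<^sub>1 + \<xi>)) - \<sigma> * Re (h \<zeta>\<^sub>1) - 2 * \<epsilon> * Re (cnj \<zeta>\<^sub>1 * \<xi>)"
      by (simp add: K_def algebra_simps)
    show ?thesis using 1 unfolding 2 3 shift right_diff_distrib by linarith
  qed
  show False
  proof (cases "\<sigma> = 1")
    case True
    then show ?thesis using touch
      by (intro no_strict_touching_above[OF a w K \<epsilon> r\<^sub>0]) auto
  next
    case False
    then have \<sigma>: "\<sigma> = -1" using \<sigma> by simp
    show ?thesis
    proof (rule no_strict_touching_below[OF a w _ _ \<epsilon> r\<^sub>0, of "\<lambda>\<xi>. - K \<xi>"])
      show "(\<lambda>\<xi>. - K \<xi>) holomorphic_on UNIV" using K by (intro holomorphic_intros)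
      show "\<phi> ?a + Re (- K \<xi>) + \<epsilon> * (cmod \<xi>)\<^sup>2 \<le> \<phi> (?a + \<xi> *s w)" if "cmod \<xi> < R - cmod \<zeta>\<^sub>1" for \<xi>
        using touch[OF that] \<sigma> by simp
    qed (simp add: K)
  qed
qed

end

text \<open>On the circle, \<open>cnj z\<close> is \<open>R\<^sup>2 / z\<close>; so products of real parts of polynomials are real parts of polynomials.\<close>

lemma Re_poly_mult_cnj_on_sphere:
  fixes p q :: "complex poly"
  shows "\<exists>r. \<forall>z. cmod z = R \<longrightarrow> Re (poly p z * cnj (poly q z)) = Re (poly r z)"
proof (induction q arbitrary: p)
  case 0
  show ?case by (rule exI[of _ 0]) simp
next
  case (pCons b q)
  obtain a p' where p: "p = pCons a p'" by (cases p) auto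
  obtain r where r: "\<And>z. cmod z = R \<Longrightarrow> Re (poly p' z * cnj (poly q z)) = Re (poly r z)"
    using pCons.IH by blast
  have Re_mult_cnj: "Re (x * cnj y) = Re (cnj x * y)" and Re_mult_real: "Re (of_real c * x) = c * Re x" for x y c
    by simp_all
  have "Re (poly p z * cnj (poly (pCons b q) z)) =
    Re (poly (smult (cnj b) p + pCons 0 (smult (cnj a) q) + smult (of_real (R\<^sup>2)) r) z)" if z: "cmod z = R" for z
  proof -
    have zz: "z * cnj z = of_real (R\<^sup>2)" using z by (simp add: complex_norm_square[symmetric] del: of_real_power)
    \<comment> \<open>With \<open>p = a + z p'\<close>, the middle term matters only through its
      real part and may be conjugated, which makes it a polynomial; the last one carries
      \<open>z * cnj z\<close>, the constant \<open>R^2\<close>, and falls under the induction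
      hypothesis for \<open>p'\<close>.\<close>
    have "poly p z * cnj (poly (pCons b q) z) =
      cnj b * poly p z + a * cnj (z * poly q z) + (z * cnj z) * (poly p' z * cnj (poly q z))"
      by (simp add: p algebra_simps)
    also have "Re \<dots> = Re (cnj b * poly p z) + Re (a * cnj (z * poly q z)) + R\<^sup>2 * Re (poly p' z * cnj (poly q z))"
      unfolding zz by (simp only: plus_complex.sel Re_mult_real)
    also have "Re (a * cnj (z * poly q z)) = Re (cnj a * (z * poly q z))"
      by (rule Re_mult_cnj)
    finally show ?thesis
      by (simp only: r[OF z] poly_add poly_smult poly_pCons plus_complex.sel Re_mult_real add_0 mult.left_commute add.assoc)
  qed
  then show ?case by blast
qed

text \<open>Stone-Weierstrass applies to real parts of polynomials: \<open>Re p * Re q\<close> is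
  half the real part of \<open>p * q + p * cnj q\<close>, whose second summand may be replaced by a
  polynomial on the circle. \<open>Re\<close> and \<open>Im\<close> belong to the family and
  separate points.\<close>

lemma sphere_approx_Re_holomorphic:
  fixes u :: "complex \<Rightarrow> real"
  assumes "continuous_on (sphere 0 R) u" "0 < \<eta>"
  obtains h where "h holomorphic_on UNIV" "\<And>z. cmod z = R \<Longrightarrow> \<bar>u z - Re (h z)\<bar> < \<eta>"
proof -
  let ?S = "sphere (0::complex) R"
  define Q where "Q f \<longleftrightarrow> continuous_on ?S f \<and> (\<exists>p. \<forall>z\<in>?S. f z = Re (poly p z))" for f :: "complex \<Rightarrow> real"
  have "\<exists>g. Q g \<and> (\<forall>x\<in>?S. \<bar>u x - g x\<bar> < \<eta>)"
  proof (rule Stone_Weierstrass_HOL[OF compact_sphere _ _ _ _ _ assms])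
    show "Q (\<lambda>x. c)" for c
      unfolding Q_def by (auto intro!: exI[of _ "[:of_real c:]"])
    show "continuous_on ?S f" if "Q f" for f using that by (simp add: Q_def)
    show "Q (\<lambda>x. f x + g x)" if "Q f \<and> Q g" for f g
    proof -
      from that obtain p q where "\<forall>z\<in>?S. f z = Re (poly p z)" "\<forall>z\<in>?S. g z = Re (poly q z)"
        unfolding Q_def by blast
      then show ?thesis using that unfolding Q_def
        by (auto intro!: continuous_intros exI[of _ "p + q"])
    qed
    show "Q (\<lambda>x. f x * g x)" if "Q f \<and> Q g" for f g
    proof -
      from that obtain p q where pq: "\<forall>z\<in>?S. f z = Re (poly p z)" "\<forall>z\<in>?S. g z = Re (poly q z)"
        unfolding Q_def by blast
      obtain r where r: "\<And>z. cmod z = R \<Longrightarrow> Re (poly p z * cnj (poly q z)) = Re (poly r z)"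
        using Re_poly_mult_cnj_on_sphere by blast
      have "f z * g z = Re (poly (smult (1/2) (p * q + r)) z)" if "z \<in> ?S" for z
      proof -
        have "Re (poly r z) = Re (poly p z * cnj (poly q z))" using r that by simp
        then show ?thesis using pq that by (simp add: field_simps)
      qed
      then show ?thesis using that unfolding Q_def
        by (auto intro!: continuous_intros exI[of _ "smult (1/2) (p * q + r)"])
    qed
    show "\<exists>f. Q f \<and> f x \<noteq> f y" if "x \<in> ?S \<and> y \<in> ?S \<and> x \<noteq> y" for x y
    proof -
      have "Q Re" unfolding Q_def by (auto intro!: continuous_intros exI[of _ "[:0, 1:]"])
      moreover have "Q Im" unfolding Q_def by (auto intro!: continuous_intros exI[of _ "[:0, -\<i>:]"])
      ultimately show ?thesis using that complex_eqI by blast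
    qed
  qed
  then obtain g p where "\<And>x. x \<in> ?S \<Longrightarrow> \<bar>u x - g x\<bar> < \<eta>" "\<And>z. z \<in> ?S \<Longrightarrow> g z = Re (poly p z)"
    unfolding Q_def by blast
  then show ?thesis by (intro that[of "poly p"]) (auto intro!: holomorphic_intros simp: dist_norm)
qed

text \<open>If \<open>Re h\<close> is within \<open>\<eta>\<close> of \<open>\<phi>\<close> on the
  circle, comparison with both signs gives the same bound at the centre. As \<open>Re h\<close> has
  the mean value property, the mean of \<open>\<phi>\<close> and \<open>\<phi> b\<close> differ by
  at most \<open>2 * \<eta>\<close>: one \<open>\<eta>\<close> from the circle, one from the
  centre.\<close>

lemma circle_mean:
  fixes \<phi> :: "complex ^ 'n \<Rightarrow> real"
  assumes \<Omega>: "open \<Omega>" and \<phi>: "continuous_on \<Omega> \<phi>" and unq: "unique_admissible_on \<phi> \<Omega>"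
    and disc: "\<And>\<zeta>. cmod \<zeta> \<le> 1 \<Longrightarrow> b + \<zeta> *s v \<in> \<Omega>"
  shows "(LINT t:{0..1}|lborel. \<phi> (b + cis (2 * pi * t) *s v)) = \<phi> b"
proof (cases "v = 0")
  case False
  define R where "R = norm v"
  define w where "w = complex_of_real (1 / R) *s v"
  have R: "R > 0" using False by (simp add: R_def)
  have w: "norm w = 1" using R by (simp only: w_def norm_csmult norm_of_real) (simp add: R_def)
  have vw: "\<zeta> *s v = (of_real R * \<zeta>) *s w" for \<zeta> using R by (simp add: w_def vec_eq_iff)
  have wv: "\<zeta> *s w = (\<zeta> / of_real R) *s v" for \<zeta> using R by (simp add: w_def vec_eq_iff)
  have disc': "b + \<zeta> *s w \<in> \<Omega>" if "cmod \<zeta> \<le> R" for \<zeta>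
    unfolding wv using that R by (intro disc) (simp add: norm_divide)
  have cu: "continuous_on (cball 0 R) (\<lambda>\<zeta>. \<phi> (b + \<zeta> *s w))"
    by (rule continuous_on_compose2[OF \<phi>]) (auto intro!: continuous_intros disc')
  let ?I = "LINT t:{0..1}|lborel. \<phi> (b + cis (2 * pi * t) *s v)"
  have "continuous_on {0..1} (\<lambda>t. \<phi> (b + cis (2 * pi * t) *s v))"
    by (rule continuous_on_compose2[OF \<phi>]) (auto intro!: continuous_intros continuous_on_cis disc)
  then have int\<phi>: "set_integrable lborel {0..1} (\<lambda>t. \<phi> (b + cis (2 * pi * t) *s v))"
    by (rule borel_integrable_atLeastAtMost')
  have "\<bar>?I - \<phi> b\<bar> \<le> 2 * \<eta>" if \<eta>: "\<eta> > 0" for \<eta>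
  proof -
    have "continuous_on (sphere 0 R) (\<lambda>\<zeta>. \<phi> (b + \<zeta> *s w))"
      using cu by (rule continuous_on_subset) auto
    then obtain h where h: "h holomorphic_on UNIV" "\<And>z. cmod z = R \<Longrightarrow> \<bar>\<phi> (b + z *s w) - Re (h z)\<bar> < \<eta>"
      using sphere_approx_Re_holomorphic[OF _ \<eta>] by blast
    have app: "\<bar>\<phi> (b + z *s w) - Re (h z)\<bar> \<le> \<eta>" if "cmod z \<le> R" for z
    proof -
      have "1 * (\<phi> (b + z *s w) - Re (h z)) \<le> \<eta>"
        by (rule harmonic_comparison[OF \<Omega> \<phi> unq w disc' h(1) _ _ that]) (use h(2) in fastforce)+
      moreover have "- 1 * (\<phi> (b + z *s w) - Re (h z)) \<le> \<eta>"
        by (rule harmonic_comparison[OF \<Omega> \<phi> unq w disc' h(1) _ _ that]) (use h(2) in fastforce)+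
      ultimately show ?thesis by (simp only: abs_le_iff) simp
    qed
    let ?g = "\<lambda>t. h (of_real R * cis (2 * pi * t))"
    have hR: "(\<lambda>z. h (of_real R * z)) holomorphic_on UNIV"
      using holomorphic_on_compose[of "\<lambda>z. of_real R * z" UNIV h] holomorphic_on_subset[OF h(1)]
      by (auto simp: o_def intro!: holomorphic_intros)
    have hm: "(LINT t:{0..1}|lborel. ?g t) = h 0"
      using circle_mean_holomorphic[of UNIV "\<lambda>z. h (of_real R * z)"] hR by simp
    have "continuous_on {0..1} ?g"
      by (rule continuous_on_compose2[OF holomorphic_on_imp_continuous_on[OF h(1)]])
         (auto intro!: continuous_intros continuous_on_cis)
    then have intg: "set_integrable lborel {0..1} ?g"
      by (rule borel_integrable_atLeastAtMost')
    have intR: "set_integrable lborel {0..1} (\<lambda>t. Re (?g t))"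
      using integrable_Re[OF intg[unfolded set_integrable_def]] by (simp add: set_integrable_def)
    have Rm: "(LINT t:{0..1}|lborel. Re (?g t)) = Re (h 0)"
      using integral_Re[OF intg[unfolded set_integrable_def]] hm by (simp add: set_lebesgue_integral_def)
    have b: "\<bar>\<phi> (b + cis (2 * pi * t) *s v) - Re (?g t)\<bar> \<le> \<eta>" for t
      unfolding vw using R by (intro app) (simp add: norm_mult)
    have "?I - Re (h 0) = (LINT t:{0..1}|lborel. \<phi> (b + cis (2 * pi * t) *s v) - Re (?g t))"
      using int\<phi> intR Rm by simp
    also have "\<dots> \<le> (LINT t:{0..1::real}|lborel. \<eta>)"
      by (rule set_integral_mono) (use int\<phi> intR b in \<open>auto simp: abs_le_iff set_integrable_def[of _ _ "\<lambda>_. \<eta>"]\<close>)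
    finally have 1: "?I - Re (h 0) \<le> \<eta>" by (simp add: set_lebesgue_integral_def)
    have "Re (h 0) - ?I = (LINT t:{0..1}|lborel. Re (?g t) - \<phi> (b + cis (2 * pi * t) *s v))"
      using int\<phi> intR Rm by simp
    also have "\<dots> \<le> (LINT t:{0..1::real}|lborel. \<eta>)"
      by (rule set_integral_mono) (use int\<phi> intR b in \<open>auto simp: abs_le_iff set_integrable_def[of _ _ "\<lambda>_. \<eta>"]\<close>)
    finally have 2: "Re (h 0) - ?I \<le> \<eta>" by (simp add: set_lebesgue_integral_def)
    show ?thesis using 1 2 app[of 0] R by simp
  qed
  \<comment> \<open>With this \<open>\<eta>\<close> a nonzero gap would be at most half of
    itself.\<close>
  from this[of "\<bar>?I - \<phi> b\<bar> / 4"] have "\<bar>?I - \<phi> b\<bar> = 0" by (cases "\<bar>?I - \<phi> b\<bar> = 0") auto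
  then show ?thesis by simp
qed (simp add: set_lebesgue_integral_def)

section \<open>Regularity from the mean value property\<close>

text \<open>Away from \<open>0\<close> this is a power or the zero function; at \<open>0\<close> the
  difference quotient is \<open>max 0 h ^ Suc n\<close>, which tends to \<open>0\<close>.\<close>

lemma has_real_derivative_pos_part_power:
  "((\<lambda>x::real. max 0 x ^ Suc (Suc n)) has_real_derivative real (Suc (Suc n)) * max 0 x ^ Suc n) (at x)"
proof -
  consider "x > 0" | "x < 0" | "x = 0" by linarith
  then show ?thesis
  proof cases
    case 1
    have "((\<lambda>x::real. x ^ Suc (Suc n)) has_real_derivative real (Suc (Suc n)) * max 0 x ^ Suc n) (at x)"
      using 1 DERIV_pow[of "Suc (Suc n)" x] by simp
    then show ?thesis
      by (rule has_field_derivative_transform_within_open[of _ _ _ "{0<..}"]) (use 1 in auto)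
  next
    case 2
    have "((\<lambda>x::real. 0) has_real_derivative real (Suc (Suc n)) * max 0 x ^ Suc n) (at x)"
      using 2 by simp
    then show ?thesis
      by (rule has_field_derivative_transform_within_open[of _ _ _ "{..<0}"]) (use 2 in auto)
  next
    case 3
    have "isCont (\<lambda>h::real. max 0 h ^ Suc n) 0" by (intro continuous_intros)
    then have "((\<lambda>h::real. max 0 h ^ Suc n) \<longlongrightarrow> 0) (at 0)" by (simp add: isCont_def)
    then have "((\<lambda>h::real. max 0 (0 + h) ^ Suc (Suc n) / h) \<longlongrightarrow> 0) (at 0)"
      by (rule Lim_transform_eventually) (auto simp: eventually_at_filter max_def)
    then show ?thesis using 3 by (simp add: DERIV_def)
  qed
qed

text \<open>Two continuous derivatives are enough, and the third is the smallest power of the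
  positive part that has them. The function depends on the norm alone and is not normalised; its
  mass is divided out later.\<close>

definition bump :: "real \<Rightarrow> 'a::euclidean_space \<Rightarrow> real" where
  "bump e z = max 0 (e\<^sup>2 - z \<bullet> z) ^ 3"

definition bump' :: "real \<Rightarrow> 'a::euclidean_space \<Rightarrow> 'a \<Rightarrow>\<^sub>L real" where
  "bump' e z = (- 6 * max 0 (e\<^sup>2 - z \<bullet> z) ^ 2) *\<^sub>R blinfun_inner_right z"

text \<open>The Hessian: a multiple of the inner product plus the rank one form
  \<open>(z \<bullet> h) * (z \<bullet> k)\<close>, whose coefficient \<open>24\<close> is
  \<open>- 6\<close> times \<open>2\<close> times the \<open>- 2\<close> from differentiating
  \<open>- z \<bullet> z\<close>.\<close>

definition bump'' :: "real \<Rightarrow> 'a::euclidean_space \<Rightarrow> 'a \<Rightarrow>\<^sub>L ('a \<Rightarrow>\<^sub>L real)" where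
  "bump'' e z = (- 6 * max 0 (e\<^sup>2 - z \<bullet> z) ^ 2) *\<^sub>R Blinfun blinfun_inner_right +
     (24 * max 0 (e\<^sup>2 - z \<bullet> z)) *\<^sub>R
       (blinfun_scaleR_left (blinfun_inner_right z) o\<^sub>L blinfun_inner_right z)"

lemma bump_has_derivative: "(bump e has_derivative bump' e z) (at z)"
proof -
  have "((\<lambda>z. e\<^sup>2 - z \<bullet> z) has_derivative (\<lambda>h. - 2 * (z \<bullet> h))) (at z)"
    by (auto intro!: derivative_eq_intros simp: inner_commute)
  from has_derivative_compose[OF this has_real_derivative_pos_part_power[of 1, unfolded has_field_derivative_def]]
  have "(bump e has_derivative (\<lambda>h. 3 * max 0 (e\<^sup>2 - z \<bullet> z) ^ 2 * (- 2 * (z \<bullet> h)))) (at z)"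
    unfolding bump_def[abs_def] by (simp add: numeral_2_eq_2 numeral_3_eq_3)
  then show ?thesis
    by (rule has_derivative_eq_rhs) (simp add: bump'_def blinfun.scaleR_left blinfun.minus_left fun_eq_iff)
qed

lemma bump'_has_derivative: "(bump' e has_derivative bump'' e z) (at z)"
proof -
  have "((\<lambda>z. e\<^sup>2 - z \<bullet> z) has_derivative (\<lambda>h. - 2 * (z \<bullet> h))) (at z)"
    by (auto intro!: derivative_eq_intros simp: inner_commute)
  from has_derivative_compose[OF this has_real_derivative_pos_part_power[of 0, unfolded has_field_derivative_def]]
  have "((\<lambda>z. max 0 (e\<^sup>2 - z \<bullet> z) ^ 2) has_derivative (\<lambda>h. - 4 * max 0 (e\<^sup>2 - z \<bullet> z) * (z \<bullet> h))) (at z)"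
    by (simp add: numeral_2_eq_2 mult_ac)
  from has_derivative_scaleR[OF has_derivative_mult_right[OF this, of "- 6"]
      bounded_linear_imp_has_derivative[OF bounded_linear_blinfun_inner_right]]
  show ?thesis unfolding bump'_def[abs_def]
    by (rule has_derivative_eq_rhs)
       (auto simp: fun_eq_iff bump''_def blinfun.add_left blinfun.diff_left blinfun.minus_left blinfun.scaleR_left
          bounded_linear_Blinfun_apply bounded_linear_blinfun_inner_right algebra_simps)
qed

lemma continuous_on_bump: "continuous_on UNIV (bump e)"
  unfolding bump_def[abs_def] by (intro continuous_intros)

lemma continuous_on_bump': "continuous_on UNIV (bump' e)"
  by (intro continuous_at_imp_continuous_on ballI has_derivative_continuous[OF bump'_has_derivative])

lemma continuous_on_bump'': "continuous_on UNIV (bump'' e)"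
  unfolding bump''_def[abs_def]
  by (intro continuous_on_add continuous_on_scaleR continuous_on_mult continuous_on_power continuous_on_max
      continuous_on_diff continuous_on_inner continuous_on_const continuous_on_id
      bounded_bilinear.continuous_on[OF bounded_bilinear_blinfun_compose]
      bounded_linear.continuous_on[OF bounded_linear_blinfun_inner_right]
      bounded_linear.continuous_on[OF bounded_linear_blinfun_scaleR_left])

text \<open>The parameter \<open>b\<close> sits in the bump only, so every derivative falls on it
  and continuity of \<open>\<phi>\<close> suffices for differentiating twice under the integral.
  Each derivative in \<open>b\<close> brings a sign, which cancels the second time.\<close>

lemma bump_convolution_C2:
  fixes \<phi> :: "'a::euclidean_space \<Rightarrow> real"
  assumes \<phi>: "continuous_on (cbox l u) \<phi>"
  obtains J' :: "'a \<Rightarrow> 'a \<Rightarrow>\<^sub>L real" and J'' :: "'a \<Rightarrow> 'a \<Rightarrow>\<^sub>L ('a \<Rightarrow>\<^sub>L real)" where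
    "\<And>b. ((\<lambda>b. integral (cbox l u) (\<lambda>t. \<phi> t *\<^sub>R bump e (t - b))) has_derivative J' b) (at b)"
    "\<And>b. (J' has_derivative J'' b) (at b)" "continuous_on UNIV J''"
proof
  let ?C = "cbox l u"
  have shift: "((\<lambda>x. t - x) has_derivative (\<lambda>h. - h)) (at x)" for x t :: 'a
    by (auto intro!: derivative_eq_intros)
  have d1: "((\<lambda>b. \<phi> t *\<^sub>R bump e (t - b)) has_derivative blinfun_apply (- \<phi> t *\<^sub>R bump' e (t - b))) (at b)" for t b
    using has_derivative_scaleR_right[OF has_derivative_compose[OF shift bump_has_derivative]]
    by (rule has_derivative_eq_rhs) (auto simp: blinfun.scaleR_left blinfun.minus_right blinfun.minus_left)
  have d2: "((\<lambda>b. - \<phi> t *\<^sub>R bump' e (t - b)) has_derivative blinfun_apply (\<phi> t *\<^sub>R bump'' e (t - b))) (at b)" for t b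
    using has_derivative_scaleR_right[OF has_derivative_compose[OF shift bump'_has_derivative]]
    by (rule has_derivative_eq_rhs) (auto simp: blinfun.scaleR_left blinfun.minus_right)
  have c: "continuous_on (UNIV \<times> ?C) (\<lambda>(b, t). \<phi> t *\<^sub>R K (t - b))" "continuous_on ?C (\<lambda>t. \<phi> t *\<^sub>R K (t - b))"
    if "continuous_on UNIV K" for K :: "'a \<Rightarrow> 'b::real_normed_vector" and b
    unfolding case_prod_beta
    by (auto intro!: continuous_intros continuous_on_compose2[OF \<phi>] continuous_on_compose2[OF that])
  have m: "continuous_on UNIV (\<lambda>z. - bump' e z)" by (rule continuous_on_minus[OF continuous_on_bump'])
  show "((\<lambda>b. integral ?C (\<lambda>t. \<phi> t *\<^sub>R bump e (t - b))) has_derivative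
      blinfun_apply (integral ?C (\<lambda>t. - \<phi> t *\<^sub>R bump' e (t - b)))) (at b)" for b
    by (rule leibniz_rule[where U = UNIV])
       (use d1 c[OF continuous_on_bump] c[OF m] in \<open>auto intro!: integrable_continuous\<close>)
  show "((\<lambda>b. integral ?C (\<lambda>t. - \<phi> t *\<^sub>R bump' e (t - b))) has_derivative
      blinfun_apply (integral ?C (\<lambda>t. \<phi> t *\<^sub>R bump'' e (t - b)))) (at b)" for b
    by (rule leibniz_rule[where U = UNIV])
       (use d2 c[OF m] c[OF continuous_on_bump''] in \<open>auto intro!: integrable_continuous\<close>)
  show "continuous_on UNIV (\<lambda>b. integral ?C (\<lambda>t. \<phi> t *\<^sub>R bump'' e (t - b)))"
    by (rule integral_continuous_on_param[OF c(1)[OF continuous_on_bump'']])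
qed

text \<open>\<open>C2_on\<close> asks for one pair of derivative functions on all of
  \<open>S\<close>. They are defined pointwise by choice; uniqueness of derivatives identifies them
  with the local ones on each open \<open>U\<close>, first \<open>f'\<close>, which then can be
  differentiated, and afterwards \<open>f''\<close>.\<close>

lemma C2_on_locally:
  fixes f :: "'a::euclidean_space \<Rightarrow> 'b::real_normed_vector"
  assumes loc: "\<And>b. b \<in> S \<Longrightarrow> \<exists>U. open U \<and> b \<in> U \<and> C2_on f U"
  shows "C2_on f S"
proof -
  define f' where "f' z = (SOME D. (f has_derivative blinfun_apply D) (at z))" for z
  define f'' where "f'' z = (SOME D. (f' has_derivative blinfun_apply D) (at z))" for z
  have *: "\<exists>U. open U \<and> b \<in> U \<and> (\<forall>z\<in>U. (f has_derivative f' z) (at z)) \<and>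
      (\<forall>z\<in>U. (f' has_derivative f'' z) (at z)) \<and> continuous_on U f''" if bS: "b \<in> S" for b
  proof -
    obtain U where U: "open U" "b \<in> U" "C2_on f U" using loc[OF bS] by blast
    from U(3) obtain g g'' where *: "\<forall>z\<in>U. (f has_derivative blinfun_apply (g z)) (at z)"
      "\<forall>z\<in>U. (g has_derivative blinfun_apply (g'' z)) (at z)" "continuous_on U g''"
      unfolding C2_on_def by (elim exE conjE)
    note g = *(1)[rule_format] *(2)[rule_format] *(3)
    have f': "(f has_derivative f' z) (at z)" "f' z = g z" if "z \<in> U" for z
    proof -
      show "(f has_derivative f' z) (at z)" unfolding f'_def using g(1)[OF that] by (rule someI)
      from has_derivative_unique[OF this g(1)[OF that]] show "f' z = g z"
        by (simp add: blinfun_apply_inject)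
    qed
    have g'': "(f' has_derivative g'' z) (at z)" if "z \<in> U" for z
      by (rule has_derivative_transform_within_open[OF g(2)[OF that] U(1) that]) (simp add: f')
    have f'': "(f' has_derivative f'' z) (at z)" "f'' z = g'' z" if "z \<in> U" for z
    proof -
      show "(f' has_derivative f'' z) (at z)" unfolding f''_def using g''[OF that] by (rule someI)
      from has_derivative_unique[OF this g''[OF that]] show "f'' z = g'' z"
        by (simp add: blinfun_apply_inject)
    qed
    have "continuous_on U f''" using g(3) f''(2) by (simp cong: continuous_on_cong)
    then show ?thesis using U(1,2) f'(1) f''(1) by (intro exI[of _ U]) simp
  qed
  have "continuous_on S f''"
    unfolding continuous_on_eq_continuous_within
  proof
    fix b assume "b \<in> S"
    then obtain U where "open U" "b \<in> U" "continuous_on U f''" using * by blast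
    then show "continuous (at b within S) f''"
      by (simp add: continuous_on_eq_continuous_at continuous_at_imp_continuous_at_within)
  qed
  then show ?thesis unfolding C2_on_def using * by blast
qed

text \<open>A nonzero value would persist on a ball, yet the zero integral makes that ball a null
  set.\<close>

lemma continuous_nonneg_integral_zero:
  fixes k :: "'a::euclidean_space \<Rightarrow> real"
  assumes S: "open S" "z \<in> S" and k: "continuous_on S k" "\<And>z. z \<in> S \<Longrightarrow> 0 \<le> k z"
    and int: "set_integrable lborel S k" "(LINT z:S|lborel. k z) = 0"
  shows "k z = 0"
proof (rule ccontr)
  define N where "N = S \<inter> k -` (- {0})"
  assume "k z \<noteq> 0"
  then have "z \<in> N" using S by (simp add: N_def)
  have "open N" unfolding N_def using k(1) S(1) by (intro continuous_open_preimage) auto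
  then obtain d where d: "0 < d" "ball z d \<subseteq> N" using \<open>z \<in> N\<close> open_contains_ball by blast
  have "AE z in lborel. indicator S z *\<^sub>R k z = 0"
    using int k(2) unfolding set_lebesgue_integral_def set_integrable_def
    by (subst (asm) integral_nonneg_eq_0_iff_AE) (auto simp: indicator_def)
  then have "AE x in lborel. x \<notin> ball z d"
  proof eventually_elim
    case (elim x)
    then show ?case using d(2) by (auto simp: N_def subset_iff)
  qed
  then have "emeasure lborel (ball z d) = 0"
    by (subst AE_iff_measurable[symmetric, of "ball z d" lborel "\<lambda>x. x \<notin> ball z d"]) auto
  then have "measure lborel (ball z d) = 0" by (simp add: measure_def)
  then show False using d(1) content_ball_gt_0_iff[of z d] by simp
qed

lemma circle_mean_imp_C2:
  fixes \<phi> :: "complex ^ 'n \<Rightarrow> real"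
  assumes \<Omega>: "open \<Omega>" and \<phi>: "continuous_on \<Omega> \<phi>"
    and mean: "\<And>b v. (\<And>\<zeta>. cmod \<zeta> \<le> 1 \<Longrightarrow> b + \<zeta> *s v \<in> \<Omega>) \<Longrightarrow>
      (LINT t:{0..1}|lborel. \<phi> (b + cis (2 * pi * t) *s v)) = \<phi> b"
  shows "C2_on \<phi> \<Omega>"
proof (rule C2_on_locally)
  fix b\<^sub>0 assume "b\<^sub>0 \<in> \<Omega>"
  then obtain l u where lu: "cbox l u \<subseteq> \<Omega>" "b\<^sub>0 \<in> box l u"
    using open_contains_cbox[OF \<Omega>] by metis
  obtain e\<^sub>0 where e\<^sub>0: "0 < e\<^sub>0" "ball b\<^sub>0 e\<^sub>0 \<subseteq> box l u"
    using lu(2) open_contains_ball[of "box l u"] open_box by blast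
  \<comment> \<open>Points within \<open>e\<close> of \<open>b\<close> are within
    \<open>2 * e\<close> of the original centre, hence in the box on which the integral is
    taken.\<close>
  define e where "e = e\<^sub>0 / 3"
  have e: "0 < e" using e\<^sub>0 by (simp add: e_def)
  have sub: "cball b e \<subseteq> cbox l u" if "b \<in> ball b\<^sub>0 e" for b
  proof
    fix x assume "x \<in> cball b e"
    then have "dist b\<^sub>0 x < e + e" using that dist_triangle[of b\<^sub>0 x b] by simp
    then have "x \<in> ball b\<^sub>0 e\<^sub>0" using e by (simp add: e_def)
    then show "x \<in> cbox l u" using e\<^sub>0(2) box_subset_cbox by blast
  qed
  let ?B = "ball 0 e :: (complex ^ 'n) set"
  define C where "C = (LINT z:?B|lborel. bump e z)"
  have contb: "continuous_on S (bump e :: complex ^ 'n \<Rightarrow> real)" for S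
    using continuous_on_bump continuous_on_subset by blast
  have contbox: "continuous_on (cbox l u) \<phi>" using \<phi> lu(1) continuous_on_subset by blast
  have bump0: "bump e z = 0" if "z \<notin> ?B" for z
  proof -
    have "e\<^sup>2 \<le> (norm z)\<^sup>2" using that e by (intro power_mono) auto
    then show ?thesis by (simp add: bump_def dot_square_norm)
  qed
  have bump_pos: "0 < bump e z" if "z \<in> ?B" for z
  proof -
    have "(norm z)\<^sup>2 < e\<^sup>2" using that by (intro power_strict_mono) auto
    then show ?thesis by (simp add: bump_def dot_square_norm)
  qed
  have intg: "set_integrable lborel ?B G" if "continuous_on (cball 0 e) G" for G :: "complex ^ 'n \<Rightarrow> real"
  proof (rule set_integrable_subset)
    show "set_integrable lborel (cball 0 e) G"
      unfolding set_integrable_def by (rule borel_integrable_compact[OF compact_cball that])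
  qed auto
  have C: "C \<noteq> 0"
  proof
    assume "C = 0"
    then have "bump e (0 :: complex ^ 'n) = 0"
      using e bump_pos unfolding C_def
      by (intro continuous_nonneg_integral_zero[OF open_ball _ contb _ intg[OF contb]]) (auto simp: less_imp_le)
    then show False using e bump_pos[of 0] by simp
  qed
  have repr: "integral (cbox l u) (\<lambda>t. \<phi> t *\<^sub>R bump e (t - b)) = \<phi> b * C" if b: "b \<in> ball b\<^sub>0 e" for b
  proof -
    have "continuous_on (cbox l u) (\<lambda>t. \<phi> t *\<^sub>R bump e (t - b))"
      by (intro continuous_intros contbox continuous_on_compose2[OF contb[of UNIV]]) auto
    then have "set_integrable lborel (cbox l u) (\<lambda>t. \<phi> t *\<^sub>R bump e (t - b))"
      unfolding set_integrable_def by (rule borel_integrable_compact[OF compact_cbox])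
    then have int: "integrable lborel (\<lambda>t. indicator (cbox l u) t *\<^sub>R (\<phi> t *\<^sub>R bump e (t - b)))"
      "integral (cbox l u) (\<lambda>t. \<phi> t *\<^sub>R bump e (t - b)) = (LINT t:cbox l u|lborel. \<phi> t *\<^sub>R bump e (t - b))"
      by (simp_all add: set_integrable_def set_borel_integral_eq_integral)
    note int(2)
    also have "(LINT t:cbox l u|lborel. \<phi> t *\<^sub>R bump e (t - b)) =
      (LINT t|distr lborel borel ((+) b). indicator (cbox l u) t *\<^sub>R (\<phi> t *\<^sub>R bump e (t - b)))"
      by (simp add: set_lebesgue_integral_def lborel_distr_plus)
    also have "\<dots> = (LINT z|lborel. indicator (cbox l u) (b + z) *\<^sub>R (\<phi> (b + z) *\<^sub>R bump e (b + z - b)))"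
      using int(1) by (intro integral_distr) auto
    also have "\<dots> = (LINT z:?B|lborel. bump e z * \<phi> (b + z))"
      unfolding set_lebesgue_integral_def
    proof (intro Bochner_Integration.integral_cong refl)
      fix z
      have "z \<in> ?B \<Longrightarrow> b + z \<in> cbox l u" using sub[OF b] by (auto simp: dist_norm)
      then show "indicator (cbox l u) (b + z) *\<^sub>R (\<phi> (b + z) *\<^sub>R bump e (b + z - b)) =
          indicat_real ?B z *\<^sub>R (bump e z * \<phi> (b + z))"
        using bump0[of z] by (cases "z \<in> ?B") auto
    qed
    \<comment> \<open>The bump is constant on each circle of points \<open>cis t *s z\<close>, and
      \<open>\<phi>\<close> has mean \<open>\<phi> b\<close> over the translated circle.\<close>
    also have "\<dots> = (LINT z:?B|lborel. bump e z * \<phi> b)"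
    proof (rule set_integral_circle_mean)
      have "continuous_on (cball 0 e) (\<lambda>z. \<phi> (b + z))"
        by (rule continuous_on_compose2[OF contbox])
           (use sub[OF b] in \<open>auto intro!: continuous_intros simp: dist_norm subset_iff\<close>)
      then have ct: "continuous_on (cball 0 e) (\<lambda>z. bump e z * \<phi> (b + z))"
        by (intro continuous_intros contb)
      then show "continuous_on ?B (\<lambda>z. bump e z * \<phi> (b + z))"
        by (rule continuous_on_subset) auto
      show "set_integrable lborel ?B (\<lambda>z. bump e z * \<phi> (b + z))" by (rule intg[OF ct])
      fix z assume z: "z \<in> ?B"
      have "bump e (cis (2 * pi * t) *s z) = bump e z" for t
        by (simp add: bump_def dot_square_norm norm_csmult)
      moreover have "(LINT t:{0..1}|lborel. \<phi> (b + cis (2 * pi * t) *s z)) = \<phi> b"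
      proof (rule mean)
        fix \<zeta> assume "cmod \<zeta> \<le> 1"
        then have "norm (\<zeta> *s z) \<le> 1 * norm z" unfolding norm_csmult by (intro mult_right_mono) auto
        then have "b + \<zeta> *s z \<in> cball b e" using z by (simp add: dist_norm)
        then show "b + \<zeta> *s z \<in> \<Omega>" using sub[OF b] lu(1) by blast
      qed
      ultimately show "(LINT t:{0..1}|lborel. bump e (cis (2 * pi * t) *s z) * \<phi> (b + cis (2 * pi * t) *s z)) = bump e z * \<phi> b"
        by simp
    qed (auto simp: norm_csmult)
    also have "\<dots> = \<phi> b * C" by (simp add: C_def mult.commute)
    finally show ?thesis .
  qed
  obtain J' :: "complex ^ 'n \<Rightarrow> (complex ^ 'n) \<Rightarrow>\<^sub>L real" and J'' where
    J: "\<And>b. ((\<lambda>b. integral (cbox l u) (\<lambda>t. \<phi> t *\<^sub>R bump e (t - b))) has_derivative J' b) (at b)"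
    "\<And>b. (J' has_derivative blinfun_apply (J'' b)) (at b)" "continuous_on UNIV J''"
    by (rule bump_convolution_C2[OF contbox, of e]) (rule that)
  have "C2_on \<phi> (ball b\<^sub>0 e)"
    unfolding C2_on_def
  proof (intro exI conjI ballI)
    fix z assume z: "z \<in> ball b\<^sub>0 e"
    have "((\<lambda>b. (1 / C) *\<^sub>R integral (cbox l u) (\<lambda>t. \<phi> t *\<^sub>R bump e (t - b))) has_derivative ((1 / C) *\<^sub>R J' z)) (at z)"
      by (rule has_derivative_eq_rhs[OF has_derivative_scaleR_right[OF J(1)]]) (auto simp: blinfun.scaleR_left)
    then show "(\<phi> has_derivative ((1 / C) *\<^sub>R J' z)) (at z)"
      by (rule has_derivative_transform_within_open[OF _ open_ball z]) (simp add: repr[unfolded real_scaleR_def] C)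
    show "((\<lambda>z. (1 / C) *\<^sub>R J' z) has_derivative ((1 / C) *\<^sub>R J'' z)) (at z)"
      by (rule has_derivative_eq_rhs[OF has_derivative_scaleR_right[OF J(2)]]) (auto simp: blinfun.scaleR_left)
  next
    show "continuous_on (ball b\<^sub>0 e) (\<lambda>z. (1 / C) *\<^sub>R J'' z)"
      using continuous_on_subset[OF J(3)] by (intro continuous_on_scaleR continuous_on_const) auto
  qed
  then show "\<exists>U. open U \<and> b\<^sub>0 \<in> U \<and> C2_on \<phi> U" using e by (intro exI[of _ "ball b\<^sub>0 e"]) auto
qed

section \<open>Second order expansion and the trace on complex lines\<close>

text \<open>The second difference is an increment of
  \<open>g x = f (z0 + t u + x v) - f (z0 + x v)\<close>. The one-variable mean value theorem turns
  it into a difference of two values of \<open>f'\<close>, each linearised at the base point; the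
  factor \<open>2\<close> counts the two remainders.\<close>

lemma second_difference_bound:
  fixes f :: "'a::real_normed_vector \<Rightarrow> real" and f' :: "'a \<Rightarrow> 'a \<Rightarrow>\<^sub>L real" and B :: "'a \<Rightarrow>\<^sub>L ('a \<Rightarrow>\<^sub>L real)"
  assumes f: "\<And>z. z \<in> ball z\<^sub>0 d \<Longrightarrow> (f has_derivative f' z) (at z)"
    and B: "\<And>h. norm h < d \<Longrightarrow> norm (f' (z\<^sub>0 + h) - f' z\<^sub>0 - B h) \<le> \<epsilon> * norm h"
    and t: "0 < t" "t * (norm u + norm v) < d" and \<epsilon>: "0 \<le> \<epsilon>"
  shows "\<bar>(f (z\<^sub>0 + t *\<^sub>R u + t *\<^sub>R v) - f (z\<^sub>0 + t *\<^sub>R u) - f (z\<^sub>0 + t *\<^sub>R v) + f z\<^sub>0) - t\<^sup>2 * B u v\<bar>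
    \<le> 2 * \<epsilon> * t\<^sup>2 * (norm u + norm v)\<^sup>2"
proof -
  define g where "g x = f (z\<^sub>0 + t *\<^sub>R u + x *\<^sub>R v) - f (z\<^sub>0 + x *\<^sub>R v)" for x
  have n: "norm (t *\<^sub>R u + x *\<^sub>R v) \<le> t * (norm u + norm v)" "norm (x *\<^sub>R v) \<le> t * (norm u + norm v)"
    if "0 \<le> x" "x \<le> t" for x
  proof -
    have x: "x * norm v \<le> t * norm v" using that by (intro mult_right_mono) auto
    have "norm (t *\<^sub>R u + x *\<^sub>R v) \<le> t * norm u + x * norm v"
      using norm_triangle_ineq[of "t *\<^sub>R u" "x *\<^sub>R v"] that t by simp
    then show "norm (t *\<^sub>R u + x *\<^sub>R v) \<le> t * (norm u + norm v)" using x by (simp add: distrib_left)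
    have "0 \<le> t * norm u" using t by simp
    moreover have "norm (x *\<^sub>R v) = x * norm v" using that by simp
    ultimately show "norm (x *\<^sub>R v) \<le> t * (norm u + norm v)" using x unfolding distrib_left by linarith
  qed
  have "\<exists>x\<in>{0<..<t}. g t - g 0 = (\<lambda>x h. f' (z\<^sub>0 + t *\<^sub>R u + x *\<^sub>R v) (h *\<^sub>R v) - f' (z\<^sub>0 + x *\<^sub>R v) (h *\<^sub>R v)) x (t - 0)"
  proof (rule mvt_simple[OF t(1)])
    fix x assume x: "0 \<le> x" "x \<le> t"
    have "z\<^sub>0 + h \<in> ball z\<^sub>0 d" if "norm h \<le> t * (norm u + norm v)" for h
      using that t by (simp add: dist_norm)
    from this[OF n(1)[OF x]] this[OF n(2)[OF x]]
    have "z\<^sub>0 + t *\<^sub>R u + x *\<^sub>R v \<in> ball z\<^sub>0 d" "z\<^sub>0 + x *\<^sub>R v \<in> ball z\<^sub>0 d"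
      unfolding add.assoc by blast+
    note d = this[THEN f]
    have l: "((\<lambda>x. c + x *\<^sub>R v) has_derivative (\<lambda>h. h *\<^sub>R v)) (at x within {0..t})" for c
      by (auto intro!: derivative_eq_intros)
    show "(g has_derivative (\<lambda>h. f' (z\<^sub>0 + t *\<^sub>R u + x *\<^sub>R v) (h *\<^sub>R v) - f' (z\<^sub>0 + x *\<^sub>R v) (h *\<^sub>R v))) (at x within {0..t})"
      unfolding g_def[abs_def]
      by (intro has_derivative_diff has_derivative_compose[OF l] d)
  qed
  then obtain x where "x \<in> {0<..<t}" and
    "g t - g 0 = f' (z\<^sub>0 + t *\<^sub>R u + x *\<^sub>R v) ((t - 0) *\<^sub>R v) - f' (z\<^sub>0 + x *\<^sub>R v) ((t - 0) *\<^sub>R v)"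
    by blast
  then have x: "0 \<le> x" "x \<le> t" and
    g: "g t - g 0 = t * (f' (z\<^sub>0 + t *\<^sub>R u + x *\<^sub>R v) v - f' (z\<^sub>0 + x *\<^sub>R v) v)"
    by (simp_all add: blinfun.scaleR_right right_diff_distrib)
  define R where "R h = f' (z\<^sub>0 + h) - f' z\<^sub>0 - B h" for h
  let ?N = "norm u + norm v"
  have R: "norm (R h) \<le> \<epsilon> * (t * ?N)" if "norm h \<le> t * ?N" for h
  proof -
    have "norm (R h) \<le> \<epsilon> * norm h" unfolding R_def using that t by (intro B) linarith
    also have "\<dots> \<le> \<epsilon> * (t * ?N)" using that \<epsilon> by (intro mult_left_mono)
    finally show ?thesis .
  qed
  \<comment> \<open>The linear parts combine to \<open>B (t u + x v) - B (x v) = t B u\<close>, so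
    the unknown point \<open>x\<close> survives only in the remainders.\<close>
  have "g t - g 0 - t\<^sup>2 * B u v = t * (R (t *\<^sub>R u + x *\<^sub>R v) v - R (x *\<^sub>R v) v)"
    unfolding g R_def
    by (simp add: blinfun.diff_left blinfun.add_left blinfun.add_right blinfun.scaleR_left blinfun.scaleR_right
        add.assoc power2_eq_square algebra_simps)
  also have "\<bar>\<dots>\<bar> \<le> t * (2 * (\<epsilon> * (t * ?N)) * norm v)"
  proof -
    have "\<bar>R h v\<bar> \<le> \<epsilon> * (t * ?N) * norm v" if "norm h \<le> t * ?N" for h
      using norm_blinfun[of "R h" v] mult_right_mono[OF R[OF that], of "norm v"] by simp
    from this[OF n(1)[OF x]] this[OF n(2)[OF x]]
    have "\<bar>R (t *\<^sub>R u + x *\<^sub>R v) v - R (x *\<^sub>R v) v\<bar> \<le> 2 * (\<epsilon> * (t * ?N)) * norm v" by linarith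
    then show ?thesis using t by (simp add: abs_mult)
  qed
  also have "\<dots> \<le> t * (2 * (\<epsilon> * (t * ?N)) * ?N)"
    using t \<epsilon> by (intro mult_left_mono) auto
  also have "\<dots> = 2 * \<epsilon> * t\<^sup>2 * ?N\<^sup>2" by (simp add: power2_eq_square)
  finally show ?thesis by (simp add: g_def algebra_simps)
qed

lemma derivative_remainder_bound:
  assumes "(f' has_derivative B) (at z\<^sub>0)" "open S" "z\<^sub>0 \<in> S" "0 < \<epsilon>"
  obtains d where "0 < d" "ball z\<^sub>0 d \<subseteq> S"
    "\<And>h. norm h < d \<Longrightarrow> norm (f' (z\<^sub>0 + h) - f' z\<^sub>0 - B h) \<le> \<epsilon> * norm h"
proof -
  obtain d\<^sub>1 where d\<^sub>1: "0 < d\<^sub>1" "\<And>y. norm (y - z\<^sub>0) < d\<^sub>1 \<Longrightarrow> norm (f' y - f' z\<^sub>0 - B (y - z\<^sub>0)) \<le> \<epsilon> * norm (y - z\<^sub>0)"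
    using assms(1,4) unfolding has_derivative_at_alt by blast
  obtain d\<^sub>2 where d\<^sub>2: "0 < d\<^sub>2" "ball z\<^sub>0 d\<^sub>2 \<subseteq> S" using assms(2,3) open_contains_ball by blast
  show ?thesis
    by (rule that[of "min d\<^sub>1 d\<^sub>2"]) (use d\<^sub>1(1) d\<^sub>1(2)[of "z\<^sub>0 + _"] d\<^sub>2 in auto)
qed

text \<open>The second difference is symmetric in \<open>u\<close> and \<open>v\<close> and
  approximates both \<open>t^2 * B u v\<close> and \<open>t^2 * B v u\<close> with error
  \<open>\<epsilon> * t^2\<close> up to a constant factor.\<close>

lemma second_derivative_symmetric:
  fixes f :: "'a::real_normed_vector \<Rightarrow> real" and f' :: "'a \<Rightarrow> 'a \<Rightarrow>\<^sub>L real" and B :: "'a \<Rightarrow>\<^sub>L ('a \<Rightarrow>\<^sub>L real)"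
  assumes S: "open S" "z\<^sub>0 \<in> S" and f: "\<And>z. z \<in> S \<Longrightarrow> (f has_derivative f' z) (at z)"
    and B: "(f' has_derivative B) (at z\<^sub>0)"
  shows "B u v = B v u"
proof -
  let ?N = "norm u + norm v"
  have bd: "\<bar>B u v - B v u\<bar> \<le> \<epsilon> * (4 * ?N\<^sup>2)" if \<epsilon>: "0 < \<epsilon>" for \<epsilon>
  proof -
    obtain d where d: "0 < d" "ball z\<^sub>0 d \<subseteq> S"
      "\<And>h. norm h < d \<Longrightarrow> norm (f' (z\<^sub>0 + h) - f' z\<^sub>0 - B h) \<le> \<epsilon> * norm h"
      using derivative_remainder_bound[OF B S \<epsilon>] by blast
    \<comment> \<open>The summand \<open>1\<close> keeps the denominator positive when both vectors
      vanish and makes \<open>t * ?N < d\<close> strict.\<close>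
    define t where "t = d / (?N + 1)"
    have N: "0 < ?N + 1" by (simp add: add_nonneg_pos)
    then have t: "0 < t" using d by (simp add: t_def)
    have "t * ?N < t * (?N + 1)" using t by simp
    also have "\<dots> = d" using N by (simp add: t_def)
    finally have tN: "t * ?N < d" .
    have fd: "(f has_derivative f' z) (at z)" if "z \<in> ball z\<^sub>0 d" for z using f d(2) that by blast
    note b1 = second_difference_bound[OF fd d(3) t tN less_imp_le[OF \<epsilon>]]
    have tN': "t * (norm v + norm u) < d" using tN by (simp add: add.commute)
    note b2 = second_difference_bound[OF fd d(3) t tN' less_imp_le[OF \<epsilon>]]
    have "f (z\<^sub>0 + t *\<^sub>R v + t *\<^sub>R u) = f (z\<^sub>0 + t *\<^sub>R u + t *\<^sub>R v)" by (simp add: algebra_simps)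
    then have "\<bar>t\<^sup>2 * B u v - t\<^sup>2 * B v u\<bar> \<le> 2 * (2 * \<epsilon> * t\<^sup>2 * ?N\<^sup>2)"
      using b1 b2 by (simp add: add.commute[of "norm v"])
    moreover have "\<bar>t\<^sup>2 * B u v - t\<^sup>2 * B v u\<bar> = t\<^sup>2 * \<bar>B u v - B v u\<bar>"
      by (simp only: right_diff_distrib[symmetric] abs_mult abs_power2)
    ultimately have "t\<^sup>2 * \<bar>B u v - B v u\<bar> \<le> t\<^sup>2 * (\<epsilon> * (4 * ?N\<^sup>2))"
      by (simp add: mult_ac)
    then show ?thesis using t by simp
  qed
  have "\<bar>B u v - B v u\<bar> \<le> 0"
  proof (rule field_le_epsilon)
    fix e :: real assume e: "0 < e"
    have N: "0 < 4 * ?N\<^sup>2 + 1" by (simp add: add_nonneg_pos)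
    then have "\<bar>B u v - B v u\<bar> \<le> e / (4 * ?N\<^sup>2 + 1) * (4 * ?N\<^sup>2)" using e by (intro bd) simp
    also have "\<dots> \<le> e" using e N by (simp add: divide_le_eq)
    finally show "\<bar>B u v - B v u\<bar> \<le> 0 + e" by simp
  qed
  then show ?thesis by simp
qed

text \<open>
  The sum over the four points \<open>v, \<i>v, -v, -\<i>v\<close> kills the first order terms of the Taylor expansion,
  and its second order term is invariant under \<open>v \<mapsto> cis t *s v\<close>.
\<close>

lemma circle_mean_imp_trace_zero:
  fixes \<phi> :: "complex ^ 'n \<Rightarrow> real" and f' :: "complex ^ 'n \<Rightarrow> (complex ^ 'n) \<Rightarrow>\<^sub>L real"
    and B :: "(complex ^ 'n) \<Rightarrow>\<^sub>L ((complex ^ 'n) \<Rightarrow>\<^sub>L real)"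
  assumes \<Omega>: "open \<Omega>" "b \<in> \<Omega>" and f: "\<And>z. z \<in> \<Omega> \<Longrightarrow> (\<phi> has_derivative f' z) (at z)"
    and B: "(f' has_derivative B) (at b)"
    and mean: "\<And>b v. (\<And>\<zeta>. cmod \<zeta> \<le> 1 \<Longrightarrow> b + \<zeta> *s v \<in> \<Omega>) \<Longrightarrow>
      (LINT t:{0..1}|lborel. \<phi> (b + cis (2 * pi * t) *s v)) = \<phi> b"
  shows "B v v + B (\<i> *s v) (\<i> *s v) = 0"
proof -
  have sym: "B x y = B y x" for x y by (rule second_derivative_symmetric[OF \<Omega> f B])
  define L where "L = B v v + B (\<i> *s v) (\<i> *s v)"
  have cisv: "cis \<theta> *s v = cos \<theta> *\<^sub>R v + sin \<theta> *\<^sub>R (\<i> *s v)" for \<theta>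
    by (simp add: vec_eq_iff complex_eq_iff)
  have icisv: "\<i> *s (cis \<theta> *s v) = cos \<theta> *\<^sub>R (\<i> *s v) - sin \<theta> *\<^sub>R v" for \<theta>
    by (simp add: vec_eq_iff complex_eq_iff)
  have rot: "B (cis \<theta> *s v) (cis \<theta> *s v) + B (\<i> *s (cis \<theta> *s v)) (\<i> *s (cis \<theta> *s v)) = L" for \<theta>
  proof -
    have "B (cis \<theta> *s v) (cis \<theta> *s v) + B (\<i> *s (cis \<theta> *s v)) (\<i> *s (cis \<theta> *s v))
      = ((cos \<theta>)\<^sup>2 + (sin \<theta>)\<^sup>2) * L"
      unfolding icisv unfolding cisv L_def
      by (simp add: blinfun.add_left blinfun.add_right blinfun.diff_left blinfun.diff_right
          blinfun.scaleR_left blinfun.scaleR_right sym[of "\<i> *s v" v] power2_eq_square algebra_simps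
          del: sin_cos_squared_add sin_cos_squared_add2 sin_cos_squared_add3)
    then show ?thesis by simp
  qed
  have bd: "\<bar>L\<bar> \<le> \<epsilon> * (4 * (norm v)\<^sup>2)" if \<epsilon>: "0 < \<epsilon>" for \<epsilon>
  proof -
    obtain d where d: "0 < d" "ball b d \<subseteq> \<Omega>"
      "\<And>h. norm h < d \<Longrightarrow> norm (f' (b + h) - f' b - B h) \<le> \<epsilon> * norm h"
      using derivative_remainder_bound[OF B \<Omega> \<epsilon>] by blast
    \<comment> \<open>Up to the constant \<open>\<phi> b\<close> this is the Taylor remainder. By
      symmetry of \<open>B\<close> its derivative at \<open>h\<close> is
      \<open>f' (b + h) - f' b - B h\<close>, which is small on the ball of radius
      \<open>norm h\<close>.\<close>
    define g where "g h = \<phi> (b + h) - f' b h - 1 / 2 * B h h" for h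
    have dg: "(g has_derivative blinfun_apply (f' (b + h) - f' b - B h)) (at h)" if "norm h < d" for h
    proof -
      have "b + h \<in> \<Omega>" using that d(2) by (auto simp: dist_norm subset_iff)
      moreover have "((\<lambda>h. b + h) has_derivative (\<lambda>h. h)) (at h)"
        by (auto intro!: derivative_eq_intros)
      ultimately have 1: "((\<lambda>h. \<phi> (b + h)) has_derivative f' (b + h)) (at h)"
        using has_derivative_compose[of "\<lambda>h. b + h" "\<lambda>h. h" h UNIV \<phi> "f' (b + h)"] f by blast
      have 2: "((\<lambda>h. B h h) has_derivative (\<lambda>k. B h k + B k h)) (at h)"
        by (rule bounded_bilinear.FDERIV[OF bounded_bilinear_blinfun_apply
              bounded_linear_imp_has_derivative[OF blinfun.bounded_linear_right] has_derivative_ident])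
      show ?thesis unfolding g_def[abs_def]
        by (rule has_derivative_eq_rhs[OF has_derivative_diff[OF has_derivative_diff[OF 1
                bounded_linear_imp_has_derivative[OF blinfun.bounded_linear_right]]
                has_derivative_mult_right[OF 2]]])
           (auto simp: blinfun.diff_left sym)
    qed
    have taylor: "\<bar>\<phi> (b + h) - \<phi> b - f' b h - B h h / 2\<bar> \<le> \<epsilon> * (norm h)\<^sup>2" if h: "norm h < d" for h
    proof -
      have "norm (g h - g 0) \<le> (\<epsilon> * norm h) * norm (h - 0)"
      proof (rule differentiable_bound[of "cball (0 :: complex ^ 'n) (norm h)"])
        fix x :: "complex ^ 'n" assume "x \<in> cball 0 (norm h)"
        then have x: "norm x \<le> norm h" by simp
        show "(g has_derivative blinfun_apply (f' (b + x) - f' b - B x)) (at x within cball 0 (norm h))"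
          using dg[of x] x h has_derivative_at_withinI by fastforce
        have "norm (f' (b + x) - f' b - B x) \<le> \<epsilon> * norm x" using x h by (intro d(3)) linarith
        also have "\<dots> \<le> \<epsilon> * norm h" using x \<epsilon> by simp
        finally show "onorm (blinfun_apply (f' (b + x) - f' b - B x)) \<le> \<epsilon> * norm h"
          by (simp add: norm_blinfun.rep_eq)
      qed auto
      then show ?thesis by (simp add: g_def power2_eq_square algebra_simps)
    qed
    define t where "t = d / (norm v + 1)"
    have N: "0 < norm v + 1" by (simp add: add_nonneg_pos)
    then have t: "0 < t" using d by (simp add: t_def)
    have "t * norm v < t * (norm v + 1)" using t by simp
    also have "\<dots> = d" using N by (simp add: t_def)
    finally have tv: "t * norm v < d" .
    define V where "V c = c *s (t *\<^sub>R v)" for c :: complex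
    have nV: "norm (V c) = t * norm v" if "cmod c = 1" for c
      using t that by (simp add: V_def norm_csmult)
    have VB: "B (V (c * cis \<theta>)) (V (c * cis \<theta>)) = t\<^sup>2 * B (c *s (cis \<theta> *s v)) (c *s (cis \<theta> *s v))" for c \<theta>
    proof -
      have "V (c * cis \<theta>) = t *\<^sub>R (c *s (cis \<theta> *s v))" by (simp add: V_def vec_eq_iff scaleR_conv_of_real)
      then show ?thesis by (simp add: blinfun.scaleR_left blinfun.scaleR_right power2_eq_square)
    qed
    have disc: "b + \<zeta> *s V c \<in> \<Omega>" if "cmod c = 1" "cmod \<zeta> \<le> 1" for c \<zeta>
    proof -
      have "norm (\<zeta> *s V c) \<le> 1 * (t * norm v)"
        unfolding norm_csmult nV[OF that(1)] using that t by (intro mult_right_mono) auto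
      then have "b + \<zeta> *s V c \<in> ball b d" using tv by (simp add: dist_norm)
      then show ?thesis using d(2) by blast
    qed
    have contm: "set_integrable lborel {0..1} (\<lambda>s. \<phi> (b + cis (2 * pi * s) *s V c))"
      and m: "(LINT s:{0..1}|lborel. \<phi> (b + cis (2 * pi * s) *s V c)) = \<phi> b" if "cmod c = 1" for c
    proof -
      have "continuous_on \<Omega> \<phi>"
        by (intro continuous_at_imp_continuous_on ballI has_derivative_continuous[OF f])
      then have "continuous_on {0..1} (\<lambda>s. \<phi> (b + cis (2 * pi * s) *s V c))"
        by (rule continuous_on_compose2) (auto intro!: continuous_intros continuous_on_cis disc that)
      then show "set_integrable lborel {0..1} (\<lambda>s. \<phi> (b + cis (2 * pi * s) *s V c))"
        by (rule borel_integrable_atLeastAtMost')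
      show "(LINT s:{0..1}|lborel. \<phi> (b + cis (2 * pi * s) *s V c)) = \<phi> b"
        by (rule mean) (rule disc[OF that])
    qed
    let ?p = "\<lambda>c s. \<phi> (b + cis (2 * pi * s) *s V c)"
    let ?E = "t\<^sup>2 * (norm v)\<^sup>2 * \<epsilon>"
    \<comment> \<open>Opposite points cancel the linear terms \<open>y\<close>, while
      \<open>q 1 + q \<i> = t^2 * L / 2\<close> occurs twice. Each of the four remainders is at most
      \<open>?E\<close>.\<close>
    have four: "\<bar>?p 1 s + ?p \<i> s + ?p (-1) s + ?p (-\<i>) s - (4 * \<phi> b + t\<^sup>2 * L)\<bar> \<le> 4 * ?E" for s
    proof -
      let ?c = "cis (2 * pi * s)"
      have p: "?p c s = \<phi> (b + V (c * ?c))" for c by (simp add: V_def vec_eq_iff mult_ac)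
      have T: "\<bar>\<phi> (b + V (c * ?c)) - \<phi> b - f' b (V (c * ?c)) - t\<^sup>2 * B (c *s (?c *s v)) (c *s (?c *s v)) / 2\<bar> \<le> ?E"
        if "cmod c = 1" for c
        using taylor[of "V (c * ?c)"] tv that nV[of "c * ?c"]
        unfolding VB by (simp add: norm_mult power_mult_distrib mult_ac)
      have neg: "f' b (V (- c)) = - f' b (V c)" for c
        by (simp add: V_def blinfun.minus_right[symmetric] vec_eq_iff)
      have Bneg: "B (- c *s w) (- c *s w) = B (c *s w) (c *s w)" for c w
        by (simp add: vector_sneg_minus1[symmetric] blinfun.minus_right blinfun.minus_left)
      define q where "q c = t\<^sup>2 * B (c *s (?c *s v)) (c *s (?c *s v)) / 2" for c
      define y where "y c = f' b (V (c * ?c))" for c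
      have qn: "q (- c) = q c" and yn: "y (- c) = - y c" for c
        unfolding q_def y_def using Bneg neg[of "c * ?c"] by simp_all
      have "q 1 + q \<i> = t\<^sup>2 * L / 2"
        unfolding rot[of "2 * pi * s", symmetric] q_def by (simp add: distrib_left add_divide_distrib)
      moreover have "\<bar>?p c s - \<phi> b - y c - q c\<bar> \<le> ?E" if "cmod c = 1" for c
        unfolding p q_def y_def by (rule T[OF that])
      note this[of 1] this[of "\<i>"] this[of "-1"] this[of "-\<i>"]
      ultimately show ?thesis unfolding qn yn by simp
    qed
    have i: "set_integrable lborel {0..1} (\<lambda>s. ?p 1 s + ?p \<i> s + ?p (-1) s + ?p (-\<i>) s)"
      by (intro set_integral_add contm) auto
    have I: "(LINT s:{0..1}|lborel. ?p 1 s + ?p \<i> s + ?p (-1) s + ?p (-\<i>) s) = 4 * \<phi> b"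
      using contm m by (simp add: set_integral_add)
    have ci: "set_integrable lborel {0..1} (\<lambda>s::real. c)" for c :: real
      by (simp add: set_integrable_def)
    have cI: "(LINT s:{0..1::real}|lborel. c) = c" for c :: real
      by (simp add: set_lebesgue_integral_def)
    \<comment> \<open>Each of the four summands has mean \<open>\<phi> b\<close> over
      \<open>s\<close>, so integrating the estimate leaves only \<open>t^2 * L\<close> and the
      error.\<close>
    have "4 * \<phi> b \<le> (LINT s:{0..1::real}|lborel. 4 * \<phi> b + t\<^sup>2 * L + 4 * ?E)"
      unfolding I[symmetric]
    proof (rule set_integral_mono[OF i ci])
      show "?p 1 s + ?p \<i> s + ?p (-1) s + ?p (-\<i>) s \<le> (LINT s:{0..1}|lborel. ?p 1 s + ?p \<i> s + ?p (-1) s + ?p (-\<i>) s) + t\<^sup>2 * L + 4 * ?E" for s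
        unfolding I using four[of s] by linarith
    qed
    moreover have "(LINT s:{0..1::real}|lborel. 4 * \<phi> b + t\<^sup>2 * L - 4 * ?E) \<le> (LINT s:{0..1}|lborel. ?p 1 s + ?p \<i> s + ?p (-1) s + ?p (-\<i>) s)"
    proof (rule set_integral_mono[OF ci i])
      show "4 * \<phi> b + t\<^sup>2 * L - 4 * ?E \<le> ?p 1 s + ?p \<i> s + ?p (-1) s + ?p (-\<i>) s" for s
        using four[of s] by linarith
    qed
    ultimately have "\<bar>t\<^sup>2 * L\<bar> \<le> 4 * ?E" unfolding I cI by linarith
    then have "t\<^sup>2 * \<bar>L\<bar> \<le> t\<^sup>2 * (\<epsilon> * (4 * (norm v)\<^sup>2))" by (simp add: abs_mult mult_ac)
    then show ?thesis using t by simp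
  qed
  have "\<bar>L\<bar> \<le> 0"
  proof (rule field_le_epsilon)
    fix e :: real assume e: "0 < e"
    have N: "0 < 4 * (norm v)\<^sup>2 + 1" by (simp add: add_nonneg_pos)
    then have "\<bar>L\<bar> \<le> e / (4 * (norm v)\<^sup>2 + 1) * (4 * (norm v)\<^sup>2)" using e by (intro bd) simp
    also have "\<dots> \<le> e" using e N by (simp add: divide_le_eq)
    finally show "\<bar>L\<bar> \<le> 0 + e" by simp
  qed
  then show ?thesis by (simp add: L_def)
qed

section \<open>Pluriharmonic functions as real parts\<close>

text \<open>The Poincare lemma for one-forms: \<open>sym\<close> says that the form \<open>L\<close>
  is closed, and the primitive is its integral along the segment from \<open>0\<close>.\<close>

lemma poincare_starshaped:
  fixes L :: "'a::euclidean_space \<Rightarrow> ('a \<Rightarrow>\<^sub>L 'b::banach)" and L' :: "'a \<Rightarrow> 'a \<Rightarrow>\<^sub>L ('a \<Rightarrow>\<^sub>L 'b)"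
  assumes S: "open S" and star: "\<And>z t. z \<in> S \<Longrightarrow> 0 \<le> t \<Longrightarrow> t \<le> 1 \<Longrightarrow> t *\<^sub>R z \<in> S"
    and L: "\<And>z. z \<in> S \<Longrightarrow> (L has_derivative L' z) (at z)" and cont: "continuous_on S L'"
    and sym: "\<And>z u v. z \<in> S \<Longrightarrow> L' z u v = L' z v u" and z: "z \<in> S"
  shows "((\<lambda>z. integral {0..1} (\<lambda>t. L (t *\<^sub>R z) z)) has_derivative L z) (at z)"
proof -
  obtain e where e: "0 < e" "ball z e \<subseteq> S" using S z open_contains_ball by blast
  let ?U = "ball z e"
  \<comment> \<open>This is the \<open>t\<close>-derivative of \<open>t L (t x)\<close>. It arises
    as the derivative of the integrand in \<open>x\<close> once symmetry moves the increment into
    the last argument.\<close>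
  define K where "K = (\<lambda>x t. t *\<^sub>R L' (t *\<^sub>R x) x + L (t *\<^sub>R x))"
  have contL: "continuous_on S L"
    by (intro continuous_at_imp_continuous_on ballI has_derivative_continuous[OF L])
  have mem: "t *\<^sub>R x \<in> S" if "x \<in> ?U" "t \<in> {0..1}" for x t
    using that e(2) by (intro star) auto
  have scale: "continuous_on (?U \<times> {0..1}) (\<lambda>p. snd p *\<^sub>R fst p)"
    by (intro continuous_on_scaleR continuous_on_snd continuous_on_fst continuous_on_id)
  have cK: "continuous_on (?U \<times> {0..1}) (\<lambda>(x, t). K x t)"
    unfolding K_def case_prod_beta
    by (intro continuous_on_add continuous_on_scaleR continuous_on_snd continuous_on_fst continuous_on_id
        bounded_bilinear.continuous_on[OF bounded_bilinear_blinfun_apply]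
        continuous_on_compose2[OF cont scale] continuous_on_compose2[OF contL scale])
      (use mem in auto)
  have cL: "continuous_on {0..1} (\<lambda>t. L (t *\<^sub>R x) x)" if "x \<in> ?U" for x
    by (intro bounded_bilinear.continuous_on[OF bounded_bilinear_blinfun_apply] continuous_on_const
        continuous_on_compose2[OF contL, of _ "\<lambda>t. t *\<^sub>R x"] continuous_on_scaleR continuous_on_id)
      (use mem that in auto)
  have "((\<lambda>x. integral (cbox 0 1) (\<lambda>t. L (t *\<^sub>R x) x)) has_derivative integral (cbox 0 1) (K z)) (at z within ?U)"
  proof (rule leibniz_rule)
    fix x t assume x: "x \<in> ?U" and "t \<in> cbox (0::real) 1"
    then have tx: "t *\<^sub>R x \<in> S" by (intro mem) simp_all
    have "((\<lambda>x. t *\<^sub>R x) has_derivative (\<lambda>h. t *\<^sub>R h)) (at x)"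
      by (auto intro!: derivative_eq_intros)
    from has_derivative_compose[OF this L[OF tx]]
    have "((\<lambda>x. L (t *\<^sub>R x)) has_derivative (\<lambda>h. L' (t *\<^sub>R x) (t *\<^sub>R h))) (at x)" .
    from bounded_bilinear.FDERIV[OF bounded_bilinear_blinfun_apply this has_derivative_ident]
    have "((\<lambda>x. L (t *\<^sub>R x) x) has_derivative (\<lambda>h. L (t *\<^sub>R x) h + L' (t *\<^sub>R x) (t *\<^sub>R h) x)) (at x)" .
    then have "((\<lambda>x. L (t *\<^sub>R x) x) has_derivative blinfun_apply (K x t)) (at x)"
      by (rule has_derivative_eq_rhs)
         (auto simp: K_def blinfun.add_left blinfun.scaleR_left blinfun.scaleR_right sym[OF tx] add.commute)
    then show "((\<lambda>x. L (t *\<^sub>R x) x) has_derivative blinfun_apply (K x t)) (at x within ?U)"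
      by (rule has_derivative_at_withinI)
  next
    show "(\<lambda>t. L (t *\<^sub>R x) x) integrable_on cbox 0 1" if "x \<in> ?U" for x
      using cL[OF that] by (intro integrable_continuous) simp
  qed (use cK e in auto)
  moreover have "(K z has_integral 1 *\<^sub>R L (1 *\<^sub>R z) - 0 *\<^sub>R L (0 *\<^sub>R z)) {0..1}"
  proof (rule fundamental_theorem_of_calculus)
    fix t :: real assume t: "t \<in> {0..1}"
    have "((\<lambda>t. t *\<^sub>R z) has_derivative (\<lambda>h. h *\<^sub>R z)) (at t within {0..1})"
      by (auto intro!: derivative_eq_intros)
    from has_derivative_compose[OF this L] t e
    have "((\<lambda>t. L (t *\<^sub>R z)) has_derivative (\<lambda>h. L' (t *\<^sub>R z) (h *\<^sub>R z))) (at t within {0..1})"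
      using mem[of z t] by simp
    from has_derivative_scaleR[OF has_derivative_ident this]
    show "((\<lambda>t. t *\<^sub>R L (t *\<^sub>R z)) has_vector_derivative K z t) (at t within {0..1})"
      unfolding has_vector_derivative_def K_def
      by (rule has_derivative_eq_rhs) (auto simp: blinfun.scaleR_right algebra_simps)
  qed simp
  ultimately show ?thesis
    using e(1) at_within_open[of z ?U] by (simp add: integral_unique)
qed

section \<open>The Levi form and the conjugate differential\<close>

lemma axis_imaginary: "axis j \<i> = \<i> *s axis j (1::complex)"
  by (simp add: vec_eq_iff axis_def)

text \<open>Splits the mixed derivative into real and imaginary parts, so that pluriharmonicity
  becomes two real identities for the Hessian \<open>B\<close>; both implications of the theorem
  pass through them.\<close>

lemma wirtinger_wirtinger_bar:
  fixes f' :: "complex ^ 'n \<Rightarrow> (complex ^ 'n) \<Rightarrow>\<^sub>L real" and B :: "(complex ^ 'n) \<Rightarrow>\<^sub>L ((complex ^ 'n) \<Rightarrow>\<^sub>L real)"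
  assumes \<Omega>: "open \<Omega>" "z \<in> \<Omega>" and f: "\<And>z. z \<in> \<Omega> \<Longrightarrow> (\<phi> has_derivative f' z) (at z)"
    and B: "(f' has_derivative B) (at z)"
  shows "wirtinger j (wirtinger_bar k (\<lambda>w. complex_of_real (\<phi> w))) z =
    (of_real (B (axis j 1) (axis k 1) + B (axis j \<i>) (axis k \<i>)) +
     \<i> * of_real (B (axis j 1) (axis k \<i>) - B (axis j \<i>) (axis k 1))) / 4"
proof -
  let ?g = "\<lambda>w. (of_real (f' w (axis k 1)) + \<i> * of_real (f' w (axis k \<i>))) / (2 :: complex)"
  have wb: "wirtinger_bar k (\<lambda>w. complex_of_real (\<phi> w)) w = ?g w" if "w \<in> \<Omega>" for w
  proof -
    have "((\<lambda>w. complex_of_real (\<phi> w)) has_derivative (\<lambda>h. of_real (f' w h))) (at w)"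
      by (rule has_derivative_of_real[OF f[OF that]])
    from frechet_derivative_at[OF this, symmetric]
    show ?thesis by (simp add: wirtinger_bar_def)
  qed
  have "(?g has_derivative (\<lambda>h. (of_real (B h (axis k 1)) + \<i> * of_real (B h (axis k \<i>))) / 2)) (at z)"
    by (auto intro!: derivative_eq_intros B simp: fun_eq_iff field_simps)
  then have "(wirtinger_bar k (\<lambda>w. complex_of_real (\<phi> w)) has_derivative
      (\<lambda>h. (of_real (B h (axis k 1)) + \<i> * of_real (B h (axis k \<i>))) / 2)) (at z)"
    by (rule has_derivative_transform_within_open[OF _ \<Omega>]) (simp add: wb)
  from frechet_derivative_at[OF this, symmetric]
  show ?thesis by (simp add: wirtinger_def field_simps)
qed

text \<open>The conclusion states that the form \<open>v \<mapsto> D (\<i> *s v)\<close>, for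
  \<open>D\<close> the differential, is closed. Both sides are real bilinear, and on real basis
  vectors the four combinations of \<open>1\<close> and \<open>\<i>\<close> reduce to the two
  identities \<open>levi\<close> and symmetry.\<close>

lemma pluriharmonic_cauchy_riemann:
  fixes B :: "(complex ^ 'n) \<Rightarrow>\<^sub>L ((complex ^ 'n) \<Rightarrow>\<^sub>L real)"
  assumes sym: "\<And>u v. B u v = B v u"
    and levi: "\<And>j k. B (axis j 1) (axis k 1) + B (axis j \<i>) (axis k \<i>) = 0"
      "\<And>j k. B (axis j 1) (axis k \<i>) = B (axis j \<i>) (axis k 1)"
  shows "B u (\<i> *s v) = B v (\<i> *s u)"
proof -
  have l: "linear (\<lambda>v. B u (\<i> *s v))" "linear (\<lambda>v. B v (\<i> *s u))" for u
    by (rule linearI; simp add: blinfun.add_left blinfun.add_right blinfun.scaleR_left blinfun.scaleR_right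
        vector_add_ldistrib linear_cmul[OF linear_csmult])+
  have "(\<lambda>u v. B u (\<i> *s v)) = (\<lambda>u v. B v (\<i> *s u))"
  proof (rule bilinear_eq_stdbasis)
    show "bilinear (\<lambda>u v. B u (\<i> *s v))" "bilinear (\<lambda>u v. B v (\<i> *s u))"
      using l by (auto simp: bilinear_def)
    fix x y :: "complex ^ 'n" assume "x \<in> Basis" "y \<in> Basis"
    then obtain j k b c where x: "x = axis j b" "b = 1 \<or> b = \<i>" and y: "y = axis k c" "c = 1 \<or> c = \<i>"
      by (auto simp: Basis_vec_def Basis_complex_def)
    have i: "\<i> *s axis m 1 = axis m \<i>" "\<i> *s axis m \<i> = - axis m (1::complex)" for m :: 'n
      by (simp_all add: vec_eq_iff axis_def)
    have "B (axis j 1) (axis k \<i>) = B (axis k 1) (axis j \<i>)"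
      using levi(2)[of j k] sym by simp
    moreover have "B (axis j \<i>) (axis k \<i>) = - B (axis k 1) (axis j 1)"
      using levi(1)[of j k] sym[of "axis j 1" "axis k 1"] by simp
    moreover have "B (axis k \<i>) (axis j \<i>) = - B (axis j 1) (axis k 1)"
      using levi(1)[of k j] sym[of "axis j 1" "axis k 1"] by simp
    moreover have "B (axis j \<i>) (axis k 1) = B (axis k \<i>) (axis j 1)"
      using levi(2)[of j k] sym by metis
    ultimately show "B x (\<i> *s y) = B y (\<i> *s x)"
      using x(2) y(2) unfolding x(1) y(1) by (auto simp: i blinfun.minus_right)
  qed
  then show ?thesis by meson
qed

lemma pluriharmonic_eq_Re_holomorphic:
  fixes \<phi> :: "complex ^ 'n \<Rightarrow> real"
  assumes ph: "pluriharmonic_on \<phi> \<Omega>" and \<Omega>: "open \<Omega>" and P: "open P" "(+) a ` P \<subseteq> \<Omega>" "0 \<in> P"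
    and star: "\<And>z t. z \<in> P \<Longrightarrow> 0 \<le> t \<Longrightarrow> t \<le> 1 \<Longrightarrow> t *\<^sub>R z \<in> P"
  obtains h where "holomorphic_several_on h P" "h 0 = 0" "\<And>z. z \<in> P \<Longrightarrow> Re (h z) = \<phi> (a + z) - \<phi> a"
proof -
  obtain f' f'' where f: "\<And>z. z \<in> \<Omega> \<Longrightarrow> (\<phi> has_derivative blinfun_apply (f' z)) (at z)"
    "\<And>z. z \<in> \<Omega> \<Longrightarrow> (f' has_derivative blinfun_apply (f'' z)) (at z)" "continuous_on \<Omega> f''"
    using ph unfolding pluriharmonic_on_def C2_on_def by (elim exE conjE) (rule that, auto)
  have sym: "f'' z u v = f'' z v u" if "z \<in> \<Omega>" for z u v
    by (rule second_derivative_symmetric[OF \<Omega> that f(1) f(2)[OF that]])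
  have CR: "f'' z u (\<i> *s v) = f'' z v (\<i> *s u)" if z: "z \<in> \<Omega>" for z u v
  proof (rule pluriharmonic_cauchy_riemann[OF sym[OF z]])
    fix j k
    have "(of_real (f'' z (axis j 1) (axis k 1) + f'' z (axis j \<i>) (axis k \<i>)) +
      \<i> * of_real (f'' z (axis j 1) (axis k \<i>) - f'' z (axis j \<i>) (axis k 1))) / (4::complex) = 0"
      using wirtinger_wirtinger_bar[OF \<Omega> z f(1) f(2)[OF z], of j k] ph z
      by (simp add: pluriharmonic_on_def)
    then show "f'' z (axis j 1) (axis k 1) + f'' z (axis j \<i>) (axis k \<i>) = 0"
      "f'' z (axis j 1) (axis k \<i>) = f'' z (axis j \<i>) (axis k 1)"
      by (simp_all add: complex_eq_iff)
  qed
  define J where "J = Blinfun ((*s) \<i> :: complex ^ 'n \<Rightarrow> complex ^ 'n)"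
  \<comment> \<open>\<open>D - \<i> * (D o J)\<close> is the complex linear form with real part
    \<open>D\<close>, where \<open>J\<close> is multiplication by \<open>\<i>\<close>. It is bounded
    linear in \<open>D\<close>, so it commutes with differentiation.\<close>
  define \<Phi> where "\<Phi> D = (Blinfun complex_of_real o\<^sub>L D) - (Blinfun (\<lambda>x. \<i> * complex_of_real x) o\<^sub>L (D o\<^sub>L J))"
    for D :: "(complex ^ 'n) \<Rightarrow>\<^sub>L real"
  have bl: "bounded_linear \<Phi>"
    unfolding \<Phi>_def[abs_def]
    by (intro bounded_linear_sub bounded_bilinear.bounded_linear_right[OF bounded_bilinear_blinfun_compose]
        bounded_linear_compose[OF bounded_bilinear.bounded_linear_right[OF bounded_bilinear_blinfun_compose]
          bounded_bilinear.bounded_linear_left[OF bounded_bilinear_blinfun_compose]])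
  have \<Phi>: "\<Phi> D v = of_real (D v) - \<i> * of_real (D (\<i> *s v))" for D v
    by (simp add: \<Phi>_def J_def blinfun.diff_left bounded_linear_Blinfun_apply bounded_linear_csmult
        bounded_linear_of_real bounded_linear_compose[OF bounded_linear_mult_right bounded_linear_of_real])
  define L where "L z = \<Phi> (f' (a + z))" for z
  define L' where "L' z = Blinfun \<Phi> o\<^sub>L f'' (a + z)" for z
  have aP: "a + z \<in> \<Omega>" if "z \<in> P" for z using P(2) that by blast
  have tr: "((\<lambda>x. a + x) has_derivative (\<lambda>h. h)) (at z)" for z
    by (auto intro!: derivative_eq_intros)
  have dL: "(L has_derivative L' z) (at z)" if "z \<in> P" for z
  proof -
    have "((\<lambda>z. \<Phi> (f' (a + z))) has_derivative (\<lambda>h. \<Phi> (f'' (a + z) h))) (at z)"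
      by (rule bounded_linear.has_derivative[OF bl has_derivative_compose[OF tr f(2)[OF aP[OF that]]]])
    then show ?thesis
      unfolding L_def[abs_def] by (rule has_derivative_eq_rhs) (simp add: L'_def bounded_linear_Blinfun_apply bl fun_eq_iff)
  qed
  have cL': "continuous_on P L'"
    unfolding L'_def[abs_def]
    by (intro bounded_bilinear.continuous_on[OF bounded_bilinear_blinfun_compose] continuous_on_const
        continuous_on_compose2[OF f(3)] continuous_on_add continuous_on_id) (use aP in auto)
  \<comment> \<open>Closedness of the complex form: symmetry of the Hessian gives the real part,
    \<open>CR\<close> the imaginary part.\<close>
  have sL': "L' z u v = L' z v u" if "z \<in> P" for z u v
    using sym[OF aP[OF that], of u v] CR[OF aP[OF that], of u v]
    by (simp add: L'_def bounded_linear_Blinfun_apply bl \<Phi>)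
  define h where "h z = integral {0..1} (\<lambda>t. L (t *\<^sub>R z) z)" for z
  have dh: "(h has_derivative L z) (at z)" if "z \<in> P" for z
    unfolding h_def[abs_def]
    by (rule poincare_starshaped[OF P(1) star dL cL' sL' that])
  have "holomorphic_several_on h P"
    unfolding holomorphic_several_on_def
  proof (intro ballI exI conjI allI)
    fix c and z v :: "complex ^ 'n" assume "z \<in> P"
    then show "(h has_derivative L z) (at z)" by (rule dh)
    have "c *s v = Re c *\<^sub>R v + Im c *\<^sub>R (\<i> *s v)" by (simp add: vec_eq_iff complex_eq_iff)
    moreover have "\<i> *s (\<i> *s v) = - v" by (simp add: vec_eq_iff)
    ultimately show "L z (c *s v) = c * L z v"
      by (simp add: blinfun.add_right blinfun.scaleR_right L_def \<Phi> blinfun.minus_right complex_eq_iff algebra_simps)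
  qed
  moreover have h0: "h 0 = 0" by (simp add: h_def)
  moreover have "Re (h z) = \<phi> (a + z) - \<phi> a" if z: "z \<in> P" for z
  proof -
    have "starlike P"
      unfolding starlike_def
    proof (intro bexI[OF _ P(3)] ballI subsetI)
      fix x y assume "x \<in> P" "y \<in> closed_segment 0 x"
      then show "y \<in> P" using star by (auto simp: closed_segment_def)
    qed
    then have "connected P" by (rule starlike_imp_connected)
    moreover have "((\<lambda>z. Re (h z) - \<phi> (a + z)) has_derivative (\<lambda>_. 0)) (at x)" if "x \<in> P" for x
      using has_derivative_diff[OF bounded_linear.has_derivative[OF bounded_linear_Re dh[OF that]]
          has_derivative_compose[OF tr f(1)[OF aP[OF that]]]]
      by (simp add: L_def \<Phi>)
    ultimately have "Re (h z) - \<phi> (a + z) = Re (h 0) - \<phi> (a + 0)"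
      using has_derivative_zero_unique_connected[OF P(1) _ _ z P(3), of "\<lambda>z. Re (h z) - \<phi> (a + z)"] by blast
    then show ?thesis by (simp add: h0)
  qed
  ultimately show ?thesis by (rule that)
qed

section \<open>The two implications\<close>

lemma holomorphic_mean_square_le_imp_one:
  fixes g :: "complex ^ 'n \<Rightarrow> complex"
  assumes w: "norm w = 1" and g: "holomorphic_several_on g (cyl w r s)" "g 0 = 1"
    and le: "(\<integral>\<^sup>+z\<in>cyl w r s. ennreal ((cmod (g z))\<^sup>2) \<partial>lborel) \<le> emeasure lborel (cyl w r s)"
    and z: "z \<in> cyl w r s"
  shows "g z = 1"
proof -
  let ?P = "cyl w r s" and ?m = "measure lborel (cyl w r s)"
  have cg: "continuous_on ?P g" by (rule holomorphic_several_on_imp_continuous_on[OF g(1)])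
  have c2: "continuous_on ?P (\<lambda>z. (cmod (g z))\<^sup>2)" by (intro continuous_intros cg)
  note sq = set_integrable_if_nn_integral_finite[OF open_cyl c2 _ le_less_trans[OF le emeasure_cyl_finite[OF w]]]
  have i2: "set_integrable lborel ?P (\<lambda>z. (cmod (g z))\<^sup>2)" by (rule sq(1)) simp
  have i1: "set_integrable lborel ?P g" by (rule set_integrable_if_square_integrable[OF w cg i2])
  have "0 \<le> (LINT z:?P|lborel. (cmod (g z))\<^sup>2)"
    unfolding set_lebesgue_integral_def by (intro Bochner_Integration.integral_nonneg) simp
  then have I2: "(LINT z:?P|lborel. (cmod (g z))\<^sup>2) \<le> ?m"
    using sq(2) le unfolding emeasure_cyl[OF w] by (simp add: ennreal_le_iff)
  have iR: "set_integrable lborel ?P (\<lambda>z. 2 * Re (g z))"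
    using integrable_Re[OF i1[unfolded set_integrable_def]]
    by (intro set_integrable_mult_right) (simp add: set_integrable_def)
  have "(LINT z:?P|lborel. Re (g z)) = Re (LINT z:?P|lborel. g z)"
    using integral_Re[OF i1[unfolded set_integrable_def]] by (simp add: set_lebesgue_integral_def)
  then have IR: "(LINT z:?P|lborel. 2 * Re (g z)) = 2 * ?m"
    by (simp add: set_integral_cyl_holomorphic[OF w g(1) i1] g(2))
  have "integrable lborel (indicat_real ?P)"
    using emeasure_cyl_finite[OF w] by (auto intro!: integrable_real_indicator)
  then have ic: "set_integrable lborel ?P (\<lambda>z. 1 :: real)" and Ic: "(LINT z:?P|lborel. 1 :: real) = ?m"
    by (simp_all add: set_integrable_def set_lebesgue_integral_def)
  have eq: "(cmod (g z - 1))\<^sup>2 = (cmod (g z))\<^sup>2 - 2 * Re (g z) + 1" for z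
    unfolding cmod_power2 by (simp add: power2_eq_square algebra_simps)
  have id: "set_integrable lborel ?P (\<lambda>z. (cmod (g z))\<^sup>2 - 2 * Re (g z))"
    by (rule set_integral_diff(1)[OF i2 iR])
  have i: "set_integrable lborel ?P (\<lambda>z. (cmod (g z - 1))\<^sup>2)"
    unfolding eq by (rule set_integral_add(1)[OF id ic])
  \<comment> \<open>The three terms of the expanded square contribute at most \<open>?m\<close>,
    exactly \<open>- 2 * ?m\<close> and \<open>?m\<close>.\<close>
  have "(LINT z:?P|lborel. (cmod (g z - 1))\<^sup>2) \<le> 0"
    unfolding eq set_integral_add(2)[OF id ic] set_integral_diff(2)[OF i2 iR] IR Ic using I2 by simp
  moreover have "0 \<le> (LINT z:?P|lborel. (cmod (g z - 1))\<^sup>2)"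
    unfolding set_lebesgue_integral_def by (intro Bochner_Integration.integral_nonneg) simp
  ultimately have "(LINT z:?P|lborel. (cmod (g z - 1))\<^sup>2) = 0" by simp
  then have "(cmod (g z - 1))\<^sup>2 = 0"
    by (intro continuous_nonneg_integral_zero[OF open_cyl z _ _ i] continuous_intros cg) auto
  then show ?thesis by simp
qed

lemma pluriharmonic_imp_unique_admissible:
  fixes \<phi> :: "complex ^ 'n \<Rightarrow> real"
  assumes ph: "pluriharmonic_on \<phi> \<Omega>" and \<Omega>: "open \<Omega>" and \<phi>: "continuous_on \<Omega> \<phi>"
    and w: "norm w = 1" and rs: "0 < r" "0 < s" and sub: "(+) a ` cyl w r s \<subseteq> \<Omega>"
  shows "unique_admissible (\<lambda>z. \<phi> (a + z)) (cyl w r s)"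
proof -
  let ?P = "cyl w r s"
  have "t *\<^sub>R z \<in> ?P" if "z \<in> ?P" "0 \<le> t" "t \<le> 1" for z t
    unfolding scaleR_eq_cscale by (rule cscale_in_cyl[OF that(1)]) (use that in simp)
  then obtain h where h: "holomorphic_several_on h ?P" "h 0 = 0" "\<And>z. z \<in> ?P \<Longrightarrow> Re (h z) = \<phi> (a + z) - \<phi> a"
    using pluriharmonic_eq_Re_holomorphic[OF ph \<Omega> open_cyl sub zero_in_cyl[OF rs]] by metis
  have he: "holomorphic_several_on (\<lambda>z. exp (c * h z)) ?P" for c
    by (rule holomorphic_several_on_compose[OF h(1)]) (intro holomorphic_intros)
  have nexp: "(cmod (exp (c * h z)))\<^sup>2 = exp (2 * Re (c * h z))" for c z
    by (simp add: power2_eq_square exp_add[symmetric])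
  \<comment> \<open>The weighted integrand of the extremal function is constant, which gives
    equality in the bound.\<close>
  have const: "(cmod (exp (1 / 2 * h z)))\<^sup>2 * exp (- \<phi> (a + z)) = exp (- \<phi> a)" if "z \<in> ?P" for z
    unfolding nexp exp_add[symmetric] using h(3)[OF that] by (simp add: diff_divide_distrib)
  have "admissible (\<lambda>z. \<phi> (a + z)) ?P (\<lambda>z. exp (1 / 2 * h z))"
    unfolding admissible_def
  proof (intro conjI he)
    have "(\<integral>\<^sup>+z\<in>?P. ennreal ((cmod (exp (1 / 2 * h z)))\<^sup>2 * exp (- \<phi> (a + z))) \<partial>lborel)
      = (\<integral>\<^sup>+z. ennreal (exp (- \<phi> a)) * indicator ?P z \<partial>lborel)"
      by (intro nn_integral_cong) (metis const indicator_simps(2) mult_zero_right)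
    also have "\<dots> = emeasure lborel ?P * ennreal (exp (- \<phi> (a + 0)))"
      by (simp add: nn_integral_cmult_indicator mult.commute)
    finally show "(\<integral>\<^sup>+z\<in>?P. ennreal ((cmod (exp (1 / 2 * h z)))\<^sup>2 * exp (- \<phi> (a + z))) \<partial>lborel)
      \<le> emeasure lborel ?P * ennreal (exp (- \<phi> (a + 0)))" by simp
  qed (simp add: h(2))
  moreover have "F z = exp (1 / 2 * h z)" if F: "admissible (\<lambda>z. \<phi> (a + z)) ?P F" and z: "z \<in> ?P" for F z
  proof -
    define g where "g z = F z * exp (- 1 / 2 * h z)" for z
    have hol: "holomorphic_several_on F ?P" and F0: "F 0 = 1"
      and le: "(\<integral>\<^sup>+z\<in>?P. ennreal ((cmod (F z))\<^sup>2 * exp (- \<phi> (a + z))) \<partial>lborel) \<le> emeasure lborel ?P * ennreal (exp (- \<phi> a))"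
      using F by (simp_all add: admissible_def)
    have cont: "continuous_on ?P (\<lambda>z. \<phi> (a + z))"
      by (rule continuous_on_compose2[OF \<phi>]) (use sub in \<open>auto intro!: continuous_intros\<close>)
    have meas: "(\<lambda>z. ennreal ((cmod (F z))\<^sup>2 * exp (- \<phi> (a + z))) * indicator ?P z) \<in> borel_measurable borel"
      using cont holomorphic_several_on_imp_continuous_on[OF hol]
      by (intro borel_measurable_ennreal_indicator open_cyl continuous_intros)
    \<comment> \<open>After division by the extremal function the weight becomes a constant, so the
      bound turns into an unweighted one.\<close>
    have eq: "(cmod (g z))\<^sup>2 = exp (\<phi> a) * ((cmod (F z))\<^sup>2 * exp (- \<phi> (a + z)))" if "z \<in> ?P" for z
    proof -
      have "2 * Re (- 1 / 2 * h z) = \<phi> a + - \<phi> (a + z)" using h(3)[OF that] by (simp add: diff_divide_distrib)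
      then show ?thesis
        unfolding g_def norm_mult power_mult_distrib nexp by (simp only: exp_add mult_ac)
    qed
    have "(\<integral>\<^sup>+z\<in>?P. ennreal ((cmod (g z))\<^sup>2) \<partial>lborel)
      = (\<integral>\<^sup>+z. ennreal (exp (\<phi> a)) * (ennreal ((cmod (F z))\<^sup>2 * exp (- \<phi> (a + z))) * indicator ?P z) \<partial>lborel)"
      by (intro nn_integral_cong) (simp add: indicator_def eq ennreal_mult)
    also have "\<dots> = ennreal (exp (\<phi> a)) * (\<integral>\<^sup>+z\<in>?P. ennreal ((cmod (F z))\<^sup>2 * exp (- \<phi> (a + z))) \<partial>lborel)"
      using meas by (intro nn_integral_cmult) simp
    also have "\<dots> \<le> ennreal (exp (\<phi> a)) * (emeasure lborel ?P * ennreal (exp (- \<phi> a)))"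
      by (intro mult_left_mono le) simp
    also have "\<dots> = emeasure lborel ?P"
      unfolding emeasure_cyl[OF w] by (simp add: ennreal_mult[symmetric] exp_minus)
    finally have le1: "(\<integral>\<^sup>+z\<in>?P. ennreal ((cmod (g z))\<^sup>2) \<partial>lborel) \<le> emeasure lborel ?P" .
    have "holomorphic_several_on g ?P"
      unfolding g_def[abs_def] by (rule holomorphic_several_on_mult[OF hol he])
    moreover have "g 0 = 1" by (simp add: g_def F0 h(2))
    ultimately have "g z = 1" by (rule holomorphic_mean_square_le_imp_one[OF w _ _ le1 z])
    then show ?thesis
      by (simp add: g_def exp_minus field_simps)
  qed
  ultimately show ?thesis unfolding unique_admissible_def by metis
qed

lemma unique_admissible_imp_pluriharmonic:
  fixes \<phi> :: "complex ^ 'n \<Rightarrow> real"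
  assumes \<Omega>: "open \<Omega>" and \<phi>: "continuous_on \<Omega> \<phi>" and unq: "unique_admissible_on \<phi> \<Omega>"
  shows "pluriharmonic_on \<phi> \<Omega>"
proof -
  note mean = circle_mean[OF \<Omega> \<phi> unq]
  have C2: "C2_on \<phi> \<Omega>" using circle_mean_imp_C2[OF \<Omega> \<phi>] mean by blast
  then obtain f' f'' where f: "\<And>z. z \<in> \<Omega> \<Longrightarrow> (\<phi> has_derivative blinfun_apply (f' z)) (at z)"
    "\<And>z. z \<in> \<Omega> \<Longrightarrow> (f' has_derivative blinfun_apply (f'' z)) (at z)"
    unfolding C2_on_def by (elim exE conjE) (rule that, auto)
  have "wirtinger j (wirtinger_bar k (\<lambda>w. complex_of_real (\<phi> w))) z = 0" if z: "z \<in> \<Omega>" for z j k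
  proof -
    let ?B = "\<lambda>u v. f'' z u v"
    have sym: "?B u v = ?B v u" for u v
      by (rule second_derivative_symmetric[OF \<Omega> z f(1) f(2)[OF z]])
    have trace: "?B v v + ?B (\<i> *s v) (\<i> *s v) = 0" for v
      using circle_mean_imp_trace_zero[OF \<Omega> z f(1) f(2)[OF z]] mean by blast
    \<comment> \<open>Polarisation: the circle means control the form on the diagonal only.\<close>
    have pol: "?B u v + ?B (\<i> *s u) (\<i> *s v) = 0" for u v
      using trace[of "u + v"] trace[of u] trace[of v] sym[of v u] sym[of "\<i> *s v" "\<i> *s u"]
      by (simp add: vector_add_ldistrib blinfun.add_left blinfun.add_right)
    have "\<i> *s axis k \<i> = - axis k (1::complex)" by (simp add: vec_eq_iff axis_def)
    \<comment> \<open>Since \<open>\<i>\<close> times \<open>axis k \<i>\<close> is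
      \<open>- axis k 1\<close>, the polarised identity at this pair is the vanishing of the
      imaginary part of the Levi form.\<close>
    then have "?B (axis j 1) (axis k \<i>) = ?B (axis j \<i>) (axis k 1)"
      using pol[of "axis j 1" "axis k \<i>"] by (simp add: axis_imaginary[symmetric] blinfun.minus_right)
    moreover have "?B (axis j 1) (axis k 1) + ?B (axis j \<i>) (axis k \<i>) = 0"
      using pol[of "axis j 1" "axis k 1"] by (simp add: axis_imaginary[symmetric])
    ultimately show ?thesis
      using wirtinger_wirtinger_bar[OF \<Omega> z f(1) f(2)[OF z], of j k] by simp
  qed
  then show ?thesis using C2 by (simp add: pluriharmonic_on_def)
qed

theorem theorem1p2:
  fixes \<Omega> :: "(complex ^ 'n) set" and \<phi> :: "complex ^ 'n \<Rightarrow> real" and p :: 'n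
  assumes "cdomain \<Omega>" and "continuous_on \<Omega> \<phi>"
  shows "pluriharmonic_on \<phi> \<Omega> \<longleftrightarrow>
    (\<forall>a\<in>\<Omega>. \<forall>r>0. \<forall>s>0. \<forall>A\<in>unitary_group.
       (+) a ` holomorphic_cylinder p r s A \<subseteq> \<Omega> \<longrightarrow>
       (\<exists>!f. f \<in> extensional ((+) a ` holomorphic_cylinder p r s A) \<and>
             holomorphic_several_on f ((+) a ` holomorphic_cylinder p r s A) \<and>
             f a = 1 \<and>
             (\<integral>\<^sup>+ z \<in> (+) a ` holomorphic_cylinder p r s A.
                 ennreal ((cmod (f z))\<^sup>2 * exp (- \<phi> z)) \<partial>lborel)
               \<le> emeasure lborel (holomorphic_cylinder p r s A) * ennreal (exp (- \<phi> a))))"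
    (is "_ \<longleftrightarrow> (\<forall>a\<in>\<Omega>. \<forall>r>0. \<forall>s>0. \<forall>A\<in>unitary_group. ?sub a r s A \<longrightarrow> ?ex1 a r s A)")
proof -
  have \<Omega>: "open \<Omega>" using assms(1) by (simp add: cdomain_def)
  have norm_column: "norm (A *v axis p 1) = 1" if "A \<in> unitary_group" for A :: "complex ^ 'n ^ 'n"
    by (simp add: norm_unitary[OF that])
  have ex1_iff: "?ex1 a r s A \<longleftrightarrow> unique_admissible (\<lambda>z. \<phi> (a + z)) (cyl (A *v axis p 1) r s)"
    if "0 < r" "0 < s" "A \<in> unitary_group" "(+) a ` cyl (A *v axis p 1) r s \<subseteq> \<Omega>" for a r s A
    unfolding holomorphic_cylinder_eq_cyl[OF that(3)]
    by (rule ex1_iff_unique_admissible[OF open_cyl zero_in_cyl[OF that(1,2)] continuous_on_subset[OF assms(2) that(4)]])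
  show ?thesis
  proof (intro iffI ballI allI impI)
    fix a r s A
    assume ph: "pluriharmonic_on \<phi> \<Omega>" and rsA: "0 < r" "0 < s" "A \<in> unitary_group" and sub: "?sub a r s A"
    have sub': "(+) a ` cyl (A *v axis p 1) r s \<subseteq> \<Omega>"
      using sub unfolding holomorphic_cylinder_eq_cyl[OF rsA(3)] .
    show "?ex1 a r s A"
      unfolding ex1_iff[OF rsA sub']
      by (rule pluriharmonic_imp_unique_admissible[OF ph \<Omega> assms(2) norm_column[OF rsA(3)] rsA(1,2) sub'])
  next
    assume R: "\<forall>a\<in>\<Omega>. \<forall>r>0. \<forall>s>0. \<forall>A\<in>unitary_group. ?sub a r s A \<longrightarrow> ?ex1 a r s A"
    have "unique_admissible_on \<phi> \<Omega>"
      unfolding unique_admissible_on_def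
    proof (intro ballI allI impI)
      fix a w r s
      assume a: "a \<in> \<Omega>" and w: "norm w = 1" and rs: "0 < r" "0 < s" and sub: "(+) a ` cyl w r s \<subseteq> \<Omega>"
      \<comment> \<open>Every unit vector is the image of \<open>axis p 1\<close> under some unitary
        matrix, so the hypothesis reaches every cylinder \<open>cyl w r s\<close>.\<close>
      obtain A where A: "A \<in> unitary_group" "A *v axis p 1 = w" using unitary_with_column[OF w] .
      have "?sub a r s A" using sub unfolding holomorphic_cylinder_eq_cyl[OF A(1)] A(2) .
      from R[rule_format, OF a rs A(1) this] have ex1: "?ex1 a r s A" .
      have "(+) a ` cyl (A *v axis p 1) r s \<subseteq> \<Omega>" using sub unfolding A(2) .
      from iffD1[OF ex1_iff[OF rs A(1) this] ex1]
      show "unique_admissible (\<lambda>z. \<phi> (a + z)) (cyl w r s)" unfolding A(2) .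
    qed
    then show "pluriharmonic_on \<phi> \<Omega>"
      by (rule unique_admissible_imp_pluriharmonic[OF \<Omega> assms(2)])
  qed
qed

end
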